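(* Let $(M,w)$ be a Poisson manifold. The quantum de Rham cohomology $Q_hH^*_{dR}(M)$, with the product $\wedge_h$ induced from the quantum exterior product of forms, satisfies $$\alpha\wedge_h\beta=(-1)^{|\alpha||\beta|}\beta\wedge_h\alpha,\qquad(\alpha\wedge_h\beta)\wedge_h\gamma=\alpha\wedge_h(\beta\wedge_h\gamma)$$ for $\alpha,\beta,\gamma\in Q_hH^*_{dR}(M)$ (homogeneous in the first identity). Similar results hold for the Laurent quantum de Rham cohomology: the same two identities hold for all $\alpha,\beta,\gamma\in Q_{h,h^{-1}}H^*_{dR}(M)$ (homogeneous in the first identity).
   Context: A Poisson manifold $(M,w)$ is a smooth manifold with a bivector field $w$ whose Schouten–Nijenhuis bracket with itself vanishes. In a local frame $\{e_i\}$ of $TM$ with dual frame $\{e^i\}$, $(w^{ij})$ is the skew-symmetric matrix $w^{ij}=w(e^i,e^j)$; repeated indices are summed over all values. For a vector $v$ and a $k$-form $\alpha$, $(v\vdash\alpha)(v_1,\dots,v_{k-1})=\alpha(v,v_1,\dots,v_{k-1})$ and $(\alpha\dashv v)(v_1,\dots,v_{k-1})=\alpha(v_1,\dots,v_{k-1},v)$. The quantum exterior product of forms is $$\alpha\wedge_h\beta=\sum_{n\ge0}\frac{h^n}{n!}w^{i_1j_1}\cdots w^{i_nj_n}(\alpha\dashv e_{i_1}\dashv\cdots\dashv e_{i_n})\wedge(e_{j_n}\vdash\cdots\vdash e_{j_1}\vdash\beta)$$ (contractions with $e_{i_1}$, $e_{j_1}$ are performed first), extended bilinearly over $\mathbb{R}[h]$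 to $\Omega(M)[h]$ and over $\mathbb{R}[h,h^{-1}]$ to $\Omega(M)[h,h^{-1}]$. With $w\vdash\alpha=\tfrac12w^{ij}\,e_i\vdash(e_j\vdash\alpha)$, Koszul's operator is $\delta\alpha=w\vdash d\alpha-d(w\vdash\alpha)$, and $d_h=d-h\delta$ is the quantum exterior differential; it satisfies $d_h^2=0$ and is a graded derivation of $\wedge_h$. Quantum de Rham cohomology is $Q_hH^*_{dR}(M)=\ker d_h/\operatorname{Im}d_h$ for $d_h$ on $\Omega(M)[h]$; Laurent quantum de Rham cohomology is $Q_{h,h^{-1}}H^*_{dR}(M)=\ker d_h/\operatorname{Im}d_h$ for $d_h$ on $\Omega(M)[h,h^{-1}]$. Since $d_h$ is a graded derivation, $\wedge_h$ descends to both. The variable $h$ has degree $2$, forms have their usual degree, and $|\alpha|$ is the degree of a homogeneous class. *)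

theory Defs
  imports "HOL-Analysis.Analysis"
begin

section \<open>Smooth maps\<close>

text \<open>
  The model space of a manifold is a real inner product space \<open>'e\<close> together with a finite
  orthonormal basis \<open>E\<close>, that is, a copy of \<open>\<real>\<^sup>n\<close> with its standard basis, \<open>n = card E\<close>.
  The class \<open>euclidean_space\<close> is not used because it excludes \<open>n = 0\<close>.
\<close>

definition orthonormal_basis :: "'e::real_inner set \<Rightarrow> bool" where
  "orthonormal_basis E \<longleftrightarrow>
     finite E \<and> (\<forall>a\<in>E. \<forall>b\<in>E. a \<bullet> b = (if a = b then 1 else 0)) \<and> span E = UNIV"

primrec Ck_on ::
  "nat \<Rightarrow> 'a::real_normed_vector set \<Rightarrow> ('a \<Rightarrow> 'b::real_normed_vector) \<Rightarrow> bool" where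
  "Ck_on 0 S f \<longleftrightarrow> continuous_on S f"
| "Ck_on (Suc k) S f \<longleftrightarrow>
     (\<forall>x\<in>S. f differentiable (at x)) \<and> (\<forall>v. Ck_on k S (\<lambda>x. frechet_derivative f (at x) v))"

text \<open>Only meaningful for open \<open>S\<close> and a finite-dimensional domain.\<close>

definition smooth_on ::
  "'a::real_normed_vector set \<Rightarrow> ('a \<Rightarrow> 'b::real_normed_vector) \<Rightarrow> bool" where
  "smooth_on S f \<longleftrightarrow> (\<forall>k. Ck_on k S f)"


section \<open>Exterior algebra\<close>

text \<open>
  An element of the exterior algebra is a function on lists of vectors whose restriction to
  the lists of length \<open>k\<close> is its component of degree \<open>k\<close>. The same representation, with
  vectors replaced by covectors, serves for multivectors.
\<close>

definition alternating_multilinear :: "('v::real_vector list \<Rightarrow> real) \<Rightarrow> bool" where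
  "alternating_multilinear f \<longleftrightarrow>
     (\<forall>us vs. linear (\<lambda>v. f (us @ v # vs))) \<and> (\<forall>vs. \<not> distinct vs \<longrightarrow> f vs = 0)"

text \<open>
  \<open>(\<alpha> \<and> \<beta>)(v\<^sub>1,\<dots>,v\<^sub>m) = \<Sum> sgn(\<sigma>) \<alpha>(v\<^sub>\<sigma>\<^sub>1,\<dots>,v\<^sub>\<sigma>\<^sub>p) \<beta>(v\<^sub>\<sigma>\<^sub>(\<^sub>p\<^sub>+\<^sub>1\<^sub>),\<dots>,v\<^sub>\<sigma>\<^sub>m)\<close>, the sum being over all \<open>p\<close> and
  all \<open>(p, m - p)\<close>-shuffles \<open>\<sigma>\<close>. A shuffle is given by the set \<open>I\<close> of positions fed to
  \<open>\<alpha>\<close>, and its sign counts the inversions. There is no factorial normalisation, so that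
  contraction with a vector in the first slot is an antiderivation.
\<close>

definition wedge :: "('v list \<Rightarrow> real) \<Rightarrow> ('v list \<Rightarrow> real) \<Rightarrow> 'v list \<Rightarrow> real" where
  "wedge \<alpha> \<beta> vs =
     (\<Sum>I\<in>Pow {..<length vs}.
        (-1) ^ card {(i, j). i \<in> I \<and> j \<in> {..<length vs} - I \<and> j < i}
        * \<alpha> (nths vs I) * \<beta> (nths vs ({..<length vs} - I)))"

definition lcontr :: "'v \<Rightarrow> ('v list \<Rightarrow> real) \<Rightarrow> 'v list \<Rightarrow> real" where
  "lcontr v \<alpha> vs = \<alpha> (v # vs)"

definition rcontr :: "'v \<Rightarrow> ('v list \<Rightarrow> real) \<Rightarrow> 'v list \<Rightarrow> real" where
  "rcontr v \<alpha> vs = \<alpha> (vs @ [v])"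


section \<open>Smooth manifolds, differential forms, multivector fields\<close>

type_synonym ('m, 'e) chart = "'m set \<times> ('m \<Rightarrow> 'e)"

definition chart_image :: "('m, 'e) chart \<Rightarrow> 'e set" where
  "chart_image c = snd c ` fst c"

definition chart_inv :: "('m, 'e) chart \<Rightarrow> 'e \<Rightarrow> 'm" where
  "chart_inv c = inv_into (fst c) (snd c)"

definition overlap :: "('m, 'e) chart \<Rightarrow> ('m, 'e) chart \<Rightarrow> 'e set" where
  "overlap c c' = snd c ` (fst c \<inter> fst c')"

definition transition :: "('m, 'e) chart \<Rightarrow> ('m, 'e) chart \<Rightarrow> 'e \<Rightarrow> 'e" where
  "transition c c' = snd c' \<circ> chart_inv c"

text \<open>
  The manifold is \<open>M\<close>, the union of the chart domains; as an open subset of a second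
  countable Hausdorff space it is itself second countable and Hausdorff.
\<close>

definition smooth_manifold ::
  "'e::real_inner set \<Rightarrow> 'm::{t2_space,second_countable_topology} set \<Rightarrow>
   ('m, 'e) chart set \<Rightarrow> bool" where
  "smooth_manifold E M \<A> \<longleftrightarrow>
     orthonormal_basis E \<and>
     M = (\<Union>c\<in>\<A>. fst c) \<and>
     (\<forall>c\<in>\<A>. open (fst c) \<and> open (chart_image c) \<and>
            homeomorphism (fst c) (chart_image c) (snd c) (chart_inv c)) \<and>
     (\<forall>c\<in>\<A>. \<forall>c'\<in>\<A>. smooth_on (overlap c c') (transition c c'))"

text \<open>
  A differential form (possibly of mixed degree) is the family of its local expressions
  \<open>\<alpha> c x\<close> at the points \<open>x\<close> of the chart images, related on overlaps by pullback along the
  transition maps. Values outside the atlas and outside the chart images are 0, so that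
  equality of forms is equality of functions.
\<close>

type_synonym ('m, 'e) form = "('m, 'e) chart \<Rightarrow> 'e \<Rightarrow> 'e list \<Rightarrow> real"

definition diff_form ::
  "('m, 'e::real_inner) chart set \<Rightarrow> ('m, 'e) form \<Rightarrow> bool" where
  "diff_form \<A> \<alpha> \<longleftrightarrow>
     (\<forall>c x vs. c \<notin> \<A> \<or> x \<notin> chart_image c \<longrightarrow> \<alpha> c x vs = 0) \<and>
     (\<forall>c\<in>\<A>. \<forall>x\<in>chart_image c. alternating_multilinear (\<alpha> c x)) \<and>
     (\<forall>c\<in>\<A>. \<forall>vs. smooth_on (chart_image c) (\<lambda>x. \<alpha> c x vs)) \<and>
     (\<forall>c\<in>\<A>. \<forall>c'\<in>\<A>. \<forall>x\<in>overlap c c'. \<forall>vs.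
        \<alpha> c x vs = \<alpha> c' (transition c c' x)
                       (map (frechet_derivative (transition c c') (at x)) vs))"

type_synonym 'e covector = "'e \<Rightarrow>\<^sub>L real"

type_synonym ('m, 'e) mvfield = "('m, 'e) chart \<Rightarrow> 'e \<Rightarrow> 'e covector list \<Rightarrow> real"

text \<open>Multivector fields of degree \<open>p\<close>, related on overlaps by pushforward.\<close>

definition multivector_field ::
  "('m, 'e::real_inner) chart set \<Rightarrow> nat \<Rightarrow> ('m, 'e) mvfield \<Rightarrow> bool" where
  "multivector_field \<A> p P \<longleftrightarrow>
     (\<forall>c\<in>\<A>. \<forall>x\<in>chart_image c. alternating_multilinear (P c x)
            \<and> (\<forall>\<xi>s. length \<xi>s \<noteq> p \<longrightarrow> P c x \<xi>s = 0)) \<and>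
     (\<forall>c\<in>\<A>. \<forall>\<xi>s. smooth_on (chart_image c) (\<lambda>x. P c x \<xi>s)) \<and>
     (\<forall>c\<in>\<A>. \<forall>c'\<in>\<A>. \<forall>x\<in>overlap c c'. \<forall>\<xi>s.
        P c' (transition c c' x) \<xi>s =
        P c x (map (\<lambda>\<xi>. \<xi> o\<^sub>L Blinfun (frechet_derivative (transition c c') (at x))) \<xi>s))"

definition dual :: "'e::real_inner \<Rightarrow> 'e covector" where
  "dual = blinfun_inner_left"

text \<open>
  Coordinate expression of the Schouten-Nijenhuis bracket of multivector fields of degrees
  \<open>p\<close> and \<open>q\<close>:
  \<open>[P, Q] = \<Sum>\<^sub>l (P \<stileturn> e\<^sup>l) \<and> \<partial>\<^sub>l Q - (-1)\<^sup>(\<^sup>p\<^sup>-\<^sup>1\<^sup>)\<^sup>(\<^sup>q\<^sup>-\<^sup>1\<^sup>) (Q \<stileturn> e\<^sup>l) \<and> \<partial>\<^sub>l P\<close>,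
  which is the Lie bracket for \<open>p = q = 1\<close>. The exponent \<open>(p + 1) * (q + 1)\<close> has the parity
  of \<open>(p - 1)(q - 1)\<close> and avoids truncated subtraction.
\<close>

definition schouten ::
  "'e::real_inner set \<Rightarrow> nat \<Rightarrow> nat \<Rightarrow>
   ('e \<Rightarrow> 'e covector list \<Rightarrow> real) \<Rightarrow> ('e \<Rightarrow> 'e covector list \<Rightarrow> real) \<Rightarrow>
   'e \<Rightarrow> 'e covector list \<Rightarrow> real" where
  "schouten E p q P Q x \<xi>s =
     (\<Sum>b\<in>E. wedge (rcontr (dual b) (P x))
                   (\<lambda>\<eta>s. frechet_derivative (\<lambda>y. Q y \<eta>s) (at x) b) \<xi>s
             - (-1) ^ ((p + 1) * (q + 1))
               * wedge (rcontr (dual b) (Q x))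
                   (\<lambda>\<eta>s. frechet_derivative (\<lambda>y. P y \<eta>s) (at x) b) \<xi>s)"

definition poisson_manifold ::
  "'e::real_inner set \<Rightarrow> 'm::{t2_space,second_countable_topology} set \<Rightarrow>
   ('m, 'e) chart set \<Rightarrow> ('m, 'e) mvfield \<Rightarrow> bool" where
  "poisson_manifold E M \<A> w \<longleftrightarrow>
     smooth_manifold E M \<A> \<and> multivector_field \<A> 2 w \<and>
     (\<forall>c\<in>\<A>. \<forall>x\<in>chart_image c. \<forall>\<xi>s. schouten E 2 2 (w c) (w c) x \<xi>s = 0)"


section \<open>Exterior differential and Koszul's operator\<close>

text \<open>\<open>d\<alpha>(v\<^sub>0,\<dots>,v\<^sub>k) = \<Sum>\<^sub>i (-1)\<^sup>i (D\<alpha> v\<^sub>i)(v\<^sub>0,\<dots>,v\<^sub>k)\<close> with \<open>v\<^sub>i\<close> omitted, in a chart.\<close>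

definition ext_d :: "('m, 'e::real_inner) chart set \<Rightarrow> ('m, 'e) form \<Rightarrow> ('m, 'e) form" where
  "ext_d \<A> \<alpha> c x vs =
     (if c \<in> \<A> \<and> x \<in> chart_image c
      then \<Sum>i<length vs. (-1) ^ i
             * frechet_derivative (\<lambda>y. \<alpha> c y (take i vs @ drop (Suc i) vs)) (at x) (vs ! i)
      else 0)"

definition biv_contr ::
  "'e::real_inner set \<Rightarrow> ('m, 'e) mvfield \<Rightarrow> ('m, 'e) form \<Rightarrow> ('m, 'e) form" where
  "biv_contr E w \<alpha> c x vs =
     (1/2) * (\<Sum>a\<in>E. \<Sum>b\<in>E. w c x [dual a, dual b] * lcontr a (lcontr b (\<alpha> c x)) vs)"

definition koszul ::
  "'e::real_inner set \<Rightarrow> ('m, 'e) chart set \<Rightarrow> ('m, 'e) mvfield \<Rightarrow> ('m, 'e) form \<Rightarrow> ('m, 'e) form"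
  where
  "koszul E \<A> w \<alpha> c x vs =
     biv_contr E w (ext_d \<A> \<alpha>) c x vs - ext_d \<A> (biv_contr E w \<alpha>) c x vs"


section \<open>The quantum exterior product and differential\<close>

text \<open>
  An element of \<open>\<Omega>(M)[h,h\<^sup>-\<^sup>1]\<close> is the function giving the coefficient of each power of \<open>h\<close>;
  \<open>\<Omega>(M)[h]\<close> is the subset with vanishing coefficients at negative powers.
\<close>

type_synonym ('m, 'e) hform = "int \<Rightarrow> ('m, 'e) form"

definition hsupp :: "('m, 'e) hform \<Rightarrow> int set" where
  "hsupp \<alpha> = {n. \<alpha> n \<noteq> (\<lambda>c x vs. 0)}"

definition Omega_laurent :: "('m, 'e::real_inner) chart set \<Rightarrow> ('m, 'e) hform set" where
  "Omega_laurent \<A> = {\<alpha>. finite (hsupp \<alpha>) \<and> (\<forall>n. diff_form \<A> (\<alpha> n))}"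

definition Omega_poly :: "('m, 'e::real_inner) chart set \<Rightarrow> ('m, 'e) hform set" where
  "Omega_poly \<A> = {\<alpha> \<in> Omega_laurent \<A>. hsupp \<alpha> \<subseteq> {0..}}"

definition hadd :: "('m, 'e) hform \<Rightarrow> ('m, 'e) hform \<Rightarrow> ('m, 'e) hform" where
  "hadd \<alpha> \<beta> = (\<lambda>n c x vs. \<alpha> n c x vs + \<beta> n c x vs)"

definition hscale :: "real \<Rightarrow> ('m, 'e) hform \<Rightarrow> ('m, 'e) hform" where
  "hscale r \<alpha> = (\<lambda>n c x vs. r * \<alpha> n c x vs)"

text \<open>
  The coefficient of \<open>h\<^sup>n\<close> in the quantum exterior product of two forms, at a point. The lists
  \<open>I = [i\<^sub>1,\<dots>,i\<^sub>n]\<close> and \<open>J = [j\<^sub>1,\<dots>,j\<^sub>n]\<close> range over basis vectors; \<open>fold\<close> contracts with the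
  head of the list first.
\<close>

definition qwedge_coeff ::
  "'e::real_inner set \<Rightarrow> ('e covector list \<Rightarrow> real) \<Rightarrow> nat \<Rightarrow>
   ('e list \<Rightarrow> real) \<Rightarrow> ('e list \<Rightarrow> real) \<Rightarrow> 'e list \<Rightarrow> real" where
  "qwedge_coeff E w n \<alpha> \<beta> vs =
     (1 / fact n) *
     (\<Sum>I | set I \<subseteq> E \<and> length I = n. \<Sum>J | set J \<subseteq> E \<and> length J = n.
        (\<Prod>k<n. w [dual (I ! k), dual (J ! k)])
        * wedge (fold rcontr I \<alpha>) (fold lcontr J \<beta>) vs)"

definition qwedge ::
  "'e::real_inner set \<Rightarrow> ('m, 'e) mvfield \<Rightarrow> ('m, 'e) hform \<Rightarrow> ('m, 'e) hform \<Rightarrow> ('m, 'e) hform"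
  where
  "qwedge E w \<alpha> \<beta> n c x vs =
     (\<Sum>p\<in>hsupp \<alpha>. \<Sum>q\<in>hsupp \<beta>.
        if p + q \<le> n then qwedge_coeff E (w c x) (nat (n - p - q)) (\<alpha> p c x) (\<beta> q c x) vs
        else 0)"

definition qd ::
  "'e::real_inner set \<Rightarrow> ('m, 'e) chart set \<Rightarrow> ('m, 'e) mvfield \<Rightarrow> ('m, 'e) hform \<Rightarrow> ('m, 'e) hform"
  where
  "qd E \<A> w \<alpha> n c x vs = ext_d \<A> (\<alpha> n) c x vs - koszul E \<A> w (\<alpha> (n - 1)) c x vs"

text \<open>\<open>h\<close> has degree 2, so the coefficient of \<open>h\<^sup>n\<close> is a form of degree \<open>m - 2n\<close>.\<close>

definition homogeneous :: "int \<Rightarrow> ('m, 'e) hform \<Rightarrow> bool" where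
  "homogeneous m \<alpha> \<longleftrightarrow> (\<forall>n c x vs. \<alpha> n c x vs \<noteq> 0 \<longrightarrow> int (length vs) = m - 2 * n)"


section \<open>Quantum de Rham cohomology\<close>

text \<open>
  Here \<open>S\<close> is \<open>\<Omega>(M)[h]\<close> or \<open>\<Omega>(M)[h,h\<^sup>-\<^sup>1]\<close>. Cohomology classes are cosets of the image of the
  quantum differential, and the operations on them are formed from all
  representatives, as for \<open>rcoset_mult\<close> in quotient rings of HOL-Algebra.
\<close>

definition qclass ::
  "'e::real_inner set \<Rightarrow> ('m, 'e) chart set \<Rightarrow> ('m, 'e) mvfield \<Rightarrow> ('m, 'e) hform set \<Rightarrow>
   ('m, 'e) hform \<Rightarrow> ('m, 'e) hform set" where
  "qclass E \<A> w S \<alpha> = (\<lambda>\<gamma>. hadd \<alpha> (qd E \<A> w \<gamma>)) ` S"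

definition qcohomology ::
  "'e::real_inner set \<Rightarrow> ('m, 'e) chart set \<Rightarrow> ('m, 'e) mvfield \<Rightarrow> ('m, 'e) hform set \<Rightarrow>
   ('m, 'e) hform set set" where
  "qcohomology E \<A> w S = qclass E \<A> w S ` {\<alpha> \<in> S. qd E \<A> w \<alpha> = (\<lambda>n c x vs. 0)}"

definition cup ::
  "'e::real_inner set \<Rightarrow> ('m, 'e) chart set \<Rightarrow> ('m, 'e) mvfield \<Rightarrow> ('m, 'e) hform set \<Rightarrow>
   ('m, 'e) hform set \<Rightarrow> ('m, 'e) hform set \<Rightarrow> ('m, 'e) hform set" where
  "cup E \<A> w S \<alpha> \<beta> = (\<Union>a\<in>\<alpha>. \<Union>b\<in>\<beta>. qclass E \<A> w S (qwedge E w a b))"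

definition class_scale ::
  "'e::real_inner set \<Rightarrow> ('m, 'e) chart set \<Rightarrow> ('m, 'e) mvfield \<Rightarrow> ('m, 'e) hform set \<Rightarrow>
   real \<Rightarrow> ('m, 'e) hform set \<Rightarrow> ('m, 'e) hform set" where
  "class_scale E \<A> w S r \<alpha> = (\<Union>a\<in>\<alpha>. qclass E \<A> w S (hscale r a))"

definition class_degree :: "int \<Rightarrow> ('m, 'e) hform set \<Rightarrow> bool" where
  "class_degree m \<alpha> \<longleftrightarrow> (\<exists>a\<in>\<alpha>. homogeneous m a)"

definition QH_poly ::
  "'e::real_inner set \<Rightarrow> ('m, 'e) chart set \<Rightarrow> ('m, 'e) mvfield \<Rightarrow> ('m, 'e) hform set set" where
  "QH_poly E \<A> w = qcohomology E \<A> w (Omega_poly \<A>)"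

definition QH_laurent ::
  "'e::real_inner set \<Rightarrow> ('m, 'e) chart set \<Rightarrow> ('m, 'e) mvfield \<Rightarrow> ('m, 'e) hform set set" where
  "QH_laurent E \<A> w = qcohomology E \<A> w (Omega_laurent \<A>)"

definition cup_poly ::
  "'e::real_inner set \<Rightarrow> ('m, 'e) chart set \<Rightarrow> ('m, 'e) mvfield \<Rightarrow>
   ('m, 'e) hform set \<Rightarrow> ('m, 'e) hform set \<Rightarrow> ('m, 'e) hform set" where
  "cup_poly E \<A> w = cup E \<A> w (Omega_poly \<A>)"

definition cup_laurent ::
  "'e::real_inner set \<Rightarrow> ('m, 'e) chart set \<Rightarrow> ('m, 'e) mvfield \<Rightarrow>
   ('m, 'e) hform set \<Rightarrow> ('m, 'e) hform set \<Rightarrow> ('m, 'e) hform set" where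
  "cup_laurent E \<A> w = cup E \<A> w (Omega_laurent \<A>)"

end

theory Submission
  imports Defs
begin

text \<open>
  Let \<open>J\<close> be contraction with the bivector and, for an operation \<open>B\<close> on forms, let \<open>ad B\<close> be the
  defect \<open>B(J \<alpha>, \<beta>) + B(\<alpha>, J \<beta>) - J B(\<alpha>, \<beta>)\<close>. The product of order \<open>n\<close>, that is \<open>n!\<close> times the
  coefficient of \<open>h\<^sup>n\<close> in the quantum exterior product, is \<open>ad\<^sup>n\<close> applied to the wedge product.
  So graded commutativity, associativity and invariance under changes of charts pass from the
  wedge product to the quantum product by induction on \<open>n\<close>. Since \<open>\<delta> = [J, d]\<close>, and since
  \<open>[J, \<delta>] = 0\<close> is the Jacobi identity for the bivector, the same induction turns the Leibniz rule
  for \<open>d\<close> into the one for \<open>d - h \<delta>\<close>, and \<open>d\<^sup>2 = 0\<close> gives \<open>(d - h \<delta>)\<^sup>2 = 0\<close>. Hence the product is well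
  defined on cohomology and inherits both identities.
\<close>

section \<open>Calculus of smooth functions\<close>

text \<open>Formally the quantum structure is the classical one conjugated by
  \<open>exp (h J)\<close>. As \<open>ad\<close> is a signed sum of three commuting operations, the
  quantum product is \<open>exp (-h J) (exp (h J) \<alpha> \<and> exp (h J) \<beta>)\<close>; as
  \<open>[J, d] = \<delta>\<close> commutes with \<open>J\<close>, \<open>d - h \<delta>\<close> is
  \<open>exp (-h J) d exp (h J)\<close>. The inductions on \<open>n\<close> are this conjugation
  read off coefficient by coefficient. The Jacobi identity enters only through
  \<open>[J, \<delta>] = 0\<close>; commutativity and associativity use skewness alone. The analytic
  obstacle is the behaviour of \<open>d\<close> in charts: that \<open>d d = 0\<close> and that
  \<open>d\<close> commutes with pullback both rest on the symmetry of second derivatives.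
  Differentiating a pulled-back form twice is avoided by writing forms through coordinate
  differentials, whose pullbacks are exact. The algebra is induction on the list of arguments:
  contraction with the first argument is an antiderivation of the wedge product, and Cartan's
  formula is the corresponding rule for \<open>d\<close>.\<close>

lemma frechet_derivative_eq:
  assumes "(f has_derivative f') (at x)"
  shows "frechet_derivative f (at x) = f'"
  using frechet_derivative_at[OF assms] by simp

lemma frechet_derivative_add:
  assumes "f differentiable (at x)" "g differentiable (at x)"
  shows "frechet_derivative (\<lambda>y. f y + g y) (at x) v
    = frechet_derivative f (at x) v + frechet_derivative g (at x) v"
  using assms unfolding frechet_derivative_works
  by (simp add: frechet_derivative_eq[OF has_derivative_add])

lemma frechet_derivative_bounded_linear:
  assumes "bounded_linear L" "f differentiable (at x)"
  shows "frechet_derivative (\<lambda>y. L (f y)) (at x) v = L (frechet_derivative f (at x) v)"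
  using assms(2) unfolding frechet_derivative_works
  by (simp add: frechet_derivative_eq[OF bounded_linear.has_derivative[OF assms(1)]])

lemma frechet_derivative_cmult:
  fixes f :: "'a::real_normed_vector \<Rightarrow> real"
  assumes "f differentiable (at x)"
  shows "frechet_derivative (\<lambda>y. r * f y) (at x) v = r * frechet_derivative f (at x) v"
  by (rule frechet_derivative_bounded_linear[OF bounded_linear_mult_right assms])

lemma frechet_derivative_mult:
  fixes f g :: "'a::real_normed_vector \<Rightarrow> real"
  assumes "f differentiable (at x)" "g differentiable (at x)"
  shows "frechet_derivative (\<lambda>y. f y * g y) (at x) v
    = f x * frechet_derivative g (at x) v + frechet_derivative f (at x) v * g x"
  using assms unfolding frechet_derivative_works
  by (simp add: frechet_derivative_eq[OF has_derivative_mult])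

lemma frechet_derivative_sum:
  assumes "\<And>i. i \<in> I \<Longrightarrow> f i differentiable (at x)"
  shows "frechet_derivative (\<lambda>y. \<Sum>i\<in>I. f i y) (at x) v
    = (\<Sum>i\<in>I. frechet_derivative (f i) (at x) v)"
proof -
  have "((\<lambda>y. \<Sum>i\<in>I. f i y) has_derivative (\<lambda>v. \<Sum>i\<in>I. frechet_derivative (f i) (at x) v)) (at x)"
    using assms unfolding frechet_derivative_works by (rule has_derivative_sum)
  then show ?thesis by (simp add: frechet_derivative_eq)
qed

lemma frechet_derivative_cong_open:
  assumes "open S" "x \<in> S" "\<And>y. y \<in> S \<Longrightarrow> f y = g y"
  shows "frechet_derivative f (at x) = frechet_derivative g (at x)"
proof -
  have "(f has_derivative f') (at x) \<longleftrightarrow> (g has_derivative f') (at x)" for f'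
    using assms has_derivative_transform_within_open[of f f' x UNIV S g]
      has_derivative_transform_within_open[of g f' x UNIV S f] by auto
  then show ?thesis unfolding frechet_derivative_def by simp
qed

lemma differentiable_cong_open:
  assumes "open S" "x \<in> S" "\<And>y. y \<in> S \<Longrightarrow> f y = g y"
  shows "f differentiable (at x) \<longleftrightarrow> g differentiable (at x)"
  using assms has_derivative_transform_within_open[of f _ x UNIV S g]
    has_derivative_transform_within_open[of g _ x UNIV S f]
  unfolding differentiable_def by metis

text \<open>On an open set a derivative depends only on the values in the set. So the derivative of
  a sum or product can be replaced by its formula, which is known only where the functions are
  differentiable.\<close>

lemma Ck_on_cong:
  assumes "open S" "\<And>x. x \<in> S \<Longrightarrow> f x = g x"
  shows "Ck_on k S f \<longleftrightarrow> Ck_on k S g"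
  using assms(2)
proof (induction k arbitrary: f g)
  case 0
  then show ?case by (auto intro: continuous_on_cong[THEN iffD1])
next
  case (Suc k)
  have "frechet_derivative f (at x) v = frechet_derivative g (at x) v" if "x \<in> S" for x v
    using frechet_derivative_cong_open[OF assms(1) that Suc.prems] by simp
  then have "Ck_on k S (\<lambda>x. frechet_derivative f (at x) v) \<longleftrightarrow>
      Ck_on k S (\<lambda>x. frechet_derivative g (at x) v)" for v
    by (rule Suc.IH)
  then show ?case
    using differentiable_cong_open[OF assms(1) _ Suc.prems] by simp
qed

lemma Ck_on_SucD: "Ck_on (Suc k) S f \<Longrightarrow> Ck_on k S f"
proof (induction k arbitrary: f)
  case 0
  then show ?case
    by (auto intro!: differentiable_imp_continuous_within continuous_at_imp_continuous_on)
qed auto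

lemma Ck_on_const: "Ck_on k S (\<lambda>x. c)"
  by (induction k arbitrary: c) auto

lemma Ck_on_add:
  assumes "open S" "Ck_on k S f" "Ck_on k S g"
  shows "Ck_on k S (\<lambda>x. f x + g x)"
  using assms(2,3)
proof (induction k arbitrary: f g)
  case 0
  then show ?case by (simp add: continuous_on_add)
next
  case (Suc k)
  have "Ck_on k S (\<lambda>x. frechet_derivative (\<lambda>x. f x + g x) (at x) v)" for v
  proof -
    have "Ck_on k S (\<lambda>x. frechet_derivative f (at x) v + frechet_derivative g (at x) v)"
      using Suc by simp
    then show ?thesis
      using Suc.prems
      by (subst Ck_on_cong[OF assms(1), where g = "\<lambda>x. frechet_derivative f (at x) v + frechet_derivative g (at x) v"])
        (simp_all add: frechet_derivative_add)
  qed
  then show ?case using Suc.prems by simp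
qed

lemma Ck_on_bounded_linear:
  assumes "open S" "bounded_linear L" "Ck_on k S f"
  shows "Ck_on k S (\<lambda>x. L (f x))"
  using assms(3)
proof (induction k arbitrary: f)
  case 0
  then show ?case by (simp add: bounded_linear.continuous_on[OF assms(2)])
next
  case (Suc k)
  have "Ck_on k S (\<lambda>x. frechet_derivative (\<lambda>x. L (f x)) (at x) v)" for v
    using Suc
    by (subst Ck_on_cong[OF assms(1), where g = "\<lambda>x. L (frechet_derivative f (at x) v)"])
      (simp_all add: frechet_derivative_bounded_linear[OF assms(2)])
  moreover have "(\<lambda>x. L (f x)) differentiable (at x)" if "x \<in> S" for x
    using Suc.prems that bounded_linear.has_derivative[OF assms(2)]
    unfolding differentiable_def Ck_on.simps by blast
  ultimately show ?case by simp
qed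

lemma Ck_on_mult:
  fixes f g :: "'a::real_normed_vector \<Rightarrow> real"
  assumes "open S" "Ck_on k S f" "Ck_on k S g"
  shows "Ck_on k S (\<lambda>x. f x * g x)"
  using assms(2,3)
proof (induction k arbitrary: f g)
  case 0
  then show ?case by (simp add: continuous_on_mult)
next
  case (Suc k)
  have "Ck_on k S (\<lambda>x. frechet_derivative (\<lambda>x. f x * g x) (at x) v)" for v
  proof -
    \<comment> \<open>In each term of the product rule one factor stays undifferentiated, so its
      order is lowered by one before the induction hypothesis applies.\<close>
    have "Ck_on k S (\<lambda>x. f x * frechet_derivative g (at x) v + frechet_derivative f (at x) v * g x)"
      using Suc.prems Ck_on_SucD[OF Suc.prems(1)] Ck_on_SucD[OF Suc.prems(2)]
      by (intro Ck_on_add[OF assms(1)] Suc.IH) simp_all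
    then show ?thesis
      using Suc.prems
      by (subst Ck_on_cong[OF assms(1), where g = "\<lambda>x. f x * frechet_derivative g (at x) v + frechet_derivative f (at x) v * g x"])
        (simp_all add: frechet_derivative_mult)
  qed
  then show ?case using Suc.prems by (simp add: differentiable_mult)
qed

lemma smooth_on_cong:
  assumes "open S" "\<And>x. x \<in> S \<Longrightarrow> f x = g x"
  shows "smooth_on S f \<longleftrightarrow> smooth_on S g"
  unfolding smooth_on_def using Ck_on_cong[OF assms] by simp

lemma smooth_on_const: "smooth_on S (\<lambda>x. c)"
  by (simp add: smooth_on_def Ck_on_const)

lemma smooth_on_add:
  "open S \<Longrightarrow> smooth_on S f \<Longrightarrow> smooth_on S g \<Longrightarrow> smooth_on S (\<lambda>x. f x + g x)"
  by (simp add: smooth_on_def Ck_on_add)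

lemma smooth_on_bounded_linear:
  "open S \<Longrightarrow> bounded_linear L \<Longrightarrow> smooth_on S f \<Longrightarrow> smooth_on S (\<lambda>x. L (f x))"
  by (simp add: smooth_on_def Ck_on_bounded_linear)

lemma smooth_on_mult:
  fixes f g :: "'a::real_normed_vector \<Rightarrow> real"
  shows "open S \<Longrightarrow> smooth_on S f \<Longrightarrow> smooth_on S g \<Longrightarrow> smooth_on S (\<lambda>x. f x * g x)"
  by (simp add: smooth_on_def Ck_on_mult)

lemma smooth_on_cmult:
  fixes f :: "'a::real_normed_vector \<Rightarrow> real"
  shows "open S \<Longrightarrow> smooth_on S f \<Longrightarrow> smooth_on S (\<lambda>x. r * f x)"
  by (rule smooth_on_mult[OF _ smooth_on_const])

lemma smooth_on_sum:
  assumes "open S" "\<And>i. i \<in> I \<Longrightarrow> smooth_on S (f i)"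
  shows "smooth_on S (\<lambda>x. \<Sum>i\<in>I. f i x)"
  using assms(2)
  by (induction I rule: infinite_finite_induct) (auto intro: smooth_on_const smooth_on_add[OF assms(1)])

lemma smooth_on_frechet_derivative:
  "smooth_on S f \<Longrightarrow> smooth_on S (\<lambda>x. frechet_derivative f (at x) v)"
  unfolding smooth_on_def using Ck_on.simps(2) by blast

lemma smooth_on_imp_differentiable: "smooth_on S f \<Longrightarrow> x \<in> S \<Longrightarrow> f differentiable (at x)"
  unfolding smooth_on_def using Ck_on.simps(2) by blast

lemma smooth_on_imp_continuous_on: "smooth_on S f \<Longrightarrow> continuous_on S f"
  unfolding smooth_on_def using Ck_on.simps(1) by blast

lemma linear_frechet_derivative_smooth:
  "smooth_on S f \<Longrightarrow> x \<in> S \<Longrightarrow> linear (frechet_derivative f (at x))"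
  by (simp add: linear_frechet_derivative smooth_on_imp_differentiable)

section \<open>Symmetry of second derivatives\<close>

lemma has_real_derivative_along_line:
  fixes f :: "'a::real_normed_vector \<Rightarrow> real"
  assumes "f differentiable (at (p + s *\<^sub>R u))"
  shows "((\<lambda>s. f (p + s *\<^sub>R u)) has_real_derivative frechet_derivative f (at (p + s *\<^sub>R u)) u) (at s)"
proof -
  have "((\<lambda>s. p + s *\<^sub>R u) has_derivative (\<lambda>t. t *\<^sub>R u)) (at s)"
    by (auto intro!: derivative_eq_intros)
  moreover have "(f has_derivative frechet_derivative f (at (p + s *\<^sub>R u))) (at (p + s *\<^sub>R u))"
    using assms by (simp add: frechet_derivative_works)
  ultimately have "((\<lambda>s. f (p + s *\<^sub>R u)) has_derivative
      (\<lambda>t. frechet_derivative f (at (p + s *\<^sub>R u)) (t *\<^sub>R u))) (at s)"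
    by (rule has_derivative_compose)
  moreover have "frechet_derivative f (at (p + s *\<^sub>R u)) (t *\<^sub>R u)
      = frechet_derivative f (at (p + s *\<^sub>R u)) u * t" for t
    by (simp add: linear_scale[OF linear_frechet_derivative[OF assms]])
  ultimately show ?thesis by (simp add: has_field_derivative_def)
qed

text \<open>The mean value theorem is used twice: in direction \<open>u\<close> for the difference
  of \<open>f\<close> along two parallel edges, then in direction \<open>v\<close> for the resulting
  difference of derivatives. The second difference is symmetric in \<open>u\<close> and
  \<open>v\<close>, the right side is not visibly so.\<close>

lemma second_difference_mean_value:
  fixes f :: "'a::real_normed_vector \<Rightarrow> real"
  assumes f: "smooth_on S f" and "h > 0"
    and S: "\<And>s t. 0 \<le> s \<Longrightarrow> s \<le> h \<Longrightarrow> 0 \<le> t \<Longrightarrow> t \<le> h \<Longrightarrow> x + s *\<^sub>R u + t *\<^sub>R v \<in> S"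
  obtains s t where "0 < s" "s < h" "0 < t" "t < h"
    "f (x + h *\<^sub>R u + h *\<^sub>R v) - f (x + h *\<^sub>R u) - f (x + h *\<^sub>R v) + f x
     = h * h * frechet_derivative (\<lambda>y. frechet_derivative f (at y) u) (at (x + s *\<^sub>R u + t *\<^sub>R v)) v"
proof -
  let ?g = "\<lambda>y. frechet_derivative f (at y) u"
  have 1: "((\<lambda>s. f (x + t *\<^sub>R v + s *\<^sub>R u)) has_real_derivative ?g (x + s *\<^sub>R u + t *\<^sub>R v)) (at s)"
    if "0 \<le> s" "s \<le> h" "0 \<le> t" "t \<le> h" for s t
  proof -
    have "f differentiable (at (x + t *\<^sub>R v + s *\<^sub>R u))"
      using smooth_on_imp_differentiable[OF f S[OF that]] by (simp add: add_ac)
    from has_real_derivative_along_line[OF this] show ?thesis by (simp add: add_ac)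
  qed
  have "\<exists>s. 0 < s \<and> s < h \<and> (f (x + h *\<^sub>R v + h *\<^sub>R u) - f (x + 0 *\<^sub>R v + h *\<^sub>R u))
      - (f (x + h *\<^sub>R v + 0 *\<^sub>R u) - f (x + 0 *\<^sub>R v + 0 *\<^sub>R u))
      = (h - 0) * (?g (x + s *\<^sub>R u + h *\<^sub>R v) - ?g (x + s *\<^sub>R u + 0 *\<^sub>R v))"
    by (rule MVT2[OF \<open>0 < h\<close>]) (use \<open>0 < h\<close> in \<open>auto intro!: DERIV_diff 1 simp del: scaleR_zero_left\<close>)
  then obtain s where s: "0 < s" "s < h" and s_eq:
      "(f (x + h *\<^sub>R u + h *\<^sub>R v) - f (x + h *\<^sub>R u)) - (f (x + h *\<^sub>R v) - f x)
      = h * (?g (x + s *\<^sub>R u + h *\<^sub>R v) - ?g (x + s *\<^sub>R u))"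
    by (auto simp: add_ac)
  have "((\<lambda>t. ?g (x + s *\<^sub>R u + t *\<^sub>R v)) has_real_derivative
      frechet_derivative ?g (at (x + s *\<^sub>R u + t *\<^sub>R v)) v) (at t)" if "0 \<le> t" "t \<le> h" for t
    using s that
    by (intro has_real_derivative_along_line
        smooth_on_imp_differentiable[OF smooth_on_frechet_derivative[OF f]] S) auto
  then have "\<exists>t. 0 < t \<and> t < h \<and> ?g (x + s *\<^sub>R u + h *\<^sub>R v) - ?g (x + s *\<^sub>R u + 0 *\<^sub>R v)
      = (h - 0) * frechet_derivative ?g (at (x + s *\<^sub>R u + t *\<^sub>R v)) v"
    by (intro MVT2[OF \<open>0 < h\<close>]) auto
  then obtain t where "0 < t" "t < h" "?g (x + s *\<^sub>R u + h *\<^sub>R v) - ?g (x + s *\<^sub>R u)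
      = h * frechet_derivative ?g (at (x + s *\<^sub>R u + t *\<^sub>R v)) v"
    by auto
  with s s_eq show ?thesis by (intro that[of s t]) (auto simp: algebra_simps)
qed

text \<open>The second difference over a small parallelogram, divided by \<open>h * h\<close>, is a
  value of either mixed derivative at some nearby point. If these derivatives differed at
  \<open>x\<close>, continuity would keep such values apart.\<close>

lemma frechet_derivative_commute:
  fixes f :: "'a::real_normed_vector \<Rightarrow> real"
  assumes f: "smooth_on S f" and "open S" "x \<in> S"
  shows "frechet_derivative (\<lambda>y. frechet_derivative f (at y) u) (at x) v
       = frechet_derivative (\<lambda>y. frechet_derivative f (at y) v) (at x) u" (is "?F x = ?G x")
proof (rule ccontr)
  assume neq: "?F x \<noteq> ?G x"
  \<comment> \<open>Half the gap: a value within \<open>e\<close> of \<open>?F x\<close> cannot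
    equal one within \<open>e\<close> of \<open>?G x\<close>.\<close>
  define e where "e = \<bar>?F x - ?G x\<bar> / 2"
  have "e > 0" using neq by (simp add: e_def)
  have "continuous_on S ?F" "continuous_on S ?G"
    using f by (intro smooth_on_imp_continuous_on smooth_on_frechet_derivative; assumption)+
  then obtain d1 d2 where d: "d1 > 0" "d2 > 0"
    "\<And>y. y \<in> S \<Longrightarrow> dist y x < d1 \<Longrightarrow> dist (?F y) (?F x) < e"
    "\<And>y. y \<in> S \<Longrightarrow> dist y x < d2 \<Longrightarrow> dist (?G y) (?G x) < e"
    using \<open>x \<in> S\<close> \<open>e > 0\<close> unfolding continuous_on_iff by metis
  obtain d3 where d3: "d3 > 0" "\<And>y. dist y x < d3 \<Longrightarrow> y \<in> S"
    using \<open>open S\<close> \<open>x \<in> S\<close> unfolding open_dist by blast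
  define d where "d = min d1 (min d2 d3)"
  \<comment> \<open>The parallelogram then stays within \<open>d / 2\<close> of \<open>x\<close>;
    the summand 1 keeps the denominator positive when \<open>u\<close> and \<open>v\<close>
    vanish.\<close>
  define h where "h = d / 2 / (norm u + norm v + 1)"
  have "d > 0" using d d3 by (simp add: d_def)
  then have "h > 0" by (simp add: h_def add_nonneg_pos)
  have close: "dist (x + s *\<^sub>R u + t *\<^sub>R v) x < d" if "0 \<le> s" "s \<le> h" "0 \<le> t" "t \<le> h" for s t
  proof -
    have "dist (x + s *\<^sub>R u + t *\<^sub>R v) x = norm (s *\<^sub>R u + t *\<^sub>R v)"
      by (simp add: dist_norm add.assoc)
    also have "\<dots> \<le> s * norm u + t * norm v"
      using that norm_triangle_ineq[of "s *\<^sub>R u" "t *\<^sub>R v"] by simp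
    also have "\<dots> \<le> h * norm u + h * norm v"
      using that by (intro add_mono mult_right_mono) auto
    also have "\<dots> \<le> h * (norm u + norm v + 1)" using \<open>h > 0\<close> by (simp add: algebra_simps)
    also have "\<dots> = d / 2"
    proof -
      have "norm u + norm v + 1 \<noteq> 0" using norm_ge_zero[of u] norm_ge_zero[of v] by linarith
      then show ?thesis by (metis h_def nonzero_eq_divide_eq)
    qed
    finally show ?thesis using \<open>d > 0\<close> by simp
  qed
  then have inS: "x + s *\<^sub>R u + t *\<^sub>R v \<in> S" if "0 \<le> s" "s \<le> h" "0 \<le> t" "t \<le> h" for s t
    using that d3 by (simp add: d_def)
  obtain s t where st: "0 < s" "s < h" "0 < t" "t < h"
    "f (x + h *\<^sub>R u + h *\<^sub>R v) - f (x + h *\<^sub>R u) - f (x + h *\<^sub>R v) + f x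
      = h * h * ?F (x + s *\<^sub>R u + t *\<^sub>R v)"
    using second_difference_mean_value[OF f \<open>h > 0\<close> inS] by blast
  have inS': "x + s *\<^sub>R v + t *\<^sub>R u \<in> S" if "0 \<le> s" "s \<le> h" "0 \<le> t" "t \<le> h" for s t
    using inS[of t s] that by (simp add: add_ac)
  obtain s' t' where st': "0 < s'" "s' < h" "0 < t'" "t' < h"
    "f (x + h *\<^sub>R v + h *\<^sub>R u) - f (x + h *\<^sub>R v) - f (x + h *\<^sub>R u) + f x
      = h * h * ?G (x + s' *\<^sub>R v + t' *\<^sub>R u)"
    using second_difference_mean_value[OF f \<open>h > 0\<close> inS'] by blast
  have comm: "x + a *\<^sub>R v + b *\<^sub>R u = x + b *\<^sub>R u + a *\<^sub>R v" for a b
    by (simp add: add_ac)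
  have "h * h * ?F (x + s *\<^sub>R u + t *\<^sub>R v) = h * h * ?G (x + t' *\<^sub>R u + s' *\<^sub>R v)"
    using st(5) st'(5)[unfolded comm] by linarith
  then have "?F (x + s *\<^sub>R u + t *\<^sub>R v) = ?G (x + t' *\<^sub>R u + s' *\<^sub>R v)"
    using \<open>h > 0\<close> by simp
  moreover have "dist (?F (x + s *\<^sub>R u + t *\<^sub>R v)) (?F x) < e"
    using st close[of s t] inS[of s t] by (intro d) (auto simp: d_def)
  moreover have "dist (?G (x + t' *\<^sub>R u + s' *\<^sub>R v)) (?G x) < e"
    using st' close[of t' s'] inS[of t' s'] by (intro d) (auto simp: d_def)
  ultimately show False by (simp add: dist_real_def e_def abs_if split: if_splits)
qed

section \<open>Algebra of functions on lists of vectors\<close>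

text \<open>Carries the Koszul sign for functions of mixed degree, so that identities need not be
  split into homogeneous components.\<close>

definition grade_inv :: "('v list \<Rightarrow> real) \<Rightarrow> 'v list \<Rightarrow> real" where
  "grade_inv f us = (-1) ^ length us * f us"

text \<open>Antisymmetry under adjacent transpositions makes sense without a vector space structure
  and suits induction on lists; under multilinearity it is equivalent to vanishing on repeated
  arguments.\<close>

definition alternating :: "('v list \<Rightarrow> real) \<Rightarrow> bool" where
  "alternating f \<longleftrightarrow> (\<forall>us u v vs. f (us @ u # v # vs) = - f (us @ v # u # vs))"

definition multilinear :: "('v::real_vector list \<Rightarrow> real) \<Rightarrow> bool" where
  "multilinear f \<longleftrightarrow> (\<forall>us vs. linear (\<lambda>v. f (us @ v # vs)))"

text \<open>Parity rather than degree, because the coefficients of a homogeneous element have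
  different degrees, all of one parity.\<close>

definition has_parity :: "nat \<Rightarrow> ('v list \<Rightarrow> real) \<Rightarrow> bool" where
  "has_parity p f \<longleftrightarrow> (\<forall>vs. f vs \<noteq> 0 \<longrightarrow> even (length vs + p))"

text \<open>The matrix \<open>W\<close> is arbitrary, so that the derivative of a bivector can be
  contracted as well. The argument order says that the contraction with \<open>b\<close> is
  performed first.\<close>

definition bcontr :: "'v set \<Rightarrow> ('v \<Rightarrow> 'v \<Rightarrow> real) \<Rightarrow> ('v list \<Rightarrow> real) \<Rightarrow> 'v list \<Rightarrow> real" where
  "bcontr E W f vs = (1/2) * (\<Sum>a\<in>E. \<Sum>b\<in>E. W a b * f (b # a # vs))"

definition skew_on :: "'v set \<Rightarrow> ('v \<Rightarrow> 'v \<Rightarrow> real) \<Rightarrow> bool" where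
  "skew_on E W \<longleftrightarrow> (\<forall>a\<in>E. \<forall>b\<in>E. W a b = - W b a)"

text \<open>\<open>n!\<close> times the coefficient of \<open>h\<^sup>n\<close> in the quantum exterior product.\<close>

primrec qprod :: "'v set \<Rightarrow> ('v \<Rightarrow> 'v \<Rightarrow> real) \<Rightarrow> nat \<Rightarrow>
    ('v list \<Rightarrow> real) \<Rightarrow> ('v list \<Rightarrow> real) \<Rightarrow> 'v list \<Rightarrow> real" where
  "qprod E W 0 f g = wedge f g"
| "qprod E W (Suc n) f g =
     (\<lambda>vs. \<Sum>a\<in>E. \<Sum>b\<in>E. W a b * qprod E W n (rcontr a f) (lcontr b g) vs)"

lemma wedge_Nil [simp]: "wedge f g [] = f [] * g []"
  by (simp add: wedge_def)

text \<open>Sorts the subsets by whether they contain position 0 and shifts the other positions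
  down.\<close>

lemma sum_Pow_Suc:
  fixes F :: "nat set \<Rightarrow> real"
  shows "(\<Sum>I\<in>Pow {..<Suc n}. F I) = (\<Sum>I\<in>Pow {..<n}. F (insert 0 (Suc ` I)) + F (Suc ` I))"
proof -
  have *: "{..<Suc n} = insert 0 (Suc ` {..<n})" by (auto simp: lessThan_Suc_eq_insert_0)
  have inj: "inj_on ((`) Suc) (Pow {..<n})" "inj_on (\<lambda>I. insert 0 (Suc ` I)) (Pow {..<n})"
    by (auto simp: inj_on_def insert_ident inj_image_eq_iff)
  have "Pow {..<Suc n} = (`) Suc ` Pow {..<n} \<union> (\<lambda>I. insert 0 (Suc ` I)) ` Pow {..<n}"
    unfolding * Pow_insert image_Pow_surj[OF refl] by (auto simp: image_image image_Pow_surj[OF refl, symmetric])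
  moreover have "(`) Suc ` Pow {..<n} \<inter> (\<lambda>I. insert 0 (Suc ` I)) ` Pow {..<n} = {}" by auto
  ultimately show ?thesis
    by (simp add: sum.union_disjoint sum.reindex[OF inj(1)] sum.reindex[OF inj(2)] sum.distrib)
qed

text \<open>The first argument goes to one of the factors. If it goes to \<open>g\<close>, it forms
  an inversion with every argument of \<open>f\<close>, whence the sign in \<open>grade_inv\<close>.
  Associativity, graded commutativity and antisymmetry follow from this recursion by induction on
  the list.\<close>

lemma wedge_Cons:
  "wedge f g (v # vs) = wedge (lcontr v f) g vs + wedge (grade_inv f) (lcontr v g) vs"
proof -
  define n where "n = length vs"
  define inv where "inv I J = {(i, j). i \<in> I \<and> j \<in> J \<and> j < i}" for I J :: "nat set"
  have nths_Suc: "nths (v # vs) (Suc ` I) = nths vs I" for I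
    by (auto simp: nths_Cons intro: arg_cong[where f = "nths vs"])
  have nths_0: "nths (v # vs) (insert 0 (Suc ` I)) = v # nths vs I" for I
    by (auto simp: nths_Cons intro: arg_cong[where f = "nths vs"])
  have diff: "{..<Suc n} - insert 0 (Suc ` I) = Suc ` ({..<n} - I)"
    "{..<Suc n} - Suc ` I = insert 0 (Suc ` ({..<n} - I))" for I
    by (auto simp: lessThan_Suc_eq_insert_0)
  have inv_Suc: "card (map_prod Suc Suc ` inv I J) = card (inv I J)" for I J
    by (rule card_image) (auto simp: inj_on_def)
  have inv_left: "inv (insert 0 (Suc ` I)) (Suc ` J) = map_prod Suc Suc ` inv I J" for I J
    unfolding inv_def by (auto simp: image_iff map_prod_def)
  have inv_right: "card (inv (Suc ` I) (insert 0 (Suc ` J))) = card I + card (inv I J)"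
    if "finite I" "finite J" for I J
  proof -
    have "inv (Suc ` I) (insert 0 (Suc ` J)) = (\<lambda>i. (Suc i, 0)) ` I \<union> map_prod Suc Suc ` inv I J"
      unfolding inv_def by (auto simp: image_iff map_prod_def)
    moreover have "(\<lambda>i. (Suc i, 0)) ` I \<inter> map_prod Suc Suc ` inv I J = {}" by auto
    moreover have "finite (inv I J)"
      by (rule finite_subset[of _ "I \<times> J"]) (use that in \<open>auto simp: inv_def\<close>)
    moreover have "card ((\<lambda>i. (Suc i, 0::nat)) ` I) = card I"
      by (rule card_image) (auto simp: inj_on_def)
    ultimately show ?thesis using that by (simp add: card_Un_disjoint inv_Suc)
  qed
  have len: "length (nths vs I) = card I" if "I \<subseteq> {..<n}" for I
    using that by (auto simp: length_nths n_def intro!: arg_cong[where f = card])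
  have "wedge f g (v # vs) = (\<Sum>I\<in>Pow {..<Suc n}. (-1) ^ card (inv I ({..<Suc n} - I))
      * f (nths (v # vs) I) * g (nths (v # vs) ({..<Suc n} - I)))"
    by (simp add: wedge_def n_def inv_def)
  also have "\<dots> = (\<Sum>I\<in>Pow {..<n}.
      (-1) ^ card (inv I ({..<n} - I)) * f (v # nths vs I) * g (nths vs ({..<n} - I))
      + (-1) ^ card (inv I ({..<n} - I)) * ((-1) ^ card I * f (nths vs I)) * g (v # nths vs ({..<n} - I)))"
    unfolding sum_Pow_Suc diff nths_0 nths_Suc inv_left inv_Suc
    by (rule sum.cong[OF refl], subst inv_right)
      (auto simp: power_add intro: finite_subset[of _ "{..<n}"])
  also have "\<dots> = wedge (lcontr v f) g vs + wedge (grade_inv f) (lcontr v g) vs"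
    by (simp add: wedge_def grade_inv_def lcontr_def sum.distrib n_def inv_def len[unfolded n_def])
  finally show ?thesis .
qed

lemma lcontr_wedge:
  "lcontr v (wedge f g) = (\<lambda>us. wedge (lcontr v f) g us + wedge (grade_inv f) (lcontr v g) us)"
  by (rule ext) (simp add: lcontr_def[of v "wedge f g"] wedge_Cons)

lemma grade_inv_grade_inv [simp]: "grade_inv (grade_inv f) = f"
  by (rule ext) (simp add: grade_inv_def)

lemma lcontr_grade_inv: "lcontr v (grade_inv f) = (\<lambda>us. - grade_inv (lcontr v f) us)"
  by (rule ext) (simp add: grade_inv_def lcontr_def)

section \<open>Bilinearity of the products\<close>

lemma wedge_linear_left:
  "wedge (\<lambda>us. r * f us + s * f' us) g vs = r * wedge f g vs + s * wedge f' g vs"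
  by (simp add: wedge_def sum.distrib sum_distrib_left algebra_simps)

lemma wedge_linear_right:
  "wedge f (\<lambda>us. r * g us + s * g' us) vs = r * wedge f g vs + s * wedge f g' vs"
  by (simp add: wedge_def sum.distrib sum_distrib_left algebra_simps)

lemma qprod_linear_left:
  "qprod E W n (\<lambda>us. r * f us + s * f' us) g vs = r * qprod E W n f g vs + s * qprod E W n f' g vs"
proof (induction n arbitrary: f f' g)
  case 0
  then show ?case by (simp add: wedge_linear_left)
next
  case (Suc n)
  have "rcontr a (\<lambda>us. r * f us + s * f' us) = (\<lambda>us. r * rcontr a f us + s * rcontr a f' us)" for a
    by (simp add: rcontr_def fun_eq_iff)
  then show ?case
    by (simp add: Suc sum.distrib sum_distrib_left algebra_simps)
qed

lemma qprod_linear_right: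
  "qprod E W n f (\<lambda>us. r * g us + s * g' us) vs = r * qprod E W n f g vs + s * qprod E W n f g' vs"
proof (induction n arbitrary: f g g')
  case 0
  then show ?case by (simp add: wedge_linear_right)
next
  case (Suc n)
  have "lcontr a (\<lambda>us. r * g us + s * g' us) = (\<lambda>us. r * lcontr a g us + s * lcontr a g' us)" for a
    by (simp add: lcontr_def fun_eq_iff)
  then show ?case
    by (simp add: Suc sum.distrib sum_distrib_left algebra_simps)
qed

lemma qprod_simps [simp]:
  "qprod E W n (\<lambda>us. 0) g vs = 0"
  "qprod E W n f (\<lambda>us. 0) vs = 0"
  "qprod E W n (\<lambda>us. f us + f' us) g vs = qprod E W n f g vs + qprod E W n f' g vs"
  "qprod E W n f (\<lambda>us. g us + g' us) vs = qprod E W n f g vs + qprod E W n f g' vs"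
  "qprod E W n (\<lambda>us. f us - f' us) g vs = qprod E W n f g vs - qprod E W n f' g vs"
  "qprod E W n f (\<lambda>us. g us - g' us) vs = qprod E W n f g vs - qprod E W n f g' vs"
  "qprod E W n (\<lambda>us. - f us) g vs = - qprod E W n f g vs"
  "qprod E W n f (\<lambda>us. - g us) vs = - qprod E W n f g vs"
  "qprod E W n (\<lambda>us. r * f us) g vs = r * qprod E W n f g vs"
  "qprod E W n f (\<lambda>us. r * g us) vs = r * qprod E W n f g vs"
  using qprod_linear_left[of E W n 0 f 0 f g vs] qprod_linear_left[of E W n 1 f 1 f' g vs]
    qprod_linear_left[of E W n 1 f "-1" f' g vs] qprod_linear_left[of E W n "-1" f 0 f g vs]
    qprod_linear_left[of E W n r f 0 f g vs]
    qprod_linear_right[of E W n f 0 g 0 g vs] qprod_linear_right[of E W n f 1 g 1 g' vs]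
    qprod_linear_right[of E W n f 1 g "-1" g' vs] qprod_linear_right[of E W n f "-1" g 0 g vs]
    qprod_linear_right[of E W n f r g 0 g vs]
  by simp_all

lemma qprod_sum_left: "qprod E W n (\<lambda>us. \<Sum>i\<in>I. f i us) g vs = (\<Sum>i\<in>I. qprod E W n (f i) g vs)"
  by (induction I rule: infinite_finite_induct) simp_all

lemma qprod_sum_right: "qprod E W n f (\<lambda>us. \<Sum>i\<in>I. g i us) vs = (\<Sum>i\<in>I. qprod E W n f (g i) vs)"
  by (induction I rule: infinite_finite_induct) simp_all

text \<open>The product of order 0 is \<open>wedge\<close> whatever the basis and the matrix are, so
  arbitrary values may instantiate them.\<close>

lemmas wedge_simps [simp] = qprod_simps[of undefined undefined 0, unfolded qprod.simps(1)]
lemmas wedge_sum_left = qprod_sum_left[of undefined undefined 0, unfolded qprod.simps(1)]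
lemmas wedge_sum_right = qprod_sum_right[of undefined undefined 0, unfolded qprod.simps(1)]

section \<open>Associativity and graded commutativity of the wedge product\<close>

lemma grade_inv_wedge: "grade_inv (wedge f g) vs = wedge (grade_inv f) (grade_inv g) vs"
proof (induction vs arbitrary: f g)
  case Nil
  then show ?case by (simp add: grade_inv_def)
next
  case (Cons v vs)
  have "grade_inv (wedge f g) (v # vs) =
      - (grade_inv (wedge (lcontr v f) g) vs + grade_inv (wedge (grade_inv f) (lcontr v g)) vs)"
    by (simp add: grade_inv_def wedge_Cons algebra_simps)
  then show ?case by (simp add: Cons wedge_Cons lcontr_grade_inv)
qed

lemma wedge_assoc: "wedge (wedge f g) h vs = wedge f (wedge g h) vs"
proof (induction vs arbitrary: f g h)
  case (Cons v vs)
  have "grade_inv (wedge f g) = wedge (grade_inv f) (grade_inv g)"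
    by (rule ext) (rule grade_inv_wedge)
  then show ?case by (simp add: wedge_Cons lcontr_wedge Cons)
qed simp

lemma has_parity_lcontr: "has_parity p f \<Longrightarrow> has_parity (Suc p) (lcontr v f)"
  by (force simp: has_parity_def lcontr_def)

lemma has_parity_bcontr:
  assumes "has_parity p f"
  shows "has_parity p (bcontr E W f)"
proof -
  have "bcontr E W f vs = 0" if "odd (length vs + p)" for vs
  proof -
    have "f (b # a # vs) = 0" for a b
      using assms[unfolded has_parity_def, rule_format, of "b # a # vs"] that by auto
    then show ?thesis by (simp add: bcontr_def)
  qed
  then show ?thesis by (auto simp: has_parity_def)
qed

lemma grade_inv_parity:
  assumes "has_parity p f"
  shows "grade_inv f = (\<lambda>us. (-1) ^ p * f us)"
proof
  fix us
  show "grade_inv f us = (-1) ^ p * f us"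
    using assms[unfolded has_parity_def, rule_format, of us]
    by (cases "f us = 0") (auto simp: grade_inv_def minus_one_power_iff)
qed

lemma wedge_commute:
  assumes "has_parity p f" "has_parity q g"
  shows "wedge f g vs = (-1) ^ (p * q) * wedge g f vs"
  using assms
proof (induction vs arbitrary: p q f g)
  case Nil
  then have "f [] = 0 \<or> even p" "g [] = 0 \<or> even q"
    unfolding has_parity_def by fastforce+
  then show ?case by auto
next
  case (Cons v vs)
  \<comment> \<open>Contraction changes the parity of one factor; the extra sign is the one that
    \<open>grade_inv\<close> puts on the corresponding term of the exchanged product.\<close>
  have "wedge (lcontr v f) g vs = (-1) ^ (p * q) * ((-1) ^ q * wedge g (lcontr v f) vs)"
    using Cons.IH[OF has_parity_lcontr[OF Cons.prems(1)] Cons.prems(2)] by (simp add: power_add)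
  moreover have "wedge f (lcontr v g) vs = (-1) ^ (p * q) * ((-1) ^ p * wedge (lcontr v g) f vs)"
    using Cons.IH[OF Cons.prems(1) has_parity_lcontr[OF Cons.prems(2)]] by (simp add: power_add)
  ultimately show ?case
    unfolding wedge_Cons grade_inv_parity[OF Cons.prems(1)] grade_inv_parity[OF Cons.prems(2)] wedge_simps
    by (simp add: algebra_simps)
qed

section \<open>Alternating functions\<close>

lemma alternatingD: "alternating f \<Longrightarrow> f (us @ u # v # vs) = - f (us @ v # u # vs)"
  unfolding alternating_def by blast

lemma alternatingI: "(\<And>us u v vs. f (us @ u # v # vs) = - f (us @ v # u # vs)) \<Longrightarrow> alternating f"
  unfolding alternating_def by blast

lemma alternating_swap: "alternating f \<Longrightarrow> f (u # v # vs) = - f (v # u # vs)"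
  using alternatingD[of f "[]" u v vs] by simp

lemma alternating_move:
  assumes "alternating f"
  shows "f (us @ vs @ u # ws) = (-1) ^ length vs * f (us @ u # vs @ ws)"
proof (induction vs arbitrary: us)
  case (Cons v vs)
  show ?case
    using Cons[of "us @ [v]"] alternatingD[OF assms, of us v u "vs @ ws"] by simp
qed simp

lemma alternating_lcontr:
  assumes "alternating f"
  shows "alternating (lcontr v f)"
proof (rule alternatingI)
  fix us u w vs
  show "lcontr v f (us @ u # w # vs) = - lcontr v f (us @ w # u # vs)"
    using alternatingD[OF assms, of "v # us" u w vs] by (simp add: lcontr_def)
qed

lemma alternating_grade_inv:
  assumes "alternating f"
  shows "alternating (grade_inv f)"
proof (rule alternatingI)
  fix us u v vs
  show "grade_inv f (us @ u # v # vs) = - grade_inv f (us @ v # u # vs)"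
    using alternatingD[OF assms, of us u v vs] by (simp add: grade_inv_def)
qed

text \<open>Carrying the last argument to the front passes it over all the others, each at the cost
  of a sign.\<close>

lemma rcontr_eq: "alternating f \<Longrightarrow> rcontr v f = grade_inv (lcontr v f)"
  using alternating_move[of f "[]" _ v "[]"] by (simp add: fun_eq_iff rcontr_def grade_inv_def lcontr_def)

lemma alternating_linear:
  assumes "alternating f" "alternating g"
  shows "alternating (\<lambda>us. r * f us + s * g us)"
proof (rule alternatingI)
  fix us u v vs
  show "r * f (us @ u # v # vs) + s * g (us @ u # v # vs)
      = - (r * f (us @ v # u # vs) + s * g (us @ v # u # vs))"
    using assms[THEN alternatingD, of us u v vs] by simp
qed

lemma alternating_add: "alternating f \<Longrightarrow> alternating g \<Longrightarrow> alternating (\<lambda>us. f us + g us)"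
  using alternating_linear[of f g 1 1] by simp

lemma alternating_cmult: "alternating f \<Longrightarrow> alternating (\<lambda>us. r * f us)"
  using alternating_linear[of f f r 0] by simp

lemma alternating_sum:
  "(\<And>i. i \<in> I \<Longrightarrow> alternating (f i)) \<Longrightarrow> alternating (\<lambda>us. \<Sum>i\<in>I. f i us)"
proof (induction I rule: infinite_finite_induct)
  case (insert i I)
  then show ?case by (simp add: alternating_add)
qed (simp_all add: alternating_def)

lemma alternating_bcontr:
  assumes "alternating f"
  shows "alternating (bcontr E W f)"
proof (rule alternatingI)
  fix us u v vs
  have "bcontr E W f (us @ u # v # vs) = (1/2) * (\<Sum>a\<in>E. \<Sum>b\<in>E. W a b * - f (b # a # us @ v # u # vs))"
    unfolding bcontr_def
    by (intro arg_cong2[where f = "(*)"] sum.cong refl)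
      (use alternatingD[OF assms, of "b # a # us" u v vs for a b] in simp)
  then show "bcontr E W f (us @ u # v # vs) = - bcontr E W f (us @ v # u # vs)"
    by (simp add: bcontr_def sum_negf)
qed

text \<open>Passing over two arguments costs no sign. That contraction with a bivector commutes with
  contraction by vectors drives most of the later inductions.\<close>

lemma lcontr_bcontr:
  assumes "alternating f"
  shows "lcontr v (bcontr E W f) = bcontr E W (lcontr v f)"
proof
  fix vs
  have "f (b # a # v # vs) = f (v # b # a # vs)" for a b
    using alternating_move[OF assms, of "[]" "[b, a]" v vs] by simp
  then show "lcontr v (bcontr E W f) vs = bcontr E W (lcontr v f) vs"
    by (simp add: lcontr_def bcontr_def)
qed

lemma rcontr_bcontr: "rcontr v (bcontr E W f) = bcontr E W (rcontr v f)"
  by (simp add: rcontr_def bcontr_def fun_eq_iff)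

text \<open>The recursion contracts the prefix away; the two contractions that remain exchange up to
  sign.\<close>

lemma wedge_swap:
  assumes "alternating f" "alternating g"
  shows "wedge f g (us @ u # v # vs) = - wedge f g (us @ v # u # vs)"
  using assms
proof (induction us arbitrary: f g)
  case Nil
  have "lcontr v (lcontr u h) = (\<lambda>us. - lcontr u (lcontr v h) us)" if "alternating h"
    for h :: "'a list \<Rightarrow> real"
  proof
    fix us
    show "lcontr v (lcontr u h) us = - lcontr u (lcontr v h) us"
      using alternating_swap[OF that, of u v us] by (simp add: lcontr_def)
  qed
  from this[OF Nil(1)] this[OF Nil(2)] show ?case
    by (simp add: wedge_Cons lcontr_grade_inv)
next
  case (Cons w us)
  then show ?case
    by (simp add: wedge_Cons alternating_lcontr alternating_grade_inv)
qed

lemma alternating_wedge: "alternating f \<Longrightarrow> alternating g \<Longrightarrow> alternating (wedge f g)"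
  by (rule alternatingI) (rule wedge_swap)

section \<open>Multilinear functions\<close>

lemma multilinear_lcontr:
  assumes "multilinear f"
  shows "multilinear (lcontr v f)"
  using assms[unfolded multilinear_def, rule_format, of "v # us" for us]
  by (simp add: multilinear_def lcontr_def)

lemma multilinear_grade_inv: "multilinear f \<Longrightarrow> multilinear (grade_inv f)"
  unfolding multilinear_def grade_inv_def by (simp add: linear_iff algebra_simps)

lemma multilinear_add: "multilinear f \<Longrightarrow> multilinear g \<Longrightarrow> multilinear (\<lambda>us. f us + g us)"
  unfolding multilinear_def by (simp add: linear_compose_add)

lemma multilinear_cmult: "multilinear f \<Longrightarrow> multilinear (\<lambda>us. r * f us)"
  unfolding multilinear_def by (simp add: linear_iff algebra_simps)

lemma lcontr_linear:
  assumes "multilinear f"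
  shows "lcontr (u + v) f = (\<lambda>us. lcontr u f us + lcontr v f us)"
    "lcontr (r *\<^sub>R v) f = (\<lambda>us. r * lcontr v f us)"
  using assms[unfolded multilinear_def, rule_format, of "[]"]
  by (auto simp: lcontr_def linear_iff)

lemma linear_wedge_slot:
  assumes "multilinear f" "multilinear g"
  shows "linear (\<lambda>v. wedge f g (us @ v # vs))"
  using assms
proof (induction us arbitrary: f g)
  case Nil
  then show ?case
    by (simp add: linear_iff wedge_Cons lcontr_linear algebra_simps)
next
  case (Cons w us)
  then show ?case
    by (simp add: wedge_Cons multilinear_lcontr multilinear_grade_inv linear_compose_add)
qed

lemma multilinear_wedge: "multilinear f \<Longrightarrow> multilinear g \<Longrightarrow> multilinear (wedge f g)"
  unfolding multilinear_def[of "wedge f g"] using linear_wedge_slot by blast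

lemma multilinear_bcontr:
  assumes "multilinear f"
  shows "multilinear (bcontr E W f)"
proof -
  have "linear (\<lambda>v. f (b # a # us @ v # vs))" for a b us vs
    using assms[unfolded multilinear_def, rule_format, of "b # a # us"] by simp
  then show ?thesis
    unfolding multilinear_def bcontr_def
    by (simp add: linear_iff sum.distrib sum_distrib_left add_divide_distrib algebra_simps)
qed

lemma alternating_multilinear_iff:
  "alternating_multilinear f \<longleftrightarrow> multilinear f \<and> alternating f"
proof
  assume f: "alternating_multilinear f"
  have lin: "linear (\<lambda>v. f (us @ v # vs))" for us vs
    using f by (simp add: alternating_multilinear_def)
  have zero: "f (us @ v # v # vs) = 0" for us v vs
    using f by (simp add: alternating_multilinear_def)
  have "f (us @ u # v # vs) = - f (us @ v # u # vs)" for us u v vs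
  proof -
    have *: "f (us @ (u + v) # w # vs) = f (us @ u # w # vs) + f (us @ v # w # vs)" for w
      using lin[of us "w # vs"] by (simp add: linear_iff)
    have **: "f (us @ w # (u + v) # vs) = f (us @ w # u # vs) + f (us @ w # v # vs)" for w
      using lin[of "us @ [w]" vs] by (simp add: linear_iff)
    \<comment> \<open>Polarisation: the vanishing value with \<open>u + v\<close> in both slots is
      expanded.\<close>
    show ?thesis using zero[of us "u + v" vs] *[of "u + v"] **[of u] **[of v] zero[of us u vs] zero[of us v vs]
      by linarith
  qed
  then show "multilinear f \<and> alternating f"
    using lin unfolding multilinear_def alternating_def by blast
next
  assume f: "multilinear f \<and> alternating f"
  have "f vs = 0" if "\<not> distinct vs" for vs
  proof -
    from not_distinct_decomp[OF that] obtain us ys zs x where vs: "vs = us @ x # ys @ x # zs"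
      by auto
    \<comment> \<open>The value is its own negative. Repeated arguments further apart are first
      brought together.\<close>
    have "f (us @ x # x # ys @ zs) = 0"
      using f alternatingD[of f us x x "ys @ zs"] by simp
    then show ?thesis
      using alternating_move[of f "us @ [x]" ys x zs] f vs by simp
  qed
  then show "alternating_multilinear f"
    using f by (auto simp: alternating_multilinear_def multilinear_def)
qed

text \<open>
  Contraction with a bivector is a second-order operator; its failure to be a derivation of
  the product of order \<open>n\<close> is the product of order \<open>n + 1\<close>.
\<close>

lemma bcontr_wedge:
  assumes W: "skew_on E W"
    and f: "alternating f"
  shows "bcontr E W (wedge f g) vs =
    wedge (bcontr E W f) g vs + wedge f (bcontr E W g) vs - qprod E W 1 f g vs"
proof -
  let ?S = "\<lambda>F. \<Sum>a\<in>E. \<Sum>b\<in>E. W a b * F a b"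
  have bc: "bcontr E W h = (\<lambda>us. 1/2 * (\<Sum>a\<in>E. \<Sum>b\<in>E. W a b * lcontr a (lcontr b h) us))" for h
    by (simp add: bcontr_def lcontr_def fun_eq_iff)
  have left: "wedge (bcontr E W f) g vs = 1/2 * ?S (\<lambda>a b. wedge (lcontr a (lcontr b f)) g vs)"
    unfolding bc by (simp only: wedge_simps wedge_sum_left)
  have right: "wedge f (bcontr E W g) vs = 1/2 * ?S (\<lambda>a b. wedge f (lcontr a (lcontr b g)) vs)"
    unfolding bc by (simp only: wedge_simps wedge_sum_right)
  have cross: "qprod E W 1 f g vs = ?S (\<lambda>a b. wedge (grade_inv (lcontr a f)) (lcontr b g) vs)"
    using f by (simp add: rcontr_eq)
  \<comment> \<open>Skewness of \<open>W\<close> makes the two mixed terms, with one contraction on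
    each factor, contribute equally; together they absorb the factor 1/2.\<close>
  have swap: "?S (\<lambda>a b. wedge (grade_inv (lcontr b f)) (lcontr a g) vs)
      = - ?S (\<lambda>a b. wedge (grade_inv (lcontr a f)) (lcontr b g) vs)"
  proof -
    have neg: "W b a * t = - (W a b * t)" if "a \<in> E" "b \<in> E" for a b t
      using W that unfolding skew_on_def by (metis minus_mult_left)
    have "?S (\<lambda>a b. wedge (grade_inv (lcontr b f)) (lcontr a g) vs)
        = (\<Sum>a\<in>E. \<Sum>b\<in>E. W b a * wedge (grade_inv (lcontr a f)) (lcontr b g) vs)"
      by (rule sum.swap)
    also have "\<dots> = (\<Sum>a\<in>E. \<Sum>b\<in>E. - (W a b * wedge (grade_inv (lcontr a f)) (lcontr b g) vs))"
      by (intro sum.cong refl neg)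
    finally show ?thesis by (simp add: sum_negf)
  qed
  have "bcontr E W (wedge f g) vs = 1/2 * ?S (\<lambda>a b. wedge f g (b # a # vs))"
    by (simp add: bcontr_def)
  also have "?S (\<lambda>a b. wedge f g (b # a # vs)) =
      ?S (\<lambda>a b. wedge (lcontr a (lcontr b f)) g vs) + ?S (\<lambda>a b. wedge (grade_inv (lcontr b f)) (lcontr a g) vs)
      - ?S (\<lambda>a b. wedge (grade_inv (lcontr a f)) (lcontr b g) vs) + ?S (\<lambda>a b. wedge f (lcontr a (lcontr b g)) vs)"
    by (simp add: wedge_Cons lcontr_grade_inv sum.distrib sum_subtractf algebra_simps)
  finally show ?thesis unfolding left right cross swap by simp
qed

lemma bcontr_sum:
  "bcontr E W (\<lambda>us. \<Sum>i\<in>I. f i us) vs = (\<Sum>i\<in>I. bcontr E W (f i) vs)"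
proof -
  have "(\<Sum>a\<in>E. \<Sum>b\<in>E. W a b * (\<Sum>i\<in>I. f i (b # a # vs)))
      = (\<Sum>a\<in>E. \<Sum>b\<in>E. \<Sum>i\<in>I. W a b * f i (b # a # vs))"
    by (simp only: sum_distrib_left)
  also have "\<dots> = (\<Sum>a\<in>E. \<Sum>i\<in>I. \<Sum>b\<in>E. W a b * f i (b # a # vs))"
    by (intro sum.cong refl sum.swap)
  also have "\<dots> = (\<Sum>i\<in>I. \<Sum>a\<in>E. \<Sum>b\<in>E. W a b * f i (b # a # vs))"
    by (rule sum.swap)
  finally show ?thesis
    by (simp add: bcontr_def sum_distrib_left)
qed

lemma bcontr_simps [simp]:
  "bcontr E W (\<lambda>us. 0) vs = 0"
  "bcontr E W (\<lambda>us. f us + f' us) vs = bcontr E W f vs + bcontr E W f' vs"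
  "bcontr E W (\<lambda>us. f us - f' us) vs = bcontr E W f vs - bcontr E W f' vs"
  "bcontr E W (\<lambda>us. - f us) vs = - bcontr E W f vs"
  "bcontr E W (\<lambda>us. r * f us) vs = r * bcontr E W f vs"
  by (simp_all add: bcontr_def sum.distrib sum_subtractf sum_negf sum_distrib_left algebra_simps)

lemma qprod_Suc:
  assumes W: "skew_on E W"
    and "alternating f" "alternating g"
  shows "qprod E W (Suc n) f g vs =
    qprod E W n (bcontr E W f) g vs + qprod E W n f (bcontr E W g) vs - bcontr E W (qprod E W n f g) vs"
  using assms(2,3)
proof (induction n arbitrary: f g vs)
  case 0
  have "qprod E W 1 f g vs = wedge (bcontr E W f) g vs + wedge f (bcontr E W g) vs
      - bcontr E W (wedge f g) vs"
    using bcontr_wedge[OF W \<open>alternating f\<close>] by simp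
  then show ?case by simp
next
  case (Suc n)
  let ?S = "\<lambda>F. \<Sum>a\<in>E. \<Sum>b\<in>E. W a b * F a b"
  have alt: "alternating (rcontr a f)" "alternating (lcontr b g)" for a b
    using Suc.prems by (simp_all add: rcontr_eq alternating_grade_inv alternating_lcontr)
  have "qprod E W (Suc (Suc n)) f g vs = ?S (\<lambda>a b. qprod E W (Suc n) (rcontr a f) (lcontr b g) vs)"
    by simp
  \<comment> \<open>Contraction with the bivector commutes with \<open>rcontr\<close> and
    \<open>lcontr\<close>, so the induction hypothesis for the contracted factors rearranges into
    the claim.\<close>
  also have "\<dots> = ?S (\<lambda>a b. qprod E W n (rcontr a (bcontr E W f)) (lcontr b g) vs)
      + ?S (\<lambda>a b. qprod E W n (rcontr a f) (lcontr b (bcontr E W g)) vs)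
      - ?S (\<lambda>a b. bcontr E W (qprod E W n (rcontr a f) (lcontr b g)) vs)"
    unfolding Suc.IH[OF alt] rcontr_bcontr lcontr_bcontr[OF Suc.prems(2)]
    by (simp add: sum.distrib sum_subtractf algebra_simps)
  also have "?S (\<lambda>a b. bcontr E W (qprod E W n (rcontr a f) (lcontr b g)) vs)
      = bcontr E W (qprod E W (Suc n) f g) vs"
    by (simp add: bcontr_sum)
  finally show ?case by simp
qed

section \<open>Commutativity and associativity of the products of all orders\<close>

lemma alternating_qprod:
  assumes W: "skew_on E W"
    and "alternating f" "alternating g"
  shows "alternating (qprod E W n f g)"
  using assms(2,3)
proof (induction n arbitrary: f g)
  case 0
  then show ?case by (simp add: alternating_wedge)
next
  case (Suc n)
  then show ?case
    unfolding qprod.simps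
    by (intro alternating_sum alternating_cmult Suc.IH)
      (simp_all add: rcontr_eq alternating_grade_inv alternating_lcontr)
qed

lemma qprod_commute:
  assumes W: "skew_on E W"
    and "alternating f" "alternating g" "has_parity p f" "has_parity q g"
  shows "qprod E W n f g vs = (-1) ^ (p * q) * qprod E W n g f vs"
  using assms(2-)
proof (induction n arbitrary: f g vs)
  case 0
  then show ?case unfolding qprod.simps by (intro wedge_commute)
next
  case (Suc n)
  have eq: "qprod E W n f g = (\<lambda>us. (-1) ^ (p * q) * qprod E W n g f us)"
    by (intro ext Suc.IH Suc.prems)
  \<comment> \<open>Contraction with a bivector preserves parity, so the sign stays the
    same.\<close>
  have "qprod E W n (bcontr E W f) g vs = (-1) ^ (p * q) * qprod E W n g (bcontr E W f) vs"
    by (intro Suc.IH alternating_bcontr has_parity_bcontr Suc.prems)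
  moreover have "qprod E W n f (bcontr E W g) vs = (-1) ^ (p * q) * qprod E W n (bcontr E W g) f vs"
    by (intro Suc.IH alternating_bcontr has_parity_bcontr Suc.prems)
  ultimately show ?case
    unfolding qprod_Suc[OF W Suc.prems(1,2)] qprod_Suc[OF W Suc.prems(2,1)] eq
    by (simp add: algebra_simps)
qed

text \<open>Pascal's rule, arranged so that each step raises either the first or the second
  index.\<close>

lemma binomial_sum_Suc:
  fixes X :: "nat \<Rightarrow> nat \<Rightarrow> real"
  shows "(\<Sum>k\<le>Suc n. (Suc n choose k) * X (Suc n - k) k)
    = (\<Sum>k\<le>n. (n choose k) * (X (Suc (n - k)) k + X (n - k) (Suc k)))"
proof -
  have "(\<Sum>k\<le>Suc n. (Suc n choose k) * X (Suc n - k) k)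
      = X (Suc n) 0 + (\<Sum>k\<le>n. (n choose k) * X (n - k) (Suc k)) + (\<Sum>k\<le>n. (n choose Suc k) * X (n - k) (Suc k))"
    by (simp only: sum.atMost_Suc_shift) (simp add: sum.distrib algebra_simps)
  also have "X (Suc n) 0 + (\<Sum>k\<le>n. (n choose k) * X (n - k) (Suc k)) + (\<Sum>k\<le>n. (n choose Suc k) * X (n - k) (Suc k))
      = (\<Sum>k\<le>n. (n choose k) * X (n - k) (Suc k)) + (\<Sum>k\<le>Suc n. (n choose k) * X (Suc n - k) k)"
    by (simp only: sum.atMost_Suc_shift[of _ n]) (simp add: algebra_simps)
  also have "(\<Sum>k\<le>Suc n. (n choose k) * X (Suc n - k) k) = (\<Sum>k\<le>n. (n choose k) * X (Suc (n - k)) k)"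
    by (simp add: Suc_diff_le)
  finally show ?thesis by (simp add: sum.distrib algebra_simps)
qed

text \<open>This is associativity at the \<open>n\<close>-th power of \<open>h\<close>, multiplied
  by \<open>fact n\<close>. The induction step applies the three-argument analogue of
  \<open>ad\<close> to both sides.\<close>

lemma qprod_assoc:
  assumes W: "skew_on E W"
    and "alternating f" "alternating g" "alternating h"
  shows "(\<Sum>k\<le>n. (n choose k) * qprod E W (n - k) (qprod E W k f g) h vs)
       = (\<Sum>k\<le>n. (n choose k) * qprod E W (n - k) f (qprod E W k g h) vs)"
  using assms(2-)
proof (induction n arbitrary: f g h vs)
  case 0
  then show ?case by (simp add: wedge_assoc)
next
  case (Suc n)
  let ?J = "bcontr E W" and ?Q = "qprod E W"
  let ?L = "\<lambda>f g h us. \<Sum>k\<le>n. (n choose k) * ?Q (n - k) (?Q k f g) h us"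
  let ?R = "\<lambda>f g h us. \<Sum>k\<le>n. (n choose k) * ?Q (n - k) f (?Q k g h) us"
  note alt = alternating_qprod[OF W]
  note rec = qprod_Suc[OF W]
  \<comment> \<open>Raising the outer order and raising the inner order each produce a term with
    \<open>?J (?Q k f g)\<close> as first factor. These cancel, leaving contractions of the three
    arguments and of the result.\<close>
  have L: "?Q (Suc m) (?Q k f g) h vs + ?Q m (?Q (Suc k) f g) h vs =
      ?Q m (?Q k (?J f) g) h vs + ?Q m (?Q k f (?J g)) h vs + ?Q m (?Q k f g) (?J h) vs
      - ?J (?Q m (?Q k f g) h) vs" for m k
  proof -
    have "?Q (Suc k) f g = (\<lambda>us. ?Q k (?J f) g us + ?Q k f (?J g) us - ?J (?Q k f g) us)"
      by (intro ext rec Suc.prems)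
    then show ?thesis
      using rec[OF alt[OF Suc.prems(1,2)] Suc.prems(3)] by (simp del: qprod.simps)
  qed
  have R: "?Q (Suc m) f (?Q k g h) vs + ?Q m f (?Q (Suc k) g h) vs =
      ?Q m (?J f) (?Q k g h) vs + ?Q m f (?Q k (?J g) h) vs + ?Q m f (?Q k g (?J h)) vs
      - ?J (?Q m f (?Q k g h)) vs" for m k
  proof -
    have "?Q (Suc k) g h = (\<lambda>us. ?Q k (?J g) h us + ?Q k g (?J h) us - ?J (?Q k g h) us)"
      by (intro ext rec Suc.prems)
    then show ?thesis
      using rec[OF Suc.prems(1) alt[OF Suc.prems(2,3)]] by (simp del: qprod.simps)
  qed
  have IH: "?L f g h = ?R f g h" by (intro ext Suc.IH Suc.prems)
  have "(\<Sum>k\<le>Suc n. (Suc n choose k) * ?Q (Suc n - k) (?Q k f g) h vs)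
      = (\<Sum>k\<le>n. (n choose k) * (?Q (Suc (n - k)) (?Q k f g) h vs + ?Q (n - k) (?Q (Suc k) f g) h vs))"
    by (rule binomial_sum_Suc)
  also have "\<dots> = ?L (?J f) g h vs + ?L f (?J g) h vs + ?L f g (?J h) vs - ?J (?L f g h) vs"
    unfolding L by (simp add: bcontr_sum sum.distrib sum_subtractf algebra_simps)
  also have "\<dots> = ?R (?J f) g h vs + ?R f (?J g) h vs + ?R f g (?J h) vs - ?J (?R f g h) vs"
    unfolding IH using Suc.prems by (simp add: Suc.IH alternating_bcontr)
  also have "\<dots> = (\<Sum>k\<le>n. (n choose k) * (?Q (Suc (n - k)) f (?Q k g h) vs + ?Q (n - k) f (?Q (Suc k) g h) vs))"
    unfolding R by (simp add: bcontr_sum sum.distrib sum_subtractf algebra_simps)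
  also have "\<dots> = (\<Sum>k\<le>Suc n. (Suc n choose k) * ?Q (Suc n - k) f (?Q k g h) vs)"
    by (rule binomial_sum_Suc[symmetric])
  finally show ?case .
qed

section \<open>Explicit sums and vanishing in high order\<close>

lemma sum_lists_Suc:
  fixes F :: "'v list \<Rightarrow> real"
  assumes "finite E"
  shows "(\<Sum>I | set I \<subseteq> E \<and> length I = Suc n. F I) = (\<Sum>a\<in>E. \<Sum>I | set I \<subseteq> E \<and> length I = n. F (a # I))"
proof -
  have "inj_on (\<lambda>(a, I). a # I) (E \<times> {I. set I \<subseteq> E \<and> length I = n})" by (auto simp: inj_on_def)
  moreover have "{I. set I \<subseteq> E \<and> length I = Suc n}
      = (\<lambda>(a, I). a # I) ` (E \<times> {I. set I \<subseteq> E \<and> length I = n})"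
    by (auto simp: length_Suc_conv image_iff)
  ultimately show ?thesis
    using assms by (simp add: sum.reindex sum.cartesian_product case_prod_unfold)
qed

text \<open>The recursion consumes the index lists from the head, and \<open>fold\<close> contracts
  with the head first, so both use the same order of contractions.\<close>

lemma qprod_explicit:
  assumes "finite E"
  shows "qprod E W n f g vs =
    (\<Sum>I | set I \<subseteq> E \<and> length I = n. \<Sum>J | set J \<subseteq> E \<and> length J = n.
      (\<Prod>k<n. W (I ! k) (J ! k)) * wedge (fold rcontr I f) (fold lcontr J g) vs)"
proof (induction n arbitrary: f g)
  case 0
  have "{I. set I \<subseteq> E \<and> I = []} = {[]}" by auto
  then show ?case by simp
next
  case (Suc n)
  let ?A = "{I. set I \<subseteq> E \<and> length I = n}"
  have "qprod E W (Suc n) f g vs = (\<Sum>a\<in>E. \<Sum>b\<in>E. \<Sum>I\<in>?A. \<Sum>J\<in>?A. W a b * ((\<Prod>k<n. W (I ! k) (J ! k))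
      * wedge (fold rcontr I (rcontr a f)) (fold lcontr J (lcontr b g)) vs))"
    by (simp add: Suc sum_distrib_left)
  also have "\<dots> = (\<Sum>a\<in>E. \<Sum>I\<in>?A. \<Sum>b\<in>E. \<Sum>J\<in>?A. W a b * ((\<Prod>k<n. W (I ! k) (J ! k))
      * wedge (fold rcontr I (rcontr a f)) (fold lcontr J (lcontr b g)) vs))"
    by (intro sum.cong refl sum.swap)
  also have "\<dots> = (\<Sum>a\<in>E. \<Sum>I\<in>?A. \<Sum>b\<in>E. \<Sum>J\<in>?A. (\<Prod>k<Suc n. W ((a # I) ! k) ((b # J) ! k))
      * wedge (fold rcontr (a # I) f) (fold lcontr (b # J) g) vs)"
    by (simp add: prod.lessThan_Suc_shift mult.assoc del: prod.lessThan_Suc)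
  finally show ?case by (simp add: sum_lists_Suc[OF assms] del: prod.lessThan_Suc)
qed

lemma fold_lcontr: "fold lcontr J g us = g (J @ us)"
  by (induction J arbitrary: g us) (simp_all add: lcontr_def)

text \<open>More contractions than basis vectors repeat one of them, and \<open>g\<close> vanishes
  on repetitions. This bounds the powers of \<open>h\<close> that a product can contribute.\<close>

lemma qprod_eq_0:
  assumes E: "finite E" "card E < n" and g: "\<And>vs. \<not> distinct vs \<Longrightarrow> g vs = 0"
  shows "qprod E W n f g vs = 0"
proof -
  have "fold lcontr J g = (\<lambda>us. 0)" if "set J \<subseteq> E" "length J = n" for J
  proof -
    have "card (set J) < length J" using that E card_mono[of E "set J"] by simp
    then have "\<not> distinct J" using distinct_card by force
    then show ?thesis by (simp add: fold_lcontr fun_eq_iff g)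
  qed
  then show ?thesis by (simp add: qprod_explicit[OF E(1)])
qed

lemma qwedge_coeff_eq:
  "finite E \<Longrightarrow> qwedge_coeff E w n f g vs = qprod E (\<lambda>a b. w [dual a, dual b]) n f g vs / fact n"
  by (simp add: qwedge_coeff_def qprod_explicit)

section \<open>The exterior differential in a chart\<close>

text \<open>The Lie derivative along the constant vector field \<open>v\<close>.\<close>

definition dir :: "'e::real_inner \<Rightarrow> ('e \<Rightarrow> 'e list \<Rightarrow> real) \<Rightarrow> 'e \<Rightarrow> 'e list \<Rightarrow> real" where
  "dir v \<phi> x us = frechet_derivative (\<lambda>y. \<phi> y us) (at x) v"

definition local_d :: "('e::real_inner \<Rightarrow> 'e list \<Rightarrow> real) \<Rightarrow> 'e \<Rightarrow> 'e list \<Rightarrow> real" where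
  "local_d \<phi> x vs = (\<Sum>i<length vs. (-1) ^ i
     * frechet_derivative (\<lambda>y. \<phi> y (take i vs @ drop (Suc i) vs)) (at x) (vs ! i))"

definition smooth_coeffs :: "'e::real_inner set \<Rightarrow> ('e \<Rightarrow> 'e list \<Rightarrow> real) \<Rightarrow> bool" where
  "smooth_coeffs U \<phi> \<longleftrightarrow> (\<forall>vs. smooth_on U (\<lambda>y. \<phi> y vs))"

definition differentiable_coeffs :: "('e::real_inner \<Rightarrow> 'e list \<Rightarrow> real) \<Rightarrow> 'e \<Rightarrow> bool" where
  "differentiable_coeffs \<phi> x \<longleftrightarrow> (\<forall>vs. (\<lambda>y. \<phi> y vs) differentiable (at x))"

definition local_form :: "'e::real_inner set \<Rightarrow> ('e \<Rightarrow> 'e list \<Rightarrow> real) \<Rightarrow> bool" where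
  "local_form U \<phi> \<longleftrightarrow> smooth_coeffs U \<phi> \<and> (\<forall>x\<in>U. multilinear (\<phi> x) \<and> alternating (\<phi> x))"

lemma local_formD:
  assumes "local_form U \<phi>"
  shows "smooth_coeffs U \<phi>" "x \<in> U \<Longrightarrow> multilinear (\<phi> x)" "x \<in> U \<Longrightarrow> alternating (\<phi> x)"
  using assms by (auto simp: local_form_def)

lemma smooth_coeffs_imp_differentiable:
  "smooth_coeffs U \<phi> \<Longrightarrow> x \<in> U \<Longrightarrow> differentiable_coeffs \<phi> x"
  by (auto simp: smooth_coeffs_def differentiable_coeffs_def intro: smooth_on_imp_differentiable)

lemmas local_form_differentiable = smooth_coeffs_imp_differentiable[OF local_formD(1)]

lemma local_d_Nil [simp]: "local_d \<phi> x [] = 0"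
  by (simp add: local_d_def)

text \<open>Cartan's formula for the constant vector field \<open>v\<close>.\<close>

lemma local_d_Cons: "local_d \<phi> x (v # vs) = dir v \<phi> x vs - local_d (\<lambda>y. lcontr v (\<phi> y)) x vs"
  unfolding local_d_def dir_def lcontr_def length_Cons sum.lessThan_Suc_shift
  by (simp add: sum_negf)

lemma lcontr_local_d:
  "lcontr v (local_d \<phi> x) = (\<lambda>us. dir v \<phi> x us - local_d (\<lambda>y. lcontr v (\<phi> y)) x us)"
  by (rule ext) (simp add: lcontr_def[of v "local_d \<phi> x"] local_d_Cons)

lemma dir_cong:
  assumes "open U" "x \<in> U" "\<And>y. y \<in> U \<Longrightarrow> \<phi> y us = \<psi> y us"
  shows "dir v \<phi> x us = dir v \<psi> x us"
  unfolding dir_def using frechet_derivative_cong_open[OF assms] by simp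

text \<open>At a given list \<open>d\<close> sees only the component one degree lower, so a form of
  mixed degree may be cut down to that component.\<close>

lemma local_d_cong_degree:
  assumes "open U" "x \<in> U"
    and "\<And>y us. y \<in> U \<Longrightarrow> Suc (length us) = length vs \<Longrightarrow> \<phi> y us = \<psi> y us"
  shows "local_d \<phi> x vs = local_d \<psi> x vs"
  unfolding local_d_def
proof (intro sum.cong refl)
  fix i assume "i \<in> {..<length vs}"
  then have "frechet_derivative (\<lambda>y. \<phi> y (take i vs @ drop (Suc i) vs)) (at x)
      = frechet_derivative (\<lambda>y. \<psi> y (take i vs @ drop (Suc i) vs)) (at x)"
    by (intro frechet_derivative_cong_open[OF assms(1,2)] assms(3)) auto
  then show "(-1) ^ i * frechet_derivative (\<lambda>y. \<phi> y (take i vs @ drop (Suc i) vs)) (at x) (vs ! i)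
      = (-1) ^ i * frechet_derivative (\<lambda>y. \<psi> y (take i vs @ drop (Suc i) vs)) (at x) (vs ! i)"
    by simp
qed

lemma local_d_cong:
  assumes "open U" "x \<in> U" "\<And>y. y \<in> U \<Longrightarrow> \<phi> y = \<psi> y"
  shows "local_d \<phi> x = local_d \<psi> x"
  by (rule ext, rule local_d_cong_degree[OF assms(1,2)]) (simp add: assms(3))

lemma dir_linear:
  assumes "differentiable_coeffs \<phi> x" "differentiable_coeffs \<psi> x"
  shows "dir v (\<lambda>y us. r * \<phi> y us + s * \<psi> y us) x us = r * dir v \<phi> x us + s * dir v \<psi> x us"
  using assms unfolding dir_def differentiable_coeffs_def
  by (simp add: frechet_derivative_add frechet_derivative_cmult differentiable_mult)

lemma differentiable_coeffs_lcontr: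
  "differentiable_coeffs \<phi> x \<Longrightarrow> differentiable_coeffs (\<lambda>y. lcontr v (\<phi> y)) x"
  by (simp add: differentiable_coeffs_def lcontr_def)

lemma local_d_linear:
  assumes "differentiable_coeffs \<phi> x" "differentiable_coeffs \<psi> x"
  shows "local_d (\<lambda>y us. r * \<phi> y us + s * \<psi> y us) x vs = r * local_d \<phi> x vs + s * local_d \<psi> x vs"
  using assms
proof (induction vs arbitrary: \<phi> \<psi>)
  case (Cons v vs)
  have "local_d (\<lambda>y us. r * \<phi> y us + s * \<psi> y us) x (v # vs) = dir v (\<lambda>y us. r * \<phi> y us + s * \<psi> y us) x vs
    - local_d (\<lambda>y us. r * lcontr v (\<phi> y) us + s * lcontr v (\<psi> y) us) x vs"
    by (simp add: local_d_Cons lcontr_def[abs_def])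
  also have "\<dots> = (r * dir v \<phi> x vs + s * dir v \<psi> x vs)
      - (r * local_d (\<lambda>y. lcontr v (\<phi> y)) x vs + s * local_d (\<lambda>y. lcontr v (\<psi> y)) x vs)"
    by (simp only: dir_linear[OF Cons.prems]
        Cons.IH[OF differentiable_coeffs_lcontr[OF Cons.prems(1)] differentiable_coeffs_lcontr[OF Cons.prems(2)]])
  finally show ?case by (simp add: local_d_Cons algebra_simps)
qed simp

lemma local_d_zero [simp]: "local_d (\<lambda>y us. 0) x vs = 0"
  by (simp add: local_d_def)

lemma local_d_arith:
  assumes "differentiable_coeffs \<phi> x"
  shows "local_d (\<lambda>y us. r * \<phi> y us) x vs = r * local_d \<phi> x vs"
    "local_d (\<lambda>y us. - \<phi> y us) x vs = - local_d \<phi> x vs"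
    "differentiable_coeffs \<psi> x \<Longrightarrow>
      local_d (\<lambda>y us. \<phi> y us + \<psi> y us) x vs = local_d \<phi> x vs + local_d \<psi> x vs"
    "differentiable_coeffs \<psi> x \<Longrightarrow>
      local_d (\<lambda>y us. \<phi> y us - \<psi> y us) x vs = local_d \<phi> x vs - local_d \<psi> x vs"
  using local_d_linear[OF assms assms, of r 0 vs] local_d_linear[OF assms assms, of "-1" 0 vs]
    local_d_linear[OF assms, of \<psi> 1 1 vs] local_d_linear[OF assms, of \<psi> 1 "-1" vs]
  by simp_all

lemma differentiable_coeffs_linear:
  assumes "differentiable_coeffs \<phi> x" "differentiable_coeffs \<psi> x"
  shows "differentiable_coeffs (\<lambda>y us. r * \<phi> y us + s * \<psi> y us) x"
  using assms by (simp add: differentiable_coeffs_def differentiable_mult)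

lemma differentiable_coeffs_sum:
  assumes "finite I" "\<And>i. i \<in> I \<Longrightarrow> differentiable_coeffs (\<phi> i) x"
  shows "differentiable_coeffs (\<lambda>y us. \<Sum>i\<in>I. \<phi> i y us) x"
  using assms by (auto simp: differentiable_coeffs_def intro: differentiable_sum)

lemma local_d_sum:
  assumes "finite I" "\<And>i. i \<in> I \<Longrightarrow> differentiable_coeffs (\<phi> i) x"
  shows "local_d (\<lambda>y us. \<Sum>i\<in>I. \<phi> i y us) x vs = (\<Sum>i\<in>I. local_d (\<phi> i) x vs)"
  using assms
proof (induction I rule: finite_induct)
  case (insert i I)
  then show ?case
    by (simp add: local_d_arith(3) differentiable_coeffs_sum)
qed simp

lemma differentiable_coeffs_grade_inv:
  "differentiable_coeffs \<phi> x \<Longrightarrow> differentiable_coeffs (\<lambda>y. grade_inv (\<phi> y)) x"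
  by (simp add: differentiable_coeffs_def grade_inv_def differentiable_mult)

lemma differentiable_coeffs_wedge:
  assumes "differentiable_coeffs \<phi> x" "differentiable_coeffs \<psi> x"
  shows "differentiable_coeffs (\<lambda>y. wedge (\<phi> y) (\<psi> y)) x"
  using assms unfolding differentiable_coeffs_def wedge_def
  by (intro allI differentiable_sum differentiable_mult differentiable_const) simp_all

lemma dir_wedge:
  assumes "differentiable_coeffs \<phi> x" "differentiable_coeffs \<psi> x"
  shows "dir v (\<lambda>y. wedge (\<phi> y) (\<psi> y)) x vs = wedge (dir v \<phi> x) (\<psi> x) vs + wedge (\<phi> x) (dir v \<psi> x) vs"
  using assms unfolding differentiable_coeffs_def wedge_def dir_def
  by (simp add: frechet_derivative_sum frechet_derivative_mult differentiable_mult
      frechet_derivative_cmult sum.distrib[symmetric] algebra_simps)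

lemma dir_grade_inv:
  assumes "differentiable_coeffs \<phi> x"
  shows "dir v (\<lambda>y. grade_inv (\<phi> y)) x us = grade_inv (dir v \<phi> x) us"
  using assms by (simp add: dir_def grade_inv_def differentiable_coeffs_def frechet_derivative_cmult)

text \<open>The minus sign appears because \<open>d\<close> raises the degree by one.\<close>

lemma local_d_grade_inv:
  assumes "differentiable_coeffs \<phi> x"
  shows "local_d (\<lambda>y. grade_inv (\<phi> y)) x vs = - grade_inv (local_d \<phi> x) vs"
  using assms
proof (induction vs arbitrary: \<phi>)
  case (Cons v vs)
  note d = differentiable_coeffs_lcontr[OF Cons.prems, of v]
  show ?case
    by (simp add: local_d_Cons dir_grade_inv[OF Cons.prems] lcontr_grade_inv
        local_d_arith(2)[OF differentiable_coeffs_grade_inv[OF d]] Cons.IH[OF d])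
      (simp add: grade_inv_def local_d_Cons algebra_simps)
qed (simp add: grade_inv_def)

text \<open>Both sides obey the same recursion in the first argument: Cartan's formula on the left,
  the antiderivation property of contraction on the right.\<close>

lemma local_d_wedge:
  assumes "differentiable_coeffs \<phi> x" "differentiable_coeffs \<psi> x"
  shows "local_d (\<lambda>y. wedge (\<phi> y) (\<psi> y)) x vs =
    wedge (local_d \<phi> x) (\<psi> x) vs + wedge (grade_inv (\<phi> x)) (local_d \<psi> x) vs"
  using assms
proof (induction vs arbitrary: \<phi> \<psi>)
  case (Cons v vs)
  note l = differentiable_coeffs_lcontr[of _ x v]
  note g = differentiable_coeffs_grade_inv[OF Cons.prems(1)]
  have "local_d (\<lambda>y. grade_inv (\<phi> y)) x = (\<lambda>us. - grade_inv (local_d \<phi> x) us)"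
    by (rule ext) (rule local_d_grade_inv[OF Cons.prems(1)])
  then show ?case
    by (simp add: local_d_Cons dir_wedge[OF Cons.prems] lcontr_wedge
        local_d_arith(3)[OF differentiable_coeffs_wedge differentiable_coeffs_wedge] Cons.IH
        l g Cons.prems)
      (simp add: wedge_Cons lcontr_local_d lcontr_grade_inv)
qed simp

lemma smooth_coeffs_dir: "smooth_coeffs U \<phi> \<Longrightarrow> smooth_coeffs U (dir v \<phi>)"
  unfolding smooth_coeffs_def dir_def by (blast intro: smooth_on_frechet_derivative)

lemma smooth_coeffs_local_d:
  assumes "open U" "smooth_coeffs U \<phi>"
  shows "smooth_coeffs U (local_d \<phi>)"
  using assms(2) unfolding smooth_coeffs_def local_d_def
  by (intro allI smooth_on_sum[OF assms(1)] smooth_on_cmult[OF assms(1)] smooth_on_frechet_derivative) blast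

lemma smooth_coeffs_lcontr: "smooth_coeffs U \<phi> \<Longrightarrow> smooth_coeffs U (\<lambda>y. lcontr v (\<phi> y))"
  by (simp add: smooth_coeffs_def lcontr_def)

lemma dir_commute:
  assumes "open U" "x \<in> U" "smooth_coeffs U \<phi>"
  shows "dir u (dir v \<phi>) x us = dir v (dir u \<phi>) x us"
  unfolding dir_def
  by (rule frechet_derivative_commute[OF _ assms(1,2)]) (use assms(3) in \<open>simp add: smooth_coeffs_def\<close>)

lemma dir_sub:
  assumes "differentiable_coeffs \<phi> x" "differentiable_coeffs \<psi> x"
  shows "dir v (\<lambda>y us. \<phi> y us - \<psi> y us) x us = dir v \<phi> x us - dir v \<psi> x us"
  using dir_linear[OF assms, of v 1 "-1"] by simp

lemma dir_local_d:
  assumes "open U" "x \<in> U" "smooth_coeffs U \<phi>"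
  shows "dir v (local_d \<phi>) x vs = local_d (dir v \<phi>) x vs"
  using assms(3)
proof (induction vs arbitrary: \<phi>)
  case Nil
  then show ?case by (simp add: dir_def)
next
  case (Cons u vs)
  note smooth = smooth_coeffs_dir[OF Cons.prems, of u]
    smooth_coeffs_local_d[OF assms(1) smooth_coeffs_lcontr[OF Cons.prems, of u]]
  have "dir v (local_d \<phi>) x (u # vs) = dir v (\<lambda>y us. dir u \<phi> y us - local_d (\<lambda>y. lcontr u (\<phi> y)) y us) x vs"
    unfolding dir_def[of v] local_d_Cons ..
  also have "\<dots> = dir v (dir u \<phi>) x vs - dir v (local_d (\<lambda>y. lcontr u (\<phi> y))) x vs"
    by (rule dir_sub[OF smooth[THEN smooth_coeffs_imp_differentiable[OF _ assms(2)]]])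
  also have "\<dots> = dir u (dir v \<phi>) x vs - local_d (dir v (\<lambda>y. lcontr u (\<phi> y))) x vs"
    by (simp only: dir_commute[OF assms(1,2) Cons.prems] Cons.IH[OF smooth_coeffs_lcontr[OF Cons.prems]])
  also have "\<dots> = local_d (dir v \<phi>) x (u # vs)"
    by (simp add: local_d_Cons dir_def[abs_def] lcontr_def[abs_def])
  finally show ?case .
qed

text \<open>Cartan's formula, used twice, leaves the commutator of \<open>dir v\<close> and
  \<open>local_d\<close>, which vanishes by the symmetry of second derivatives, and the same claim
  for the contracted form.\<close>

lemma local_d_local_d:
  assumes "open U" "x \<in> U" "smooth_coeffs U \<phi>"
  shows "local_d (local_d \<phi>) x vs = 0"
  using assms(3)
proof (induction vs arbitrary: \<phi>)
  case (Cons v vs)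
  note smooth = smooth_coeffs_dir[OF Cons.prems, of v]
    smooth_coeffs_local_d[OF assms(1) smooth_coeffs_lcontr[OF Cons.prems, of v]]
  show ?case
    by (simp add: local_d_Cons lcontr_local_d Cons.IH[OF smooth_coeffs_lcontr[OF Cons.prems]]
        dir_local_d[OF assms(1,2) Cons.prems]
        local_d_arith(4)[OF smooth[THEN smooth_coeffs_imp_differentiable[OF _ assms(2)]]])
qed simp

section \<open>Forms on an open set\<close>

lemma local_form_lcontr: "local_form U \<phi> \<Longrightarrow> local_form U (\<lambda>y. lcontr v (\<phi> y))"
  by (simp add: local_form_def smooth_coeffs_lcontr multilinear_lcontr alternating_lcontr)

lemma local_form_linear:
  assumes "open U" "local_form U \<phi>" "local_form U \<psi>"
  shows "local_form U (\<lambda>y us. r * \<phi> y us + s * \<psi> y us)"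
  using assms
  by (auto simp: local_form_def smooth_coeffs_def intro!: multilinear_add multilinear_cmult
      alternating_linear smooth_on_add smooth_on_cmult)

lemma local_form_grade_inv:
  assumes "open U" "local_form U \<phi>"
  shows "local_form U (\<lambda>y. grade_inv (\<phi> y))"
  using assms
  by (auto simp: local_form_def smooth_coeffs_def multilinear_grade_inv alternating_grade_inv
      grade_inv_def[of "\<phi> y" vs for y vs] intro!: smooth_on_cmult)

lemma local_form_wedge:
  assumes "open U" "local_form U \<phi>" "local_form U \<psi>"
  shows "local_form U (\<lambda>y. wedge (\<phi> y) (\<psi> y))"
proof -
  have "smooth_on U (\<lambda>y. wedge (\<phi> y) (\<psi> y) vs)" for vs
    using assms unfolding wedge_def local_form_def smooth_coeffs_def
    by (intro smooth_on_sum smooth_on_mult smooth_on_const) auto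
  then show ?thesis
    using assms by (auto simp: local_form_def smooth_coeffs_def multilinear_wedge alternating_wedge)
qed

lemma local_form_bcontr:
  assumes "open U" "local_form U \<phi>" "\<And>a b. smooth_on U (\<lambda>y. W y a b)"
  shows "local_form U (\<lambda>y. bcontr E (W y) (\<phi> y))"
proof -
  have "smooth_on U (\<lambda>y. bcontr E (W y) (\<phi> y) vs)" for vs
    using assms unfolding bcontr_def local_form_def smooth_coeffs_def
    by (intro smooth_on_sum smooth_on_mult smooth_on_cmult) auto
  then show ?thesis
    using assms by (auto simp: local_form_def smooth_coeffs_def multilinear_bcontr alternating_bcontr)
qed

text \<open>The linearity and antisymmetry relations hold throughout an open set, so they may be
  differentiated.\<close>

lemma local_form_dir:
  assumes "open U" "local_form U \<phi>"
  shows "local_form U (dir v \<phi>)"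
proof -
  have diff: "(\<lambda>y. \<phi> y us) differentiable (at x)" if "x \<in> U" for x us
    using local_form_differentiable[OF assms(2) that] by (simp add: differentiable_coeffs_def)
  have "multilinear (dir v \<phi> x)" if "x \<in> U" for x
  proof -
    have "dir v \<phi> x (us @ (a + b) # vs) = dir v \<phi> x (us @ a # vs) + dir v \<phi> x (us @ b # vs)" for us vs a b
    proof -
      have "\<phi> y (us @ (a + b) # vs) = \<phi> y (us @ a # vs) + \<phi> y (us @ b # vs)" if "y \<in> U" for y
        using local_formD(2)[OF assms(2) that] by (simp add: multilinear_def linear_iff)
      then have "frechet_derivative (\<lambda>y. \<phi> y (us @ (a + b) # vs)) (at x)
          = frechet_derivative (\<lambda>y. \<phi> y (us @ a # vs) + \<phi> y (us @ b # vs)) (at x)"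
        by (rule frechet_derivative_cong_open[OF assms(1) that])
      then show ?thesis by (simp add: dir_def frechet_derivative_add diff[OF that])
    qed
    moreover have "dir v \<phi> x (us @ (r *\<^sub>R a) # vs) = r * dir v \<phi> x (us @ a # vs)" for us vs r a
    proof -
      have "\<phi> y (us @ (r *\<^sub>R a) # vs) = r * \<phi> y (us @ a # vs)" if "y \<in> U" for y
        using local_formD(2)[OF assms(2) that] by (simp add: multilinear_def linear_iff)
      then have "frechet_derivative (\<lambda>y. \<phi> y (us @ (r *\<^sub>R a) # vs)) (at x)
          = frechet_derivative (\<lambda>y. r * \<phi> y (us @ a # vs)) (at x)"
        by (rule frechet_derivative_cong_open[OF assms(1) that])
      then show ?thesis by (simp add: dir_def frechet_derivative_cmult diff[OF that])
    qed
    ultimately show ?thesis by (simp add: multilinear_def linear_iff)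
  qed
  moreover have "alternating (dir v \<phi> x)" if "x \<in> U" for x
  proof (rule alternatingI)
    fix us a b vs
    have "\<phi> y (us @ a # b # vs) = (-1) * \<phi> y (us @ b # a # vs)" if "y \<in> U" for y
      using alternatingD[OF local_formD(3)[OF assms(2) that], of us a b vs] by simp
    then have "frechet_derivative (\<lambda>y. \<phi> y (us @ a # b # vs)) (at x)
        = frechet_derivative (\<lambda>y. (-1) * \<phi> y (us @ b # a # vs)) (at x)"
      by (rule frechet_derivative_cong_open[OF assms(1) that])
    then show "dir v \<phi> x (us @ a # b # vs) = - dir v \<phi> x (us @ b # a # vs)"
      using frechet_derivative_cmult[OF diff[OF that], of "-1" "us @ b # a # vs" v] by (simp add: dir_def)
  qed
  ultimately show ?thesis
    using assms(2) by (simp add: local_form_def smooth_coeffs_dir)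
qed

lemma local_d_slot_linear:
  assumes "open U" "x \<in> U" "local_form U \<phi>"
  shows "linear (\<lambda>v. local_d \<phi> x (us @ v # vs))"
  using assms(3)
proof (induction us arbitrary: \<phi>)
  case Nil
  note diff = local_form_differentiable[OF local_form_lcontr[OF Nil] assms(2)]
  have "local_d (\<lambda>y. lcontr (a + b) (\<phi> y)) x = local_d (\<lambda>y us. lcontr a (\<phi> y) us + lcontr b (\<phi> y) us) x"
    "local_d (\<lambda>y. lcontr (r *\<^sub>R a) (\<phi> y)) x = local_d (\<lambda>y us. r * lcontr a (\<phi> y) us) x" for a b r
    by (rule local_d_cong[OF assms(1,2)], simp add: lcontr_linear[OF local_formD(2)[OF Nil]])+
  then have "linear (\<lambda>v. local_d (\<lambda>y. lcontr v (\<phi> y)) x vs)"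
    by (simp add: linear_iff local_d_arith[OF diff] diff)
  moreover have "linear (\<lambda>v. dir v \<phi> x vs)"
    using linear_frechet_derivative_smooth[of U "\<lambda>y. \<phi> y vs" x] assms(2) local_formD(1)[OF Nil]
    by (simp add: dir_def smooth_coeffs_def)
  ultimately show ?case by (simp add: local_d_Cons linear_compose_sub)
next
  case (Cons u us)
  have "linear (\<lambda>v. dir u \<phi> x (us @ v # vs))"
    using local_formD(2)[OF local_form_dir[OF assms(1) Cons.prems] assms(2)] by (simp add: multilinear_def)
  then show ?case
    using Cons.IH[OF local_form_lcontr[OF Cons.prems, of u]] by (simp add: local_d_Cons linear_compose_sub)
qed

text \<open>Two uses of Cartan's formula give a difference of directional derivatives in which
  \<open>u\<close> and \<open>v\<close> trade places, and \<open>d\<close> of a double contraction;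
  both are antisymmetric.\<close>

lemma local_d_swap:
  assumes "open U" "x \<in> U" "local_form U \<phi>"
  shows "local_d \<phi> x (us @ u # v # vs) = - local_d \<phi> x (us @ v # u # vs)"
  using assms(3)
proof (induction us arbitrary: \<phi>)
  case Nil
  note diff = local_form_differentiable[OF local_form_lcontr[OF local_form_lcontr[OF Nil]] assms(2)]
  have dir_lcontr: "dir a (\<lambda>y. lcontr b (\<phi> y)) x vs = dir a \<phi> x (b # vs)" for a b
    by (simp add: dir_def lcontr_def)
  have "lcontr v (lcontr u (\<phi> y)) us = - lcontr u (lcontr v (\<phi> y)) us" if "y \<in> U" for y us
    using alternating_swap[OF local_formD(3)[OF Nil that], of u v us] by (simp add: lcontr_def)
  then have "local_d (\<lambda>y. lcontr v (lcontr u (\<phi> y))) x = local_d (\<lambda>y us. - lcontr u (lcontr v (\<phi> y)) us) x"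
    by (intro local_d_cong[OF assms(1,2)] ext)
  then show ?case by (simp add: local_d_Cons dir_lcontr local_d_arith(2)[OF diff])
next
  case (Cons w us)
  show ?case
    using alternatingD[OF local_formD(3)[OF local_form_dir[OF assms(1) Cons.prems, of w] assms(2)], of us u v vs]
      Cons.IH[OF local_form_lcontr[OF Cons.prems, of w]]
    by (simp add: local_d_Cons)
qed

lemma local_form_local_d:
  assumes "open U" "local_form U \<phi>"
  shows "local_form U (local_d \<phi>)"
proof -
  have "alternating (local_d \<phi> x)" if "x \<in> U" for x
    by (rule alternatingI) (rule local_d_swap[OF assms(1) that assms(2)])
  then show ?thesis
    using smooth_coeffs_local_d[OF assms(1) local_formD(1)[OF assms(2)]]
      local_d_slot_linear[OF assms(1) _ assms(2)]
    by (simp add: local_form_def multilinear_def)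
qed

section \<open>Naturality of the exterior differential\<close>

text \<open>The coordinate differential in the direction \<open>a\<close>, extended by 0 to all
  degrees other than 1.\<close>

definition covec :: "'e::real_inner \<Rightarrow> 'e list \<Rightarrow> real" where
  "covec a us = (if length us = 1 then hd us \<bullet> a else 0)"

definition pullback :: "('e::real_inner \<Rightarrow> 'e) \<Rightarrow> ('e \<Rightarrow> 'e list \<Rightarrow> real) \<Rightarrow> 'e \<Rightarrow> 'e list \<Rightarrow> real" where
  "pullback \<tau> \<beta> y us = \<beta> (\<tau> y) (map (frechet_derivative \<tau> (at y)) us)"

text \<open>The error is orthogonal to the basis, hence to its span, hence to itself.\<close>

lemma orthonormal_basis_expand:
  assumes "orthonormal_basis E"
  shows "(\<Sum>a\<in>E. (v \<bullet> a) *\<^sub>R a) = v"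
proof -
  define u where "u = v - (\<Sum>a\<in>E. (v \<bullet> a) *\<^sub>R a)"
  have E: "finite E" "\<And>a b. a \<in> E \<Longrightarrow> b \<in> E \<Longrightarrow> a \<bullet> b = (if a = b then 1 else 0)" "span E = UNIV"
    using assms by (auto simp: orthonormal_basis_def)
  have "orthogonal u b" if "b \<in> E" for b
  proof -
    have "(\<Sum>a\<in>E. (v \<bullet> a) * (a \<bullet> b)) = (\<Sum>a\<in>E. if a = b then v \<bullet> a else 0)"
      using E(2) that by (intro sum.cong) auto
    then show ?thesis
      using E(1) that by (simp add: orthogonal_def u_def inner_diff_left inner_sum_left)
  qed
  then have "orthogonal u u"
    using orthogonal_to_span[of u E u] E(3) by simp
  then show ?thesis by (simp add: orthogonal_def u_def)
qed

lemma multilinear_expand: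
  assumes "orthonormal_basis E" "multilinear f"
  shows "f (us @ v # vs) = (\<Sum>a\<in>E. (v \<bullet> a) * f (us @ a # vs))"
proof -
  have lin: "linear (\<lambda>v. f (us @ v # vs))" using assms(2) by (simp add: multilinear_def)
  have "f (us @ v # vs) = f (us @ (\<Sum>a\<in>E. (v \<bullet> a) *\<^sub>R a) # vs)"
    by (simp add: orthonormal_basis_expand[OF assms(1)])
  also have "\<dots> = (\<Sum>a\<in>E. (v \<bullet> a) * f (us @ a # vs))"
    by (simp add: linear_sum[OF lin] linear_scale[OF lin])
  finally show ?thesis .
qed

lemma grade_inv_scalar: "grade_inv (\<lambda>us. if us = [] then r else 0) = (\<lambda>us. if us = [] then r else 0)"
  by (auto simp: grade_inv_def)

lemma lcontr_scalar: "lcontr v (\<lambda>us. if us = [] then r else 0) = (\<lambda>us. 0)"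
  by (auto simp: lcontr_def)

lemma wedge_scalar: "wedge (\<lambda>us. if us = [] then r else 0) g vs = r * g vs"
proof (induction vs arbitrary: g)
  case (Cons v vs)
  show ?case by (simp add: wedge_Cons grade_inv_scalar lcontr_scalar Cons) (simp add: lcontr_def)
qed simp

lemma lcontr_covec: "lcontr v (covec a) = (\<lambda>us. if us = [] then v \<bullet> a else 0)"
  by (auto simp: lcontr_def covec_def)

lemma grade_inv_covec: "grade_inv (covec a) = (\<lambda>us. - covec a us)"
  by (auto simp: grade_inv_def covec_def)

lemma wedge_covec_Cons:
  "wedge (covec a) g (v # vs) = (v \<bullet> a) * g vs - wedge (covec a) (lcontr v g) vs"
  by (simp add: wedge_Cons lcontr_covec grade_inv_covec wedge_scalar)

text \<open>Contraction with \<open>v\<close> extracts the \<open>v\<close>-component of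
  \<open>f\<close> once and leaves the same sum for the contracted function, so every argument
  contributes one copy of \<open>f\<close>.\<close>

lemma euler_identity:
  assumes "orthonormal_basis E" "multilinear f" "alternating f"
  shows "(\<Sum>a\<in>E. wedge (covec a) (lcontr a f) vs) = real (length vs) * f vs"
  using assms(2,3)
proof (induction vs arbitrary: f)
  case Nil
  then show ?case by (simp add: covec_def)
next
  case (Cons v vs)
  have swap: "lcontr v (lcontr a f) = (\<lambda>us. - lcontr a (lcontr v f) us)" for a
  proof
    fix us
    show "lcontr v (lcontr a f) us = - lcontr a (lcontr v f) us"
      using alternating_swap[OF Cons.prems(2), of a v us] by (simp add: lcontr_def)
  qed
  have "(\<Sum>a\<in>E. wedge (covec a) (lcontr a f) (v # vs))
      = (\<Sum>a\<in>E. (v \<bullet> a) * f (a # vs)) + (\<Sum>a\<in>E. wedge (covec a) (lcontr a (lcontr v f)) vs)"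
    by (simp add: wedge_covec_Cons swap sum.distrib) (simp add: lcontr_def)
  also have "\<dots> = f (v # vs) + real (length vs) * lcontr v f vs"
    using multilinear_expand[OF assms(1) Cons.prems(1), of "[]" v vs]
      Cons.IH[OF multilinear_lcontr[OF Cons.prems(1)] alternating_lcontr[OF Cons.prems(2)]]
    by simp
  finally show ?case by (simp add: lcontr_def[of v f] algebra_simps)
qed

lemma wedge_map: "wedge f g (map L vs) = wedge (\<lambda>us. f (map L us)) (\<lambda>us. g (map L us)) vs"
  by (simp add: wedge_def nths_map)

lemma local_form_covec: "local_form U (\<lambda>_. covec a)"
proof -
  have "multilinear (covec a)"
    unfolding multilinear_def covec_def by (auto simp: linear_iff inner_add_left)
  moreover have "alternating (covec a)"
    by (rule alternatingI) (simp add: covec_def)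
  ultimately show ?thesis by (simp add: local_form_def smooth_coeffs_def smooth_on_const)
qed

locale smooth_map =
  fixes U V :: "'e::real_inner set" and \<tau> :: "'e \<Rightarrow> 'e" and E :: "'e set"
  assumes E: "orthonormal_basis E" and U: "open U" and V: "open V"
    and smooth: "smooth_on U \<tau>" and maps: "\<And>y. y \<in> U \<Longrightarrow> \<tau> y \<in> V"
begin

text \<open>Expanding each transported argument in the basis gives finite sums of products of
  differentiable functions. Differentiability at a point suffices for the Leibniz rule, so higher
  smoothness of composites never comes up.\<close>

lemma differentiable_pullback:
  assumes "local_form V \<beta>" "x \<in> U"
  shows "differentiable_coeffs (pullback \<tau> \<beta>) x"
proof -
  have comp: "(\<lambda>y. \<beta> (\<tau> y) us) differentiable (at x)" for us
  proof -
    have "(\<lambda>z. \<beta> z us) differentiable (at (\<tau> x))"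
      using local_form_differentiable[OF assms(1) maps[OF assms(2)]] by (simp add: differentiable_coeffs_def)
    from differentiable_chain_at[OF smooth_on_imp_differentiable[OF smooth assms(2)] this]
    show ?thesis by (simp add: o_def)
  qed
  \<comment> \<open>The prefix \<open>pre\<close> collects the arguments already expanded.\<close>
  have "(\<lambda>y. \<beta> (\<tau> y) (pre @ map (frechet_derivative \<tau> (at y)) us)) differentiable (at x)" for pre us
  proof (induction us arbitrary: pre)
    case Nil
    then show ?case using comp by simp
  next
    case (Cons u us)
    have "(\<lambda>y. \<Sum>a\<in>E. (frechet_derivative \<tau> (at y) u \<bullet> a)
        * \<beta> (\<tau> y) ((pre @ [a]) @ map (frechet_derivative \<tau> (at y)) us)) differentiable (at x)"
    proof (intro differentiable_sum ballI differentiable_mult Cons.IH)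
      show "finite E" using E by (simp add: orthonormal_basis_def)
      fix a
      have "(\<lambda>y. frechet_derivative \<tau> (at y) u) differentiable (at x)"
        by (rule smooth_on_imp_differentiable[OF smooth_on_frechet_derivative[OF smooth] assms(2)])
      then show "(\<lambda>y. frechet_derivative \<tau> (at y) u \<bullet> a) differentiable (at x)"
        by (simp add: differentiable_inner)
    qed
    moreover have "\<beta> (\<tau> y) (pre @ map (frechet_derivative \<tau> (at y)) (u # us))
        = (\<Sum>a\<in>E. (frechet_derivative \<tau> (at y) u \<bullet> a)
          * \<beta> (\<tau> y) ((pre @ [a]) @ map (frechet_derivative \<tau> (at y)) us))" if "y \<in> U" for y
      using multilinear_expand[OF E local_formD(2)[OF assms(1) maps[OF that]], of pre
          "frechet_derivative \<tau> (at y) u" "map (frechet_derivative \<tau> (at y)) us"]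
      by simp
    ultimately show ?case
      by (rule iffD2[OF differentiable_cong_open[OF U assms(2)], rotated])
  qed
  from this[of "[]"] show ?thesis by (simp add: differentiable_coeffs_def pullback_def)
qed

text \<open>The pullback is \<open>d\<close> of the component of \<tau> along \<open>a\<close>, so
  \<open>d d = 0\<close> applies. This is where the second derivatives of \<tau> disappear.\<close>

lemma closed_pullback_covec:
  assumes "x \<in> U"
  shows "local_d (pullback \<tau> (\<lambda>_. covec a)) x vs = 0"
proof -
  define F where "F y us = (if us = [] then \<tau> y \<bullet> a else 0)" for y and us :: "'e list"
  have "smooth_on U (\<lambda>y. F y us)" for us
    using smooth_on_bounded_linear[OF U bounded_linear_inner_left smooth] smooth_on_const
    by (cases "us = []") (simp_all add: F_def)
  then have F: "smooth_coeffs U F" by (simp add: smooth_coeffs_def)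
  have "pullback \<tau> (\<lambda>_. covec a) y = local_d F y" if y: "y \<in> U" for y
  proof
    fix us
    show "pullback \<tau> (\<lambda>_. covec a) y us = local_d F y us"
    proof (cases us)
      case (Cons u us')
      have "lcontr u (F z) = (\<lambda>us. 0)" for z by (simp add: F_def lcontr_def fun_eq_iff)
      moreover have "dir u F y us' = (if us' = [] then frechet_derivative \<tau> (at y) u \<bullet> a else 0)"
        using frechet_derivative_bounded_linear[OF bounded_linear_inner_left smooth_on_imp_differentiable[OF smooth y]]
        by (simp add: dir_def F_def)
      ultimately show ?thesis by (simp add: Cons local_d_Cons pullback_def covec_def)
    qed (simp add: pullback_def covec_def)
  qed
  from local_d_cong[OF U assms this] local_d_local_d[OF U assms F] show ?thesis by simp
qed

text \<open>
  Induction on the degree: by Euler's identity a form of positive degree is a combination of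
  products of coordinate differentials, whose pullbacks are closed, with forms of lower degree.
\<close>

lemma local_d_pullback_homogeneous:
  assumes "x \<in> U" "local_form V \<beta>"
    and "\<And>z us. z \<in> V \<Longrightarrow> length us \<noteq> k \<Longrightarrow> \<beta> z us = 0"
  shows "local_d (pullback \<tau> \<beta>) x vs = local_d \<beta> (\<tau> x) (map (frechet_derivative \<tau> (at x)) vs)"
  using assms(2,3)
proof (induction k arbitrary: \<beta> vs)
  case 0
  let ?D = "frechet_derivative \<tau> (at x)"
  show ?case
  proof (cases vs)
    case (Cons v vs')
    \<comment> \<open>In degree 0 all contractions vanish; what is left of Cartan's formula is the
      chain rule at the empty list.\<close>
    have "local_d (\<lambda>y. lcontr v (pullback \<tau> \<beta> y)) x vs' = local_d (\<lambda>y us. 0) x vs'"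
      by (rule local_d_cong_degree[OF U assms(1)]) (use 0(2)[OF maps] in \<open>simp add: lcontr_def pullback_def\<close>)
    moreover have "local_d (\<lambda>y. lcontr (?D v) (\<beta> y)) (\<tau> x) (map ?D vs') = local_d (\<lambda>y us. 0) (\<tau> x) (map ?D vs')"
      by (rule local_d_cong_degree[OF V maps[OF assms(1)]]) (use 0(2) in \<open>simp add: lcontr_def\<close>)
    moreover have "dir v (pullback \<tau> \<beta>) x vs' = dir (?D v) \<beta> (\<tau> x) (map ?D vs')"
    proof (cases vs')
      case Nil
      have "(\<lambda>z. \<beta> z []) differentiable (at (\<tau> x))"
        using local_form_differentiable[OF 0(1) maps[OF assms(1)]] by (simp add: differentiable_coeffs_def)
      from frechet_derivative_compose[OF smooth_on_imp_differentiable[OF smooth assms(1)] this]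
      show ?thesis by (simp add: Nil dir_def pullback_def o_def fun_eq_iff)
    next
      case (Cons u us)
      have "dir v (pullback \<tau> \<beta>) x vs' = dir v (\<lambda>y us. 0) x vs'"
        by (rule dir_cong[OF U assms(1)]) (use 0(2)[OF maps] in \<open>simp add: Cons pullback_def\<close>)
      moreover have "dir (?D v) \<beta> (\<tau> x) (map ?D vs') = dir (?D v) (\<lambda>y us. 0) (\<tau> x) (map ?D vs')"
        by (rule dir_cong[OF V maps[OF assms(1)]]) (use 0(2) in \<open>simp add: Cons\<close>)
      ultimately show ?thesis by (simp add: dir_def)
    qed
    ultimately show ?thesis by (simp add: Cons local_d_Cons)
  qed simp
next
  case (Suc m)
  let ?D = "frechet_derivative \<tau> (at x)"
  have fin: "finite E" using E by (simp add: orthonormal_basis_def)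
  let ?l = "\<lambda>a z. lcontr a (\<beta> z)" and ?e = "\<lambda>a _. covec a"
  note form_l = local_form_lcontr[OF Suc.prems(1)]
  note dl = differentiable_pullback[OF form_l assms(1)]
  note de = differentiable_pullback[OF local_form_covec assms(1)]
  note d'l = local_form_differentiable[OF form_l maps[OF assms(1)]]
  note d'e = local_form_differentiable[OF local_form_covec maps[OF assms(1)]]
  have scale: "differentiable_coeffs (\<lambda>y us. r * \<phi> y us) y" if "differentiable_coeffs \<phi> y" for r \<phi> and y :: 'e
    using differentiable_coeffs_linear[OF that that, of r 0] by simp
  \<comment> \<open>Euler's identity divided by the degree; in other degrees both sides are
    0.\<close>
  have beta: "\<beta> z us = (\<Sum>a\<in>E. 1 / Suc m * wedge (covec a) (?l a z) us)" if "z \<in> V" for z us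
  proof -
    have "(\<Sum>a\<in>E. wedge (covec a) (?l a z) us) = real (Suc m) * \<beta> z us"
      using euler_identity[OF E local_formD(2,3)[OF Suc.prems(1) that], of us] Suc.prems(2)[OF that, of us]
      by (cases "length us = Suc m") auto
    then show ?thesis by (simp add: sum_divide_distrib[symmetric])
  qed
  have IH: "local_d (pullback \<tau> (?l a)) x = (\<lambda>us. local_d (?l a) (\<tau> x) (map ?D us))" for a
    by (rule ext, rule Suc.IH[OF form_l]) (simp add: lcontr_def Suc.prems(2))
  have "pullback \<tau> \<beta> y = (\<lambda>us. \<Sum>a\<in>E. 1 / Suc m * wedge (pullback \<tau> (?e a) y) (pullback \<tau> (?l a) y) us)"
    if "y \<in> U" for y
    by (rule ext) (simp add: pullback_def[abs_def] wedge_map beta[OF maps[OF that]])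
  then have "local_d (pullback \<tau> \<beta>) x vs
      = local_d (\<lambda>y us. \<Sum>a\<in>E. 1 / Suc m * wedge (pullback \<tau> (?e a) y) (pullback \<tau> (?l a) y) us) x vs"
    by (rule arg_cong[OF local_d_cong[OF U assms(1)], where f = "\<lambda>f. f vs"])
  also have "\<dots> = (\<Sum>a\<in>E. 1 / Suc m * (wedge (local_d (pullback \<tau> (?e a)) x) (pullback \<tau> (?l a) x) vs
      + wedge (grade_inv (pullback \<tau> (?e a) x)) (local_d (pullback \<tau> (?l a)) x) vs))"
    by (subst local_d_sum[OF fin])
      (simp_all only: scale differentiable_coeffs_wedge de dl local_d_arith(1) local_d_wedge)
  also have "\<dots> = (\<Sum>a\<in>E. 1 / Suc m * wedge (grade_inv (covec a)) (local_d (?l a) (\<tau> x)) (map ?D vs))"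
  proof -
    have "local_d (pullback \<tau> (?e a)) x = (\<lambda>us. 0)" for a
      by (rule ext) (rule closed_pullback_covec[OF assms(1)])
    moreover have "grade_inv (pullback \<tau> (?e a) x) = (\<lambda>us. grade_inv (covec a) (map ?D us))" for a
      by (simp add: grade_inv_def pullback_def fun_eq_iff)
    ultimately show ?thesis by (simp add: IH wedge_map)
  qed
  \<comment> \<open>A vanishing term is added to restore the Leibniz formula, now on the
    target.\<close>
  also have "\<dots> = (\<Sum>a\<in>E. 1 / Suc m * (wedge (local_d (?e a) (\<tau> x)) (?l a (\<tau> x)) (map ?D vs)
      + wedge (grade_inv (covec a)) (local_d (?l a) (\<tau> x)) (map ?D vs)))"
  proof -
    have "local_d (?e a) (\<tau> x) = (\<lambda>us. 0)" for a
      by (simp add: local_d_def fun_eq_iff)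
    then show ?thesis by simp
  qed
  also have "\<dots> = local_d (\<lambda>z us. \<Sum>a\<in>E. 1 / Suc m * wedge (covec a) (?l a z) us) (\<tau> x) (map ?D vs)"
    by (subst local_d_sum[OF fin])
      (simp_all only: scale differentiable_coeffs_wedge d'e d'l local_d_arith(1) local_d_wedge)
  also have "\<dots> = local_d \<beta> (\<tau> x) (map ?D vs)"
    by (rule local_d_cong_degree[OF V maps[OF assms(1)]]) (simp add: beta)
  finally show ?case .
qed

lemma local_d_pullback:
  assumes "x \<in> U" "local_form V \<beta>"
  shows "local_d (pullback \<tau> \<beta>) x vs = local_d \<beta> (\<tau> x) (map (frechet_derivative \<tau> (at x)) vs)"
proof (cases vs)
  case (Cons v vs')
  \<comment> \<open>The component in the only degree that \<open>d\<close> sees at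
    \<open>vs\<close>.\<close>
  define \<beta>' where "\<beta>' z us = (if length us = length vs' then \<beta> z us else 0)" for z us
  have "multilinear (\<beta>' z)" "alternating (\<beta>' z)" if "z \<in> V" for z
  proof -
    show "multilinear (\<beta>' z)"
      using local_formD(2)[OF assms(2) that] unfolding multilinear_def \<beta>'_def
      by (auto simp: linear_iff)
    show "alternating (\<beta>' z)"
    proof (rule alternatingI)
      fix us a b ws
      show "\<beta>' z (us @ a # b # ws) = - \<beta>' z (us @ b # a # ws)"
        using alternatingD[OF local_formD(3)[OF assms(2) that], of us a b ws] by (simp add: \<beta>'_def)
    qed
  qed
  moreover have "smooth_on V (\<lambda>z. \<beta>' z us)" for us
    using local_formD(1)[OF assms(2)] by (cases "length us = length vs'")
      (simp_all add: \<beta>'_def smooth_coeffs_def smooth_on_const)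
  ultimately have \<beta>': "local_form V \<beta>'" by (simp add: local_form_def smooth_coeffs_def)
  have "local_d (pullback \<tau> \<beta>) x vs = local_d (pullback \<tau> \<beta>') x vs"
    by (rule local_d_cong_degree[OF U assms(1)]) (simp add: pullback_def \<beta>'_def Cons)
  also have "\<dots> = local_d \<beta>' (\<tau> x) (map (frechet_derivative \<tau> (at x)) vs)"
    by (rule local_d_pullback_homogeneous[OF assms(1) \<beta>', where k = "length vs'"]) (simp add: \<beta>'_def)
  also have "\<dots> = local_d \<beta> (\<tau> x) (map (frechet_derivative \<tau> (at x)) vs)"
    by (rule local_d_cong_degree[OF V maps[OF assms(1)]]) (simp add: \<beta>'_def Cons)
  finally show ?thesis .
qed simp

end

section \<open>Contraction with a Poisson bivector\<close>

text \<open>Either contraction commutes with contractions by vectors, and the other is a combination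
  of pairs of these.\<close>

lemma bcontr_commute:
  assumes "alternating f"
  shows "bcontr E W (bcontr E W' f) vs = bcontr E W' (bcontr E W f) vs"
proof -
  have bc: "bcontr E W g = (\<lambda>us. 1/2 * (\<Sum>a\<in>E. \<Sum>b\<in>E. W a b * lcontr a (lcontr b g) us))"
    for g :: "'a list \<Rightarrow> real"
    by (simp add: bcontr_def lcontr_def fun_eq_iff)
  have "bcontr E W (bcontr E W' f) vs
      = 1/2 * (\<Sum>a\<in>E. \<Sum>b\<in>E. W a b * bcontr E W' (lcontr a (lcontr b f)) vs)"
    unfolding bc by (simp only: lcontr_bcontr[OF assms] lcontr_bcontr[OF alternating_lcontr[OF assms]])
  also have "\<dots> = bcontr E W' (bcontr E W f) vs"
    unfolding bc by (simp only: bcontr_simps bcontr_sum)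
  finally show ?thesis .
qed

lemma dir_bcontr:
  assumes "finite E" "differentiable_coeffs \<phi> x" "\<And>a b. (\<lambda>y. W y a b) differentiable (at x)"
  shows "dir v (\<lambda>y. bcontr E (W y) (\<phi> y)) x us =
    bcontr E (\<lambda>a b. frechet_derivative (\<lambda>y. W y a b) (at x) v) (\<phi> x) us + bcontr E (W x) (dir v \<phi> x) us"
proof -
  have diff: "(\<lambda>y. W y a b * \<phi> y (b # a # us)) differentiable (at x)" for a b
    using assms by (simp add: differentiable_coeffs_def differentiable_mult)
  have diff1: "(\<lambda>y. \<Sum>b\<in>E. W y a b * \<phi> y (b # a # us)) differentiable (at x)" for a
    using assms(1) diff by (intro differentiable_sum) auto
  have diff2: "(\<lambda>y. \<Sum>a\<in>E. \<Sum>b\<in>E. W y a b * \<phi> y (b # a # us)) differentiable (at x)"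
    using assms(1) diff1 by (intro differentiable_sum) auto
  have "dir v (\<lambda>y. bcontr E (W y) (\<phi> y)) x us
      = 1/2 * (\<Sum>a\<in>E. \<Sum>b\<in>E. frechet_derivative (\<lambda>y. W y a b * \<phi> y (b # a # us)) (at x) v)"
    unfolding dir_def bcontr_def frechet_derivative_cmult[OF diff2] frechet_derivative_sum[OF diff1]
      frechet_derivative_sum[OF diff] ..
  also have "\<dots> = 1/2 * (\<Sum>a\<in>E. \<Sum>b\<in>E. frechet_derivative (\<lambda>y. W y a b) (at x) v * \<phi> x (b # a # us)
      + W x a b * dir v \<phi> x (b # a # us))"
    using assms(2,3)
    by (simp add: differentiable_coeffs_def frechet_derivative_mult dir_def add.commute)
  finally show ?thesis by (simp add: bcontr_def sum.distrib algebra_simps)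
qed

lemma sum_swap_pairs:
  fixes G :: "'a \<Rightarrow> 'a \<Rightarrow> 'a \<Rightarrow> 'a \<Rightarrow> real"
  shows "(\<Sum>a\<in>E. \<Sum>b\<in>E. \<Sum>c\<in>E. \<Sum>e\<in>E. G a b c e) = (\<Sum>c\<in>E. \<Sum>e\<in>E. \<Sum>a\<in>E. \<Sum>b\<in>E. G a b c e)"
proof -
  have "(\<Sum>a\<in>E. \<Sum>b\<in>E. \<Sum>c\<in>E. \<Sum>e\<in>E. G a b c e) = (\<Sum>a\<in>E. \<Sum>c\<in>E. \<Sum>b\<in>E. \<Sum>e\<in>E. G a b c e)"
    by (intro sum.cong refl sum.swap)
  also have "\<dots> = (\<Sum>c\<in>E. \<Sum>a\<in>E. \<Sum>b\<in>E. \<Sum>e\<in>E. G a b c e)"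
    by (rule sum.swap)
  also have "\<dots> = (\<Sum>c\<in>E. \<Sum>a\<in>E. \<Sum>e\<in>E. \<Sum>b\<in>E. G a b c e)"
    by (intro sum.cong refl sum.swap)
  also have "\<dots> = (\<Sum>c\<in>E. \<Sum>e\<in>E. \<Sum>a\<in>E. \<Sum>b\<in>E. G a b c e)"
    by (intro sum.cong refl sum.swap)
  finally show ?thesis .
qed

lemma sum_skew_swap:
  assumes "skew_on E W"
  shows "(\<Sum>a\<in>E. \<Sum>b\<in>E. W a b * F b a) = - (\<Sum>a\<in>E. \<Sum>b\<in>E. W a b * F a b)"
proof -
  have "(\<Sum>a\<in>E. \<Sum>b\<in>E. W a b * F b a) = (\<Sum>a\<in>E. \<Sum>b\<in>E. W b a * F a b)"
    by (rule sum.swap)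
  also have "\<dots> = (\<Sum>a\<in>E. \<Sum>b\<in>E. - (W a b * F a b))"
    using assms unfolding skew_on_def by (intro sum.cong refl) (metis minus_mult_left)
  finally show ?thesis by (simp add: sum_negf)
qed

lemma alternating_cycle:
  assumes "alternating f"
  shows "f [a, b, c] = f [b, c, a]" "f [a, b, c] = f [c, a, b]"
  using alternatingD[OF assms, of "[]" a b "[c]"] alternatingD[OF assms, of "[b]" a c "[]"]
    alternatingD[OF assms, of "[a]" b c "[]"] alternatingD[OF assms, of "[]" a c "[b]"]
  by simp_all

text \<open>The assumption \<open>jacobi\<close> has the signs of the three shuffles in the Schouten
  bracket; by skewness it is the usual cyclic sum.\<close>

locale local_poisson =
  fixes E :: "'e::real_inner set" and U :: "'e set" and W :: "'e \<Rightarrow> 'e \<Rightarrow> 'e \<Rightarrow> real"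
  assumes E: "finite E" and U: "open U"
    and smooth: "\<And>a b. smooth_on U (\<lambda>y. W y a b)"
    and skew: "\<And>y. y \<in> U \<Longrightarrow> skew_on E (W y)"
    and jacobi: "\<And>y a b c. y \<in> U \<Longrightarrow> a \<in> E \<Longrightarrow> b \<in> E \<Longrightarrow> c \<in> E \<Longrightarrow>
      (\<Sum>e\<in>E. W y c e * frechet_derivative (\<lambda>z. W z a b) (at y) e
         - W y a e * frechet_derivative (\<lambda>z. W z c b) (at y) e
         + W y b e * frechet_derivative (\<lambda>z. W z c a) (at y) e) = 0"
begin

abbreviation (input) J :: "('e \<Rightarrow> 'e list \<Rightarrow> real) \<Rightarrow> 'e \<Rightarrow> 'e list \<Rightarrow> real" where
  "J \<phi> \<equiv> (\<lambda>y. bcontr E (W y) (\<phi> y))"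

lemma local_form_J: "local_form U \<phi> \<Longrightarrow> local_form U (J \<phi>)"
  by (rule local_form_bcontr[OF U _ smooth])

text \<open>Paired with an alternating function, the three terms of the Jacobi identity become equal
  after relabelling, so three times the sum vanishes.\<close>

lemma jacobi_contraction:
  assumes "x \<in> U" "alternating f"
  shows "(\<Sum>c\<in>E. \<Sum>e\<in>E. W x c e * (\<Sum>a\<in>E. \<Sum>b\<in>E. frechet_derivative (\<lambda>y. W y a b) (at x) e * f [b, a, c])) = 0"
    (is "?Z = 0")
proof -
  define K where "K c a b = (\<Sum>e\<in>E. W x c e * frechet_derivative (\<lambda>y. W y a b) (at x) e)" for a b c
  let ?T = "\<lambda>F. \<Sum>c\<in>E. \<Sum>a\<in>E. \<Sum>b\<in>E. F c a b :: real"
  have rot: "?T (\<lambda>c a b. F a b c) = ?T F" for F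
  proof -
    have "?T (\<lambda>c a b. F a b c) = (\<Sum>a\<in>E. \<Sum>c\<in>E. \<Sum>b\<in>E. F a b c)" by (rule sum.swap)
    also have "\<dots> = ?T F" by (intro sum.cong refl sum.swap)
    finally show ?thesis .
  qed
  have Z: "?Z = ?T (\<lambda>c a b. K c a b * f [b, a, c])"
  proof (rule sum.cong[OF refl])
    fix c
    have "(\<Sum>e\<in>E. W x c e * (\<Sum>a\<in>E. \<Sum>b\<in>E. frechet_derivative (\<lambda>y. W y a b) (at x) e * f [b, a, c]))
        = (\<Sum>e\<in>E. \<Sum>a\<in>E. \<Sum>b\<in>E. W x c e * frechet_derivative (\<lambda>y. W y a b) (at x) e * f [b, a, c])"
      by (simp add: sum_distrib_left mult.assoc)
    also have "\<dots> = (\<Sum>a\<in>E. \<Sum>e\<in>E. \<Sum>b\<in>E. W x c e * frechet_derivative (\<lambda>y. W y a b) (at x) e * f [b, a, c])"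
      by (rule sum.swap)
    also have "\<dots> = (\<Sum>a\<in>E. \<Sum>b\<in>E. \<Sum>e\<in>E. W x c e * frechet_derivative (\<lambda>y. W y a b) (at x) e * f [b, a, c])"
      by (intro sum.cong refl sum.swap)
    finally show "(\<Sum>e\<in>E. W x c e * (\<Sum>a\<in>E. \<Sum>b\<in>E. frechet_derivative (\<lambda>y. W y a b) (at x) e * f [b, a, c]))
        = (\<Sum>a\<in>E. \<Sum>b\<in>E. K c a b * f [b, a, c])"
      by (simp add: K_def sum_distrib_right)
  qed
  have second: "?T (\<lambda>c a b. K a c b * f [b, a, c]) = - ?Z"
  proof -
    have "?T (\<lambda>c a b. K a c b * f [b, a, c]) = (\<Sum>a\<in>E. \<Sum>c\<in>E. \<Sum>b\<in>E. K a c b * f [b, a, c])"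
      by (rule sum.swap)
    also have "\<dots> = ?T (\<lambda>c a b. - (K c a b * f [b, a, c]))"
    proof (intro sum.cong refl)
      fix a b c
      show "K c a b * f [b, c, a] = - (K c a b * f [b, a, c])"
        using alternatingD[OF assms(2), of "[b]" c a "[]"] by simp
    qed
    finally show ?thesis unfolding Z by (simp add: sum_negf)
  qed
  have third: "?T (\<lambda>c a b. K b c a * f [b, a, c]) = ?Z"
  proof -
    have "?T (\<lambda>c a b. K b c a * f [b, a, c]) = ?T (\<lambda>c a b. K c a b * f [c, b, a])"
      using rot[of "\<lambda>c a b. K b c a * f [b, a, c]"] rot[of "\<lambda>c a b. K c a b * f [c, b, a]"] by simp
    also have "\<dots> = ?Z" unfolding Z
      by (intro sum.cong refl arg_cong2[where f = "(*)"] alternating_cycle(1)[OF assms(2)])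
    finally show ?thesis .
  qed
  have "K c a b - K a c b + K b c a = 0" if "a \<in> E" "b \<in> E" "c \<in> E" for a b c
    using jacobi[OF assms(1) that] by (simp add: K_def sum.distrib sum_subtractf)
  then have "?T (\<lambda>c a b. (K c a b - K a c b + K b c a) * f [b, a, c]) = 0"
    by simp
  moreover have "?T (\<lambda>c a b. (K c a b - K a c b + K b c a) * f [b, a, c])
      = ?T (\<lambda>c a b. K c a b * f [b, a, c]) - ?T (\<lambda>c a b. K a c b * f [b, a, c])
      + ?T (\<lambda>c a b. K b c a * f [b, a, c])"
    by (simp only: distrib_right left_diff_distrib sum.distrib sum_subtractf)
  ultimately have *: "?Z - (- ?Z) + ?Z = 0"
    unfolding Z[symmetric] second third by (rule trans[OF sym, rotated])
  have "z = 0" if "z - (- z) + z = 0" for z :: real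
    using that by linarith
  from this[OF *] show ?thesis .
qed

text \<open>
  Contraction with a constant vector reduces the vanishing of this double commutator to the
  empty list, where it is the Jacobi identity.
\<close>

lemma J_J_local_d:
  assumes "x \<in> U" "local_form U \<phi>"
  shows "bcontr E (W x) (bcontr E (W x) (local_d \<phi> x)) vs
    - 2 * bcontr E (W x) (local_d (J \<phi>) x) vs + local_d (J (J \<phi>)) x vs = 0"
  using assms(2)
proof (induction vs arbitrary: \<phi>)
  case Nil
  let ?w = "W x"
  define D where "D e = dir e \<phi> x" for e
  define DW where "DW e a b = frechet_derivative (\<lambda>y. W y a b) (at x) e" for e a b
  \<comment> \<open>Summation against two copies of the bivector: it changes sign when the indices
    of one pair are exchanged and is unchanged when the pairs are exchanged.\<close>
  define S where "S F = (\<Sum>a\<in>E. \<Sum>b\<in>E. ?w a b * (\<Sum>c\<in>E. \<Sum>e\<in>E. ?w c e * F a b c e))"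
    for F :: "'e \<Rightarrow> 'e \<Rightarrow> 'e \<Rightarrow> 'e \<Rightarrow> real"
  note sk = sum_skew_swap[OF skew[OF assms(1)]]
  have S1: "S (\<lambda>a b c e. F a b e c) = - S F" for F
  proof -
    have "(\<Sum>c\<in>E. \<Sum>e\<in>E. ?w c e * F a b e c) = - (\<Sum>c\<in>E. \<Sum>e\<in>E. ?w c e * F a b c e)" for a b
      by (rule sk)
    then show ?thesis unfolding S_def by (simp only: mult_minus_right sum_negf)
  qed
  have S2: "S (\<lambda>a b c e. F b a c e) = - S F" for F
    unfolding S_def by (rule sk)
  have S3: "S (\<lambda>a b c e. F c e a b) = S F" for F
    unfolding S_def sum_distrib_left by (subst sum_swap_pairs) (simp add: mult.left_commute)
  have alt: "alternating (D e)" for e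
    unfolding D_def by (rule local_formD(3)[OF local_form_dir[OF U Nil] assms(1)])
  have dir_lcontr: "dir v (\<lambda>y. lcontr u (\<psi> y)) x us = dir v \<psi> x (u # us)" for u v us \<psi>
    by (simp add: dir_def lcontr_def)
  let ?F = "\<lambda>a b c e. D e [c, b, a]"
  \<comment> \<open>Cartan's formula on four arguments; cyclic permutations of three arguments bring
    every term to the shape of \<open>?F\<close>.\<close>
  have d: "local_d \<phi> x [e, c, b, a] = ?F a b c e - ?F a b e c + ?F c e a b - ?F c e b a" for a b c e
  proof -
    have "local_d \<phi> x [e, c, b, a] = D e [c, b, a] - D c [e, b, a] + D b [e, c, a] - D a [e, c, b]"
      by (simp add: local_d_Cons dir_lcontr D_def)
    then show ?thesis
      using alternating_cycle(2)[OF alt[of b], of e c a] alternating_cycle(2)[OF alt[of a], of e c b]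
      by simp
  qed
  have "bcontr E ?w (bcontr E ?w (local_d \<phi> x)) [] = 1/4 * S (\<lambda>a b c e. local_d \<phi> x [e, c, b, a])"
    by (simp add: bcontr_def S_def sum_distrib_left)
  also have "S (\<lambda>a b c e. local_d \<phi> x [e, c, b, a])
      = S ?F - S (\<lambda>a b c e. ?F a b e c) + S (\<lambda>a b c e. ?F c e a b) - S (\<lambda>a b c e. ?F c e b a)"
    unfolding d by (simp add: S_def sum.distrib sum_subtractf algebra_simps)
  \<comment> \<open>The symmetries of \<open>S\<close> identify the four terms, which cancels the
    factor 1/4 from the two contractions.\<close>
  also have "\<dots> = 4 * S ?F"
    using S1[of ?F] S3[of ?F] S3[of "\<lambda>a b c e. ?F a b e c"] by simp
  finally have JJd: "bcontr E ?w (bcontr E ?w (local_d \<phi> x)) [] = S ?F" by simp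
  have dirJ: "dir e (J \<phi>) x [c] = 1/2 * (\<Sum>a\<in>E. \<Sum>b\<in>E. DW e a b * \<phi> x [b, a, c])
      + 1/2 * (\<Sum>a\<in>E. \<Sum>b\<in>E. ?w a b * D e [b, a, c])" for e c
    using dir_bcontr[OF E local_form_differentiable[OF Nil assms(1)] smooth_on_imp_differentiable[OF smooth assms(1)]]
    by (simp add: bcontr_def D_def DW_def)
  have "2 * bcontr E ?w (local_d (J \<phi>) x) [] = (\<Sum>c\<in>E. \<Sum>e\<in>E. ?w c e * (dir e (J \<phi>) x [c] - dir c (J \<phi>) x [e]))"
    by (simp add: bcontr_def local_d_Cons dir_lcontr)
  also have "\<dots> = 2 * (\<Sum>c\<in>E. \<Sum>e\<in>E. ?w c e * dir e (J \<phi>) x [c])"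
    using sk[of "\<lambda>c e. dir e (J \<phi>) x [c]"] by (simp add: sum_subtractf right_diff_distrib)
  also have "\<dots> = (\<Sum>c\<in>E. \<Sum>e\<in>E. ?w c e * (\<Sum>a\<in>E. \<Sum>b\<in>E. DW e a b * \<phi> x [b, a, c]))
      + (\<Sum>c\<in>E. \<Sum>e\<in>E. ?w c e * (\<Sum>a\<in>E. \<Sum>b\<in>E. ?w a b * D e [b, a, c]))"
    unfolding dirJ by (simp add: sum_distrib_left sum.distrib algebra_simps)
  \<comment> \<open>The derivatives of the bivector drop out by the Jacobi identity.\<close>
  also have "(\<Sum>c\<in>E. \<Sum>e\<in>E. ?w c e * (\<Sum>a\<in>E. \<Sum>b\<in>E. DW e a b * \<phi> x [b, a, c])) = 0"
    unfolding DW_def by (rule jacobi_contraction[OF assms(1) local_formD(3)[OF Nil assms(1)]])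
  also have "(\<Sum>c\<in>E. \<Sum>e\<in>E. ?w c e * (\<Sum>a\<in>E. \<Sum>b\<in>E. ?w a b * D e [b, a, c])) = S (\<lambda>a b c e. ?F c e a b)"
    unfolding S_def by (intro sum.cong refl arg_cong2[where f = "(*)"] alternating_cycle(2)[OF alt])
  finally have "2 * bcontr E ?w (local_d (J \<phi>) x) [] = S ?F"
    using S3[of ?F] by simp
  \<comment> \<open>The third term is a differential at the empty list, hence 0.\<close>
  with JJd show ?case by simp
next
  case (Cons v vs)
  let ?w = "W x" and ?l = "\<lambda>y. lcontr v (\<phi> y)"
  let ?w' = "\<lambda>a b. frechet_derivative (\<lambda>y. W y a b) (at x) v"
  note J\<phi> = local_form_J[OF Cons.prems]
  note d = local_formD(3)[OF local_form_local_d[OF U] assms(1)]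
  have dirJ: "dir v (J \<psi>) x = (\<lambda>us. bcontr E ?w' (\<psi> x) us + bcontr E ?w (dir v \<psi> x) us)"
    if "local_form U \<psi>" for \<psi>
    by (rule ext, rule dir_bcontr[OF E local_form_differentiable[OF that assms(1)]
          smooth_on_imp_differentiable[OF smooth assms(1)]])
  have lJ: "local_d (\<lambda>y. lcontr v (J \<psi> y)) x = local_d (J (\<lambda>y. lcontr v (\<psi> y))) x"
    if "local_form U \<psi>" for \<psi>
    by (rule local_d_cong[OF U assms(1)]) (rule lcontr_bcontr[OF local_formD(3)[OF that]])
  have lJJ: "local_d (\<lambda>y. lcontr v (J (J \<phi>) y)) x = local_d (J (J ?l)) x"
  proof (rule local_d_cong[OF U assms(1)])
    fix y assume "y \<in> U"
    show "lcontr v (J (J \<phi>) y) = J (J ?l) y"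
      by (simp only: lcontr_bcontr[OF local_formD(3)[OF J\<phi> \<open>y \<in> U\<close>]]
          lcontr_bcontr[OF local_formD(3)[OF Cons.prems \<open>y \<in> U\<close>]])
  qed
  have "bcontr E ?w (bcontr E ?w (local_d \<phi> x)) (v # vs)
      = bcontr E ?w (bcontr E ?w (lcontr v (local_d \<phi> x))) vs"
    using fun_cong[OF lcontr_bcontr[OF alternating_bcontr[OF d[OF Cons.prems]]], of v E ?w E ?w vs]
    unfolding lcontr_bcontr[OF d[OF Cons.prems]] by (simp add: lcontr_def)
  moreover have "bcontr E ?w (local_d (J \<phi>) x) (v # vs) = bcontr E ?w (lcontr v (local_d (J \<phi>) x)) vs"
    using fun_cong[OF lcontr_bcontr[OF d[OF J\<phi>]], of v E ?w vs] by (simp add: lcontr_def)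
  \<comment> \<open>The terms that differentiate the bivector add up to the commutator of the
    contractions with \<open>?w\<close> and with its derivative \<open>?w'\<close>.\<close>
  moreover have "bcontr E ?w' (bcontr E ?w (\<phi> x)) vs = bcontr E ?w (bcontr E ?w' (\<phi> x)) vs"
    by (rule bcontr_commute[OF local_formD(3)[OF Cons.prems assms(1)]])
  moreover have "bcontr E ?w (\<lambda>us. f us - g us) = (\<lambda>us. bcontr E ?w f us - bcontr E ?w g us)" for f g
    by (rule ext) simp
  ultimately show ?case
    using Cons.IH[OF local_form_lcontr[OF Cons.prems, of v]]
    unfolding lcontr_local_d local_d_Cons lJJ lJ[OF Cons.prems] dirJ[OF Cons.prems] dirJ[OF J\<phi>]
    by simp
qed

end

section \<open>Operators on forms of a Poisson manifold\<close>

lemma local_form_cong: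
  assumes "open U" "\<And>y. y \<in> U \<Longrightarrow> \<phi> y = \<psi> y"
  shows "local_form U \<phi> \<longleftrightarrow> local_form U \<psi>"
proof -
  have "smooth_on U (\<lambda>y. \<phi> y vs) \<longleftrightarrow> smooth_on U (\<lambda>y. \<psi> y vs)" for vs
    by (rule smooth_on_cong[OF assms(1)]) (simp add: assms(2))
  then show ?thesis using assms(2) by (simp add: local_form_def smooth_coeffs_def)
qed

lemma diff_form_iff:
  "diff_form \<A> \<alpha> \<longleftrightarrow>
     (\<forall>c x. c \<notin> \<A> \<or> x \<notin> chart_image c \<longrightarrow> \<alpha> c x = (\<lambda>vs. 0)) \<and>
     (\<forall>c\<in>\<A>. local_form (chart_image c) (\<alpha> c)) \<and>
     (\<forall>c\<in>\<A>. \<forall>c'\<in>\<A>. \<forall>x\<in>overlap c c'. \<alpha> c x = pullback (transition c c') (\<alpha> c') x)"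
  unfolding diff_form_def local_form_def smooth_coeffs_def alternating_multilinear_iff pullback_def fun_eq_iff
  by blast

text \<open>One combination with two coefficients covers sums, differences and multiples, so each
  operator gets a single linearity law.\<close>

definition lin :: "real \<Rightarrow> ('m, 'e) form \<Rightarrow> real \<Rightarrow> ('m, 'e) form \<Rightarrow> ('m, 'e) form" where
  "lin r \<alpha> s \<beta> c x vs = r * \<alpha> c x vs + s * \<beta> c x vs"

definition parity_inv :: "('m, 'e) form \<Rightarrow> ('m, 'e) form" where
  "parity_inv \<alpha> c x = grade_inv (\<alpha> c x)"

locale poisson =
  fixes E :: "'e::real_inner set"
    and M :: "'m::{t2_space,second_countable_topology} set"
    and \<A> :: "('m, 'e) chart set"
    and w :: "('m, 'e) mvfield"
  assumes poisson: "poisson_manifold E M \<A> w"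
begin

definition W :: "('m, 'e) chart \<Rightarrow> 'e \<Rightarrow> 'e \<Rightarrow> 'e \<Rightarrow> real" where
  "W c x a b = w c x [dual a, dual b]"

definition P :: "nat \<Rightarrow> ('m, 'e) form \<Rightarrow> ('m, 'e) form \<Rightarrow> ('m, 'e) form" where
  "P n \<alpha> \<beta> c x = qprod E (W c x) n (\<alpha> c x) (\<beta> c x)"

abbreviation "d \<equiv> ext_d \<A>"
abbreviation "J \<equiv> biv_contr E w"
abbreviation "\<delta> \<equiv> koszul E \<A> w"
abbreviation "form \<equiv> diff_form \<A>"

lemma orthonormal: "orthonormal_basis E"
  using poisson by (simp add: poisson_manifold_def smooth_manifold_def)

lemma finite_E: "finite E"
  using orthonormal by (simp add: orthonormal_basis_def)

lemma chart:
  assumes "c \<in> \<A>"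
  shows "open (fst c)" "open (chart_image c)"
    "homeomorphism (fst c) (chart_image c) (snd c) (chart_inv c)"
  using poisson assms by (auto simp: poisson_manifold_def smooth_manifold_def)

lemma overlap:
  assumes "c \<in> \<A>" "c' \<in> \<A>"
  shows "open (overlap c c')" "overlap c c' \<subseteq> chart_image c"
    "x \<in> overlap c c' \<Longrightarrow> transition c c' x \<in> chart_image c'"
    "smooth_on (overlap c c') (transition c c')"
proof -
  note hom = chart(3)[OF assms(1)]
  have eq: "overlap c c' = chart_image c \<inter> chart_inv c -` fst c'"
    using hom unfolding overlap_def homeomorphism_def by (auto simp: chart_image_def)
  have "continuous_on (chart_image c) (chart_inv c)"
    using hom by (simp add: homeomorphism_def)
  then show "open (overlap c c')"
    unfolding eq using chart(2)[OF assms(1)] chart(1)[OF assms(2)] by (rule continuous_open_preimage)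
  show "overlap c c' \<subseteq> chart_image c" unfolding eq by blast
  show "transition c c' x \<in> chart_image c'" if "x \<in> overlap c c'"
    using that unfolding eq by (auto simp: transition_def chart_image_def)
  show "smooth_on (overlap c c') (transition c c')"
    using poisson assms by (simp add: poisson_manifold_def smooth_manifold_def)
qed

lemma smooth_map_transition:
  "c \<in> \<A> \<Longrightarrow> c' \<in> \<A> \<Longrightarrow> smooth_map (overlap c c') (chart_image c') (transition c c') E"
  using overlap chart orthonormal by unfold_locales auto

lemma bivector:
  assumes "c \<in> \<A>" "x \<in> chart_image c"
  shows "multilinear (w c x)" "alternating (w c x)" "length \<xi>s \<noteq> 2 \<Longrightarrow> w c x \<xi>s = 0"
  using poisson assms
  by (simp_all add: poisson_manifold_def multivector_field_def alternating_multilinear_iff)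

lemma smooth_bivector: "c \<in> \<A> \<Longrightarrow> smooth_on (chart_image c) (\<lambda>x. w c x \<xi>s)"
  using poisson by (simp add: poisson_manifold_def multivector_field_def)

lemma skew_W:
  assumes "c \<in> \<A>" "x \<in> chart_image c"
  shows "skew_on E (W c x)"
  unfolding skew_on_def
proof (intro ballI)
  fix a b
  show "W c x a b = - W c x b a"
    using alternating_swap[OF bivector(2)[OF assms], of "dual a" "dual b" "[]"] by (simp add: W_def)
qed

lemma jacobi_W:
  assumes "c \<in> \<A>" "x \<in> chart_image c"
  shows "(\<Sum>e\<in>E. W c x c0 e * frechet_derivative (\<lambda>z. W c z a b) (at x) e
     - W c x a e * frechet_derivative (\<lambda>z. W c z c0 b) (at x) e
     + W c x b e * frechet_derivative (\<lambda>z. W c z c0 a) (at x) e) = 0"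
proof -
  define f where "f e = rcontr (dual e) (w c x)" for e
  define g where "g e us = frechet_derivative (\<lambda>y. w c y us) (at x) e" for e us
  have f0: "f e us = 0" if "length us \<noteq> 1" for e us
    using bivector(3)[OF assms] that by (simp add: f_def rcontr_def)
  \<comment> \<open>As \<open>f e\<close> lives in degree 1, only the three shuffles that feed it
    one argument survive.\<close>
  have wedge: "wedge (f e) (g e) [u, v, z] = f e [u] * g e [v, z] - f e [v] * g e [u, z] + f e [z] * g e [u, v]"
    for e u v z
    by (simp add: wedge_Cons grade_inv_def lcontr_def f0)
  have "0 = schouten E 2 2 (w c) (w c) x [dual c0, dual a, dual b]"
    using poisson assms by (simp add: poisson_manifold_def)
  \<comment> \<open>For two bivectors the exponent of the sign is 9, so the two halves of the
    bracket add up.\<close>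
  also have "\<dots> = 2 * (\<Sum>e\<in>E. wedge (f e) (g e) [dual c0, dual a, dual b])"
    by (simp add: schouten_def f_def g_def[abs_def] sum_distrib_left)
  finally show ?thesis
    by (simp add: wedge) (simp add: f_def g_def rcontr_def W_def)
qed

lemma local_poisson_chart: "c \<in> \<A> \<Longrightarrow> local_poisson E (chart_image c) (W c)"
  using finite_E chart(2) smooth_bivector skew_W jacobi_W
  by unfold_locales (simp_all add: W_def[abs_def])

lemma J_eq: "J \<alpha> c x = bcontr E (W c x) (\<alpha> c x)"
  by (rule ext) (simp add: biv_contr_def bcontr_def W_def lcontr_def)

lemma d_eq: "c \<in> \<A> \<Longrightarrow> x \<in> chart_image c \<Longrightarrow> d \<alpha> c x = local_d (\<alpha> c) x"
  by (rule ext) (simp add: ext_d_def local_d_def)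

lemma d_outside: "c \<notin> \<A> \<or> x \<notin> chart_image c \<Longrightarrow> d \<alpha> c x = (\<lambda>vs. 0)"
  by (rule ext) (auto simp: ext_d_def)

lemma koszul_eq: "\<delta> \<alpha> = lin 1 (J (d \<alpha>)) (-1) (d (J \<alpha>))"
  by (simp add: fun_eq_iff lin_def koszul_def)

lemma formD:
  assumes "form \<alpha>"
  shows "c \<notin> \<A> \<or> x \<notin> chart_image c \<Longrightarrow> \<alpha> c x = (\<lambda>vs. 0)"
    "c \<in> \<A> \<Longrightarrow> local_form (chart_image c) (\<alpha> c)"
    "c \<in> \<A> \<Longrightarrow> c' \<in> \<A> \<Longrightarrow> x \<in> overlap c c' \<Longrightarrow> \<alpha> c x = pullback (transition c c') (\<alpha> c') x"
  using assms unfolding diff_form_iff by blast+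

lemma formI:
  assumes "\<And>c x. c \<notin> \<A> \<or> x \<notin> chart_image c \<Longrightarrow> \<alpha> c x = (\<lambda>vs. 0)"
    "\<And>c. c \<in> \<A> \<Longrightarrow> local_form (chart_image c) (\<alpha> c)"
    "\<And>c c' x. c \<in> \<A> \<Longrightarrow> c' \<in> \<A> \<Longrightarrow> x \<in> overlap c c' \<Longrightarrow> \<alpha> c x = pullback (transition c c') (\<alpha> c') x"
  shows "form \<alpha>"
  using assms unfolding diff_form_iff by blast

lemma alternating_form:
  assumes "form \<alpha>"
  shows "alternating (\<alpha> c x)"
proof (cases "c \<in> \<A> \<and> x \<in> chart_image c")
  case True
  then show ?thesis using local_formD(3)[OF formD(2)[OF assms]] by blast
next
  case False
  then show ?thesis using formD(1)[OF assms] by (auto simp: alternating_def)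
qed

section \<open>Stability of forms under the operators\<close>

lemma form_lin:
  assumes "form \<alpha>" "form \<beta>"
  shows "form (lin r \<alpha> s \<beta>)"
proof (rule formI)
  show "lin r \<alpha> s \<beta> c x = (\<lambda>vs. 0)" if "c \<notin> \<A> \<or> x \<notin> chart_image c" for c x
    by (simp add: fun_eq_iff lin_def formD(1)[OF assms(1) that] formD(1)[OF assms(2) that])
  show "local_form (chart_image c) (lin r \<alpha> s \<beta> c)" if "c \<in> \<A>" for c
    using local_form_linear[OF chart(2) formD(2)[OF assms(1)] formD(2)[OF assms(2)], OF that that that, of r s]
    by (simp add: lin_def[abs_def])
  show "lin r \<alpha> s \<beta> c x = pullback (transition c c') (lin r \<alpha> s \<beta> c') x"
    if "c \<in> \<A>" "c' \<in> \<A>" "x \<in> overlap c c'" for c c' x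
    by (simp add: fun_eq_iff lin_def pullback_def formD(3)[OF assms(1) that] formD(3)[OF assms(2) that])
qed

lemma form_zero: "form (\<lambda>c x vs. 0)"
  by (rule formI) (auto simp: pullback_def local_form_def smooth_coeffs_def smooth_on_const
      multilinear_def alternating_def linear_iff)

lemma form_parity_inv:
  assumes "form \<alpha>"
  shows "form (parity_inv \<alpha>)"
proof (rule formI)
  show "parity_inv \<alpha> c x = (\<lambda>vs. 0)" if "c \<notin> \<A> \<or> x \<notin> chart_image c" for c x
    by (simp add: fun_eq_iff parity_inv_def grade_inv_def formD(1)[OF assms that])
  show "local_form (chart_image c) (parity_inv \<alpha> c)" if "c \<in> \<A>" for c
    using local_form_grade_inv[OF chart(2) formD(2)[OF assms], OF that that]
    by (simp add: parity_inv_def[abs_def])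
  show "parity_inv \<alpha> c x = pullback (transition c c') (parity_inv \<alpha> c') x"
    if "c \<in> \<A>" "c' \<in> \<A>" "x \<in> overlap c c'" for c c' x
    by (simp add: fun_eq_iff parity_inv_def grade_inv_def pullback_def formD(3)[OF assms that])
qed

lemma form_wedge:
  assumes "form \<alpha>" "form \<beta>"
  shows "form (P 0 \<alpha> \<beta>)"
proof (rule formI)
  show "P 0 \<alpha> \<beta> c x = (\<lambda>vs. 0)" if "c \<notin> \<A> \<or> x \<notin> chart_image c" for c x
    by (simp add: fun_eq_iff P_def formD(1)[OF assms(1) that])
  show "local_form (chart_image c) (P 0 \<alpha> \<beta> c)" if "c \<in> \<A>" for c
    using local_form_wedge[OF chart(2) formD(2)[OF assms(1)] formD(2)[OF assms(2)], OF that that that]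
    by (simp add: P_def[abs_def])
  show "P 0 \<alpha> \<beta> c x = pullback (transition c c') (P 0 \<alpha> \<beta> c') x"
    if "c \<in> \<A>" "c' \<in> \<A>" "x \<in> overlap c c'" for c c' x
    by (simp add: fun_eq_iff P_def pullback_def[abs_def] wedge_map formD(3)[OF assms(1) that] formD(3)[OF assms(2) that])
qed

lemma form_d:
  assumes "form \<alpha>"
  shows "form (d \<alpha>)"
proof (rule formI)
  show "d \<alpha> c x = (\<lambda>vs. 0)" if "c \<notin> \<A> \<or> x \<notin> chart_image c" for c x
    by (rule d_outside[OF that])
  show "local_form (chart_image c) (d \<alpha> c)" if "c \<in> \<A>" for c
    using local_form_local_d[OF chart(2)[OF that] formD(2)[OF assms that]]
    by (subst local_form_cong[OF chart(2)[OF that] d_eq[OF that]])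
  show "d \<alpha> c x = pullback (transition c c') (d \<alpha> c') x"
    if "c \<in> \<A>" "c' \<in> \<A>" "x \<in> overlap c c'" for c c' x
  proof
    fix vs
    interpret smooth_map "overlap c c'" "chart_image c'" "transition c c'" E
      by (rule smooth_map_transition[OF that(1,2)])
    have "d \<alpha> c x vs = local_d (pullback (transition c c') (\<alpha> c')) x vs"
      using d_eq[OF that(1), of x \<alpha>] overlap(2)[OF that(1,2)] that(3)
        local_d_cong[OF U that(3) formD(3)[OF assms that(1,2)]] by auto
    also have "\<dots> = pullback (transition c c') (d \<alpha> c') x vs"
      unfolding local_d_pullback[OF that(3) formD(2)[OF assms that(2)]] pullback_def
      by (simp add: d_eq[OF that(2) maps[OF that(3)]])
    finally show "d \<alpha> c x vs = pullback (transition c c') (d \<alpha> c') x vs" .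
  qed
qed

text \<open>A transported covector expands in the dual basis with entries of the derivative of the
  transition map as coefficients; bilinearity does the rest.\<close>

lemma bivector_transform:
  assumes "c \<in> \<A>" "c' \<in> \<A>" "x \<in> overlap c c'"
  shows "W c' (transition c c' x) a' b' =
    (\<Sum>a\<in>E. \<Sum>b\<in>E. (frechet_derivative (transition c c') (at x) a \<bullet> a')
       * (frechet_derivative (transition c c') (at x) b \<bullet> b') * W c x a b)"
proof -
  let ?D = "frechet_derivative (transition c c') (at x)"
  note lin = linear_frechet_derivative_smooth[OF overlap(4)[OF assms(1,2)] assms(3)]
  have bl: "bounded_linear ?D"
    using smooth_on_imp_differentiable[OF overlap(4)[OF assms(1,2)] assms(3)]
    by (simp add: frechet_derivative_works has_derivative_bounded_linear)
  have x: "x \<in> chart_image c" using overlap(2)[OF assms(1,2)] assms(3) by blast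
  note ml = bivector(1)[OF assms(1) x]
  have dual: "dual a' o\<^sub>L Blinfun ?D = (\<Sum>a\<in>E. (?D a \<bullet> a') *\<^sub>R dual a)" for a'
  proof (rule blinfun_eqI)
    fix v
    have "?D v \<bullet> a' = ?D (\<Sum>a\<in>E. (v \<bullet> a) *\<^sub>R a) \<bullet> a'"
      by (simp add: orthonormal_basis_expand[OF orthonormal])
    also have "\<dots> = (\<Sum>a\<in>E. (?D a \<bullet> a') * (v \<bullet> a))"
      by (simp add: linear_sum[OF lin] linear_scale[OF lin] inner_sum_left mult.commute)
    finally show "blinfun_apply (dual a' o\<^sub>L Blinfun ?D) v = blinfun_apply (\<Sum>a\<in>E. (?D a \<bullet> a') *\<^sub>R dual a) v"
      by (simp add: dual_def bounded_linear_Blinfun_apply[OF bl] blinfun.sum_left blinfun.scaleR_left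
          blinfun_inner_left.rep_eq inner_commute)
  qed
  have lin1: "linear (\<lambda>\<xi>. w c x [\<xi>, \<eta>])" for \<eta>
    using ml[unfolded multilinear_def, rule_format, of "[]" "[\<eta>]"] by simp
  have lin2: "linear (\<lambda>\<eta>. w c x [\<xi>, \<eta>])" for \<xi>
    using ml[unfolded multilinear_def, rule_format, of "[\<xi>]" "[]"] by simp
  have "W c' (transition c c' x) a' b' = w c x [dual a' o\<^sub>L Blinfun ?D, dual b' o\<^sub>L Blinfun ?D]"
    using poisson assms by (simp add: W_def poisson_manifold_def multivector_field_def)
  also have "\<dots> = (\<Sum>b\<in>E. (?D b \<bullet> b') * (\<Sum>a\<in>E. (?D a \<bullet> a') * W c x a b))"
    unfolding dual
    by (simp only: linear_sum[OF lin1] linear_scale[OF lin1] linear_sum[OF lin2] linear_scale[OF lin2]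
        W_def real_scaleR_def)
  also have "\<dots> = (\<Sum>b\<in>E. \<Sum>a\<in>E. (?D a \<bullet> a') * (?D b \<bullet> b') * W c x a b)"
    by (simp add: sum_distrib_left mult_ac)
  finally show ?thesis by (subst sum.swap)
qed

lemma form_J:
  assumes "form \<alpha>"
  shows "form (J \<alpha>)"
proof (rule formI)
  show "J \<alpha> c x = (\<lambda>vs. 0)" if "c \<notin> \<A> \<or> x \<notin> chart_image c" for c x
    by (simp add: fun_eq_iff J_eq formD(1)[OF assms that])
  show "local_form (chart_image c) (J \<alpha> c)" if "c \<in> \<A>" for c
  proof -
    have "local_form (chart_image c) (\<lambda>x. bcontr E (W c x) (\<alpha> c x))"
      using local_form_bcontr[OF chart(2)[OF that] formD(2)[OF assms that]] smooth_bivector[OF that]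
      by (simp add: W_def)
    then show ?thesis by (simp add: J_eq[abs_def])
  qed
  show "J \<alpha> c x = pullback (transition c c') (J \<alpha> c') x"
    if "c \<in> \<A>" "c' \<in> \<A>" "x \<in> overlap c c'" for c c' x
  proof
    fix vs
    let ?D = "frechet_derivative (transition c c') (at x)" and ?y = "transition c c' x"
    let ?\<alpha> = "\<alpha> c' ?y" and ?us = "map ?D vs"
    have ml: "multilinear ?\<alpha>"
      by (rule local_formD(2)[OF formD(2)[OF assms that(2)] overlap(3)[OF that]])
    have "?\<alpha> (?D b # ?D a # ?us) = (\<Sum>b'\<in>E. (?D b \<bullet> b') * ?\<alpha> (b' # ?D a # ?us))" for a b
      using multilinear_expand[OF orthonormal ml, of "[]" "?D b" "?D a # ?us"] by simp
    also have "\<dots> a b = (\<Sum>b'\<in>E. (?D b \<bullet> b') * (\<Sum>a'\<in>E. (?D a \<bullet> a') * ?\<alpha> (b' # a' # ?us)))" for a b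
      using multilinear_expand[OF orthonormal ml, of "[b']" "?D a" ?us for b'] by simp
    also have "\<dots> a b = (\<Sum>a'\<in>E. \<Sum>b'\<in>E. (?D a \<bullet> a') * (?D b \<bullet> b') * ?\<alpha> (b' # a' # ?us))" for a b
      by (subst sum.swap) (simp add: sum_distrib_left mult_ac)
    finally have \<alpha>: "?\<alpha> (?D b # ?D a # ?us)
        = (\<Sum>a'\<in>E. \<Sum>b'\<in>E. (?D a \<bullet> a') * (?D b \<bullet> b') * ?\<alpha> (b' # a' # ?us))" for a b .
    have "J \<alpha> c x vs = 1/2 * (\<Sum>a\<in>E. \<Sum>b\<in>E. W c x a b * ?\<alpha> (?D b # ?D a # ?us))"
      by (simp add: J_eq bcontr_def formD(3)[OF assms that] pullback_def)
    also have "\<dots> = 1/2 * (\<Sum>a\<in>E. \<Sum>b\<in>E. \<Sum>a'\<in>E. \<Sum>b'\<in>E.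
        (?D a \<bullet> a') * (?D b \<bullet> b') * W c x a b * ?\<alpha> (b' # a' # ?us))"
      unfolding \<alpha> by (simp add: sum_distrib_left mult_ac)
    \<comment> \<open>With the sums over \<open>a\<close> and \<open>b\<close> inside, the entries
      of the derivative gather around \<open>W c\<close> and form the bivector in the other
      chart.\<close>
    also have "\<dots> = 1/2 * (\<Sum>a'\<in>E. \<Sum>b'\<in>E. \<Sum>a\<in>E. \<Sum>b\<in>E.
        (?D a \<bullet> a') * (?D b \<bullet> b') * W c x a b * ?\<alpha> (b' # a' # ?us))"
      by (subst sum_swap_pairs) (rule refl)
    also have "\<dots> = pullback (transition c c') (J \<alpha> c') x vs"
      by (simp add: pullback_def J_eq bcontr_def bivector_transform[OF that] sum_distrib_right)
    finally show "J \<alpha> c x vs = pullback (transition c c') (J \<alpha> c') x vs" .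
  qed
qed

lemma form_koszul: "form \<alpha> \<Longrightarrow> form (\<delta> \<alpha>)"
  unfolding koszul_eq by (intro form_lin form_J form_d)

section \<open>Commutation relations of \<open>d\<close>, \<open>J\<close> and \<delta>\<close>

lemma J_lin: "J (lin r \<alpha> s \<beta>) = lin r (J \<alpha>) s (J \<beta>)"
  by (simp add: fun_eq_iff J_eq lin_def[abs_def])

lemma d_lin:
  assumes "form \<alpha>" "form \<beta>"
  shows "d (lin r \<alpha> s \<beta>) = lin r (d \<alpha>) s (d \<beta>)"
proof (intro ext)
  fix c x vs
  show "d (lin r \<alpha> s \<beta>) c x vs = lin r (d \<alpha>) s (d \<beta>) c x vs"
  proof (cases "c \<in> \<A> \<and> x \<in> chart_image c")
    case True
    then have "differentiable_coeffs (\<alpha> c) x" "differentiable_coeffs (\<beta> c) x"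
      using formD(2)[OF assms(1)] formD(2)[OF assms(2)] by (blast intro: local_form_differentiable)+
    then show ?thesis
      using True by (simp add: d_eq lin_def local_d_linear[of "\<alpha> c" x "\<beta> c", symmetric]) (simp add: lin_def[abs_def])
  qed (auto simp: d_outside lin_def)
qed

lemma koszul_lin: "form \<alpha> \<Longrightarrow> form \<beta> \<Longrightarrow> \<delta> (lin r \<alpha> s \<beta>) = lin r (\<delta> \<alpha>) s (\<delta> \<beta>)"
  by (simp add: koszul_eq d_lin J_lin form_J) (simp add: lin_def[abs_def] algebra_simps)

lemma d_d: "form \<alpha> \<Longrightarrow> d (d \<alpha>) c x vs = 0"
proof (cases "c \<in> \<A> \<and> x \<in> chart_image c")
  case True
  assume "form \<alpha>"
  then have "local_d (local_d (\<alpha> c)) x vs = 0"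
    using True by (intro local_d_local_d[OF chart(2) _ local_formD(1)[OF formD(2)]]) auto
  moreover have "local_d (d \<alpha> c) x = local_d (local_d (\<alpha> c)) x"
    using True by (intro local_d_cong[OF chart(2)] d_eq) auto
  ultimately show ?thesis using True by (simp add: d_eq)
qed (auto simp: d_outside)

lemma d_wedge:
  assumes "form \<alpha>" "form \<beta>"
  shows "d (P 0 \<alpha> \<beta>) c x vs = P 0 (d \<alpha>) \<beta> c x vs + P 0 (parity_inv \<alpha>) (d \<beta>) c x vs"
proof (cases "c \<in> \<A> \<and> x \<in> chart_image c")
  case True
  then have "differentiable_coeffs (\<alpha> c) x" "differentiable_coeffs (\<beta> c) x"
    using formD(2)[OF assms(1)] formD(2)[OF assms(2)] by (blast intro: local_form_differentiable)+
  then show ?thesis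
    using True local_d_wedge[of "\<alpha> c" x "\<beta> c" vs] by (simp add: d_eq P_def[abs_def] parity_inv_def)
next
  case False
  then show ?thesis
    using formD(1)[OF assms(1)] formD(1)[OF assms(2)]
    by (simp add: d_outside P_def)
qed

text \<open>As \<open>\<delta> = J d - d J\<close>, the difference of the two sides is the double
  commutator \<open>J J d - 2 J d J + d J J\<close>, which vanishes by the Jacobi identity.\<close>

lemma J_koszul:
  assumes "form \<alpha>"
  shows "J (\<delta> \<alpha>) = \<delta> (J \<alpha>)"
proof (intro ext)
  fix c x vs
  show "J (\<delta> \<alpha>) c x vs = \<delta> (J \<alpha>) c x vs"
  proof (cases "c \<in> \<A> \<and> x \<in> chart_image c")
    case True
    then have "c \<in> \<A>" "x \<in> chart_image c" by auto
    then show ?thesis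
      using local_poisson.J_J_local_d[OF local_poisson_chart _ formD(2)[OF assms], of c x vs]
      by (simp add: koszul_eq J_lin lin_def J_eq d_eq) (simp add: J_eq[abs_def])
  next
    case False
    then show ?thesis
      using formD(1)[OF form_J[OF form_koszul[OF assms]]] formD(1)[OF form_koszul[OF form_J[OF assms]]] by simp
  qed
qed

text \<open>Both sides reduce to \<open>d J d\<close> because \<open>d d = 0\<close>.\<close>

lemma d_koszul: "form \<alpha> \<Longrightarrow> d (\<delta> \<alpha>) c x vs = - \<delta> (d \<alpha>) c x vs"
proof -
  assume \<alpha>: "form \<alpha>"
  have dd: "d (d \<alpha>) = (\<lambda>c x vs. 0)" by (intro ext d_d \<alpha>)
  have "d (\<delta> \<alpha>) = lin 1 (d (J (d \<alpha>))) (-1) (d (d (J \<alpha>)))"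
    unfolding koszul_eq by (intro d_lin form_J form_d \<alpha>)
  moreover have "J (d (d \<alpha>)) c x vs = 0" by (simp add: dd J_eq)
  ultimately show ?thesis by (simp add: lin_def koszul_eq d_d form_J \<alpha>)
qed

text \<open>Expanding one \<delta> and moving \<open>J\<close> and \<open>d\<close> past the other
  turns \<open>\<delta> \<delta>\<close> into its own negative.\<close>

lemma koszul_koszul: "form \<alpha> \<Longrightarrow> \<delta> (\<delta> \<alpha>) c x vs = 0"
proof -
  assume \<alpha>: "form \<alpha>"
  have neg: "J (\<lambda>c x vs. - \<beta> c x vs) c x vs = - J \<beta> c x vs" for \<beta>
    by (simp add: J_eq)
  have eq: "\<delta> (d \<alpha>) = (\<lambda>c x vs. - d (\<delta> \<alpha>) c x vs)" using d_koszul[OF \<alpha>] by (simp add: fun_eq_iff)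
  have "\<delta> (\<delta> \<alpha>) = lin 1 (\<delta> (J (d \<alpha>))) (-1) (\<delta> (d (J \<alpha>)))"
    by (subst (2) koszul_eq) (intro koszul_lin form_J form_d \<alpha>)
  then have "\<delta> (\<delta> \<alpha>) c x vs = J (\<delta> (d \<alpha>)) c x vs - \<delta> (d (J \<alpha>)) c x vs"
    by (simp add: lin_def J_koszul form_d \<alpha>)
  also have "\<dots> = - J (d (\<delta> \<alpha>)) c x vs + d (J (\<delta> \<alpha>)) c x vs"
    using d_koszul[OF form_J[OF \<alpha>], of c x vs] by (simp add: eq neg J_koszul \<alpha>)
  also have "\<dots> = - \<delta> (\<delta> \<alpha>) c x vs"
    by (subst (3) koszul_eq) (simp add: lin_def)
  finally show ?thesis by simp
qed

section \<open>Products of forms in all orders\<close>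

lemma P_lin_left: "P n (lin r \<alpha> s \<alpha>') \<beta> = lin r (P n \<alpha> \<beta>) s (P n \<alpha>' \<beta>)"
  by (simp add: fun_eq_iff P_def lin_def[abs_def])

lemma P_lin_right: "P n \<alpha> (lin r \<beta> s \<beta>') = lin r (P n \<alpha> \<beta>) s (P n \<alpha> \<beta>')"
  by (simp add: fun_eq_iff P_def lin_def[abs_def])

lemma P_Suc:
  assumes "form \<alpha>" "form \<beta>"
  shows "P (Suc n) \<alpha> \<beta> = lin 1 (lin 1 (P n (J \<alpha>) \<beta>) 1 (P n \<alpha> (J \<beta>))) (-1) (J (P n \<alpha> \<beta>))"
proof (intro ext)
  fix c x vs
  show "P (Suc n) \<alpha> \<beta> c x vs
    = lin 1 (lin 1 (P n (J \<alpha>) \<beta>) 1 (P n \<alpha> (J \<beta>))) (-1) (J (P n \<alpha> \<beta>)) c x vs"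
  proof (cases "c \<in> \<A> \<and> x \<in> chart_image c")
    case True
    then show ?thesis
      using qprod_Suc[OF skew_W alternating_form[OF assms(1)] alternating_form[OF assms(2)], of c x n c x c x vs]
      by (simp add: P_def lin_def J_eq del: qprod.simps)
  next
    case False
    then have "\<alpha> c x = (\<lambda>vs. 0)" by (intro formD(1)[OF assms(1)]) blast
    moreover have "bcontr E (W c x) (\<lambda>vs. 0) = (\<lambda>vs. 0)" by (rule ext) simp
    moreover have "qprod E (W c x) n (\<lambda>vs. 0) g = (\<lambda>vs. 0)" for g by (rule ext) simp
    ultimately show ?thesis by (simp add: P_def lin_def J_eq del: qprod.simps(2))
  qed
qed

text \<open>By \<open>P_Suc\<close> the product of order \<open>n\<close> is built from the wedge
  product and \<open>J\<close>, so it inherits chart compatibility without a change of variables in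
  the multiple sum.\<close>

lemma form_P: "form \<alpha> \<Longrightarrow> form \<beta> \<Longrightarrow> form (P n \<alpha> \<beta>)"
proof (induction n arbitrary: \<alpha> \<beta>)
  case 0
  then show ?case by (rule form_wedge)
next
  case (Suc n)
  show ?case
    unfolding P_Suc[OF Suc.prems] by (intro form_lin form_J Suc.IH Suc.prems)
qed

lemma J_parity_inv: "J (parity_inv \<alpha>) = parity_inv (J \<alpha>)"
  by (simp add: fun_eq_iff J_eq parity_inv_def grade_inv_def bcontr_def sum_distrib_left mult_ac)

text \<open>
  With \<open>ad B(\<alpha>, \<beta>) = B(J \<alpha>, \<beta>) + B(\<alpha>, J \<beta>) - J B(\<alpha>, \<beta>)\<close>, the operation \<open>ad\<close> maps the defect of this
  identity at \<open>n\<close> to the defect at \<open>n + 1\<close>, and at \<open>n = 0\<close> the defect is zero by the Leibniz rule.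
\<close>

lemma d_P:
  assumes "form \<alpha>" "form \<beta>"
  shows "d (P n \<alpha> \<beta>) c x vs - real n * \<delta> (P (n - 1) \<alpha> \<beta>) c x vs =
    P n (d \<alpha>) \<beta> c x vs - real n * P (n - 1) (\<delta> \<alpha>) \<beta> c x vs
    + P n (parity_inv \<alpha>) (d \<beta>) c x vs - real n * P (n - 1) (parity_inv \<alpha>) (\<delta> \<beta>) c x vs"
  using assms
proof (induction n arbitrary: \<alpha> \<beta> c x vs)
  case 0
  then show ?case by (simp add: d_wedge)
next
  case (Suc n)
  note \<alpha> = Suc.prems(1) and \<beta> = Suc.prems(2)
  let ?\<sigma> = parity_inv
  let ?ad = "\<lambda>B. lin 1 (lin 1 (B (J \<alpha>) \<beta>) 1 (B \<alpha> (J \<beta>))) (-1) (J (B \<alpha> \<beta>))"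
  \<comment> \<open>\<open>A\<close> and \<open>B\<close> are the two sides at \<open>n\<close>,
    kept as operations on pairs of forms so that \<open>ad\<close> can act on them.\<close>
  define A where "A \<alpha> \<beta> = lin 1 (d (P n \<alpha> \<beta>)) (- real n) (\<delta> (P (n - 1) \<alpha> \<beta>))" for \<alpha> \<beta>
  define B where "B \<alpha> \<beta> = lin 1 (lin 1 (P n (d \<alpha>) \<beta>) (- real n) (P (n - 1) (\<delta> \<alpha>) \<beta>))
      1 (lin 1 (P n (?\<sigma> \<alpha>) (d \<beta>)) (- real n) (P (n - 1) (?\<sigma> \<alpha>) (\<delta> \<beta>)))" for \<alpha> \<beta>
  have AB: "A \<alpha> \<beta> = B \<alpha> \<beta>" if "form \<alpha>" "form \<beta>" for \<alpha> \<beta>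
    using Suc.IH[OF that] by (simp add: A_def B_def lin_def fun_eq_iff)
  have comm: "J (d \<gamma>) = lin 1 (d (J \<gamma>)) 1 (\<delta> \<gamma>)" for \<gamma>
    by (simp add: koszul_eq lin_def fun_eq_iff)
  \<comment> \<open>For \<open>n = 0\<close> the truncated index \<open>n - 1\<close> is 0 again,
    and the factor \<open>real n\<close> makes the claim trivial.\<close>
  have pred: "real n * P n \<gamma> \<epsilon> c x vs = real n * (P (n - 1) (J \<gamma>) \<epsilon> c x vs + P (n - 1) \<gamma> (J \<epsilon>) c x vs
      - J (P (n - 1) \<gamma> \<epsilon>) c x vs)" if "form \<gamma>" "form \<epsilon>" for \<gamma> \<epsilon>
    using P_Suc[OF that, of "n - 1"] by (cases n) (simp_all add: lin_def)
  \<comment> \<open>Moving \<open>d\<close> past the outer \<open>J\<close> leaves one extra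
    \<open>\<delta> (P n \<alpha> \<beta>)\<close>, which raises the coefficient from
    \<open>n\<close> to \<open>n + 1\<close>.\<close>
  have "d (P (Suc n) \<alpha> \<beta>) c x vs = d (P n (J \<alpha>) \<beta>) c x vs + d (P n \<alpha> (J \<beta>)) c x vs
      - J (d (P n \<alpha> \<beta>)) c x vs + \<delta> (P n \<alpha> \<beta>) c x vs"
    unfolding P_Suc[OF \<alpha> \<beta>] by (simp add: d_lin form_lin form_J form_P \<alpha> \<beta> comm) (simp add: lin_def)
  moreover have "real n * \<delta> (P n \<alpha> \<beta>) c x vs = real n * (\<delta> (P (n - 1) (J \<alpha>) \<beta>) c x vs
      + \<delta> (P (n - 1) \<alpha> (J \<beta>)) c x vs - J (\<delta> (P (n - 1) \<alpha> \<beta>)) c x vs)"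
  proof (cases n)
    case (Suc m)
    then show ?thesis
      unfolding Suc P_Suc[OF \<alpha> \<beta>]
      by (simp add: koszul_lin form_lin form_J form_P \<alpha> \<beta> J_koszul) (simp add: lin_def)
  qed simp
  ultimately have "d (P (Suc n) \<alpha> \<beta>) c x vs - real (Suc n) * \<delta> (P n \<alpha> \<beta>) c x vs = ?ad A c x vs"
    unfolding A_def J_lin lin_def of_nat_Suc by algebra
  also have "?ad A = ?ad B"
    by (simp add: AB form_J \<alpha> \<beta>)
  \<comment> \<open>Here the extra terms arise inside the arguments, from
    \<open>d (J \<alpha>) = J (d \<alpha>) - \<delta> \<alpha>\<close> and its counterpart for
    \<beta>.\<close>
  also have "?ad B c x vs =
      P (Suc n) (d \<alpha>) \<beta> c x vs - real (Suc n) * P n (\<delta> \<alpha>) \<beta> c x vs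
      + P (Suc n) (?\<sigma> \<alpha>) (d \<beta>) c x vs - real (Suc n) * P n (?\<sigma> \<alpha>) (\<delta> \<beta>) c x vs"
    using pred[OF form_koszul[OF \<alpha>] \<beta>] pred[OF form_parity_inv[OF \<alpha>] form_koszul[OF \<beta>]]
    unfolding P_Suc[OF form_d[OF \<alpha>] \<beta>] P_Suc[OF form_parity_inv[OF \<alpha>] form_d[OF \<beta>]]
    unfolding B_def J_lin comm P_lin_left P_lin_right J_parity_inv J_koszul[OF \<alpha>] J_koszul[OF \<beta>]
      lin_def of_nat_Suc
    by algebra
  finally show ?case by simp
qed

lemma P_assoc:
  assumes "form \<alpha>" "form \<beta>" "form \<gamma>"
  shows "(\<Sum>k\<le>n. (n choose k) * P (n - k) (P k \<alpha> \<beta>) \<gamma> c x vs)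
    = (\<Sum>k\<le>n. (n choose k) * P (n - k) \<alpha> (P k \<beta> \<gamma>) c x vs)"
proof (cases "c \<in> \<A> \<and> x \<in> chart_image c")
  case True
  then show ?thesis
    unfolding P_def by (intro qprod_assoc skew_W alternating_form assms) auto
next
  case False
  then have \<alpha>: "\<alpha> c x = (\<lambda>vs. 0)" by (intro formD(1)[OF assms(1)]) blast
  have "qprod E (W c x) n (\<lambda>vs. 0) g = (\<lambda>vs. 0)" for n g by (rule ext) simp
  then show ?thesis by (simp add: P_def \<alpha>)
qed

lemma P_commute:
  assumes "form \<alpha>" "form \<beta>" "has_parity p (\<alpha> c x)" "has_parity q (\<beta> c x)"
  shows "P n \<alpha> \<beta> c x vs = (-1) ^ (p * q) * P n \<beta> \<alpha> c x vs"
proof (cases "c \<in> \<A> \<and> x \<in> chart_image c")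
  case True
  then show ?thesis
    unfolding P_def by (intro qprod_commute skew_W alternating_form assms) auto
next
  case False
  then have "\<alpha> c x = (\<lambda>vs. 0)" by (intro formD(1)[OF assms(1)]) blast
  then show ?thesis by (simp add: P_def)
qed

lemma P_eq_0:
  assumes "form \<beta>" "card E < n"
  shows "P n \<alpha> \<beta> c x vs = 0"
proof -
  have "\<beta> c x vs = 0" if "\<not> distinct vs" for vs
    using assms(1) that unfolding diff_form_def alternating_multilinear_def by blast
  then show ?thesis unfolding P_def by (rule qprod_eq_0[OF finite_E assms(2)])
qed

end

section \<open>The quantum product and differential\<close>

definition hlin :: "real \<Rightarrow> ('m, 'e) hform \<Rightarrow> real \<Rightarrow> ('m, 'e) hform \<Rightarrow> ('m, 'e) hform" where
  "hlin r a s b n = lin r (a n) s (b n)"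

definition hparity_inv :: "('m, 'e) hform \<Rightarrow> ('m, 'e) hform" where
  "hparity_inv a n = parity_inv (a n)"

abbreviation hzero :: "('m, 'e) hform" where
  "hzero \<equiv> (\<lambda>n c x vs. 0)"

lemma hadd_eq: "hadd a b = hlin 1 a 1 b"
  by (simp add: fun_eq_iff hadd_def hlin_def lin_def)

lemma notin_hsupp: "p \<notin> hsupp a \<Longrightarrow> a p = (\<lambda>c x vs. 0)"
  by (simp add: hsupp_def)

context poisson
begin

text \<open>Extended by 0 to negative orders, so that coefficients of products are sums without side
  conditions on the indices.\<close>

definition Q :: "int \<Rightarrow> ('m, 'e) form \<Rightarrow> ('m, 'e) form \<Rightarrow> ('m, 'e) form" where
  "Q k \<alpha> \<beta> c x vs = (if k < 0 then 0 else P (nat k) \<alpha> \<beta> c x vs / fact (nat k))"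

lemma Q_of_nat: "Q (int n) \<alpha> \<beta> = lin (1 / fact n) (P n \<alpha> \<beta>) 0 (P n \<alpha> \<beta>)"
  by (simp add: fun_eq_iff Q_def lin_def)

lemma Q_neg: "k < 0 \<Longrightarrow> Q k \<alpha> \<beta> = (\<lambda>c x vs. 0)"
  by (simp add: fun_eq_iff Q_def)

lemma form_Q:
  assumes "form \<alpha>" "form \<beta>"
  shows "form (Q k \<alpha> \<beta>)"
proof (cases "k < 0")
  case False
  then obtain n where "k = int n" by (metis nonneg_int_cases not_less)
  then show ?thesis by (simp add: Q_of_nat form_lin form_P assms)
qed (simp add: Q_neg form_zero)

lemma Q_lin_left: "Q k (lin r \<alpha> s \<alpha>') \<beta> = lin r (Q k \<alpha> \<beta>) s (Q k \<alpha>' \<beta>)"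
  by (simp add: fun_eq_iff Q_def P_lin_left) (simp add: lin_def Q_def add_divide_distrib)

lemma Q_lin_right: "Q k \<alpha> (lin r \<beta> s \<beta>') = lin r (Q k \<alpha> \<beta>) s (Q k \<alpha> \<beta>')"
  by (simp add: fun_eq_iff Q_def P_lin_right) (simp add: lin_def Q_def add_divide_distrib)

lemma Q_zero_left [simp]: "Q k (\<lambda>c x vs. 0) \<beta> = (\<lambda>c x vs. 0)"
  by (simp add: fun_eq_iff Q_def P_def)

lemma Q_zero_right [simp]: "Q k \<alpha> (\<lambda>c x vs. 0) = (\<lambda>c x vs. 0)"
  by (simp add: fun_eq_iff Q_def P_def)

lemma Q_sum_left: "Q k (\<lambda>c x vs. \<Sum>i\<in>I. f i c x vs) \<beta> c x vs = (\<Sum>i\<in>I. Q k (f i) \<beta> c x vs)"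
  by (simp add: Q_def P_def qprod_sum_left sum_divide_distrib)

lemma Q_sum_right: "Q k \<alpha> (\<lambda>c x vs. \<Sum>i\<in>I. f i c x vs) c x vs = (\<Sum>i\<in>I. Q k \<alpha> (f i) c x vs)"
  by (simp add: Q_def P_def qprod_sum_right sum_divide_distrib)

lemma Q_eq_0:
  assumes "form \<beta>" "k < 0 \<or> int (card E) < k"
  shows "Q k \<alpha> \<beta> = (\<lambda>c x vs. 0)"
  using assms P_eq_0[OF assms(1), of "nat k"] by (auto simp: fun_eq_iff Q_def)

lemma d_zero: "d (\<lambda>c x vs. 0) = (\<lambda>c x vs. 0)"
  by (simp add: fun_eq_iff ext_d_def)

lemma koszul_zero: "\<delta> (\<lambda>c x vs. 0) = (\<lambda>c x vs. 0)"
proof -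
  have J_zero: "J (\<lambda>c x vs. 0) = (\<lambda>c x vs. 0)" by (simp add: fun_eq_iff J_eq)
  show ?thesis unfolding koszul_eq d_zero J_zero by (simp add: fun_eq_iff lin_def)
qed

text \<open>Division by the factorial turns the factor \<open>n\<close> in \<open>d_P\<close> into a
  shift of the order.\<close>

lemma d_Q:
  assumes "form \<alpha>" "form \<beta>"
  shows "d (Q k \<alpha> \<beta>) c x vs - \<delta> (Q (k - 1) \<alpha> \<beta>) c x vs =
    Q k (d \<alpha>) \<beta> c x vs - Q (k - 1) (\<delta> \<alpha>) \<beta> c x vs
    + Q k (parity_inv \<alpha>) (d \<beta>) c x vs - Q (k - 1) (parity_inv \<alpha>) (\<delta> \<beta>) c x vs"
proof -
  note zero = d_zero koszul_zero
  consider "k < 0" | "k = 0" | n where "k = int (Suc n)"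
  proof -
    have "k = int (Suc (nat (k - 1)))" if "0 < k" using that by simp
    then show thesis using that by (meson linorder_neqE_linordered_idom)
  qed
  then show ?thesis
  proof cases
    case 1
    then show ?thesis by (simp add: Q_neg zero)
  next
    case 2
    show ?thesis
    proof -
      have "Q 0 \<alpha> \<beta> = P 0 \<alpha> \<beta>" for \<alpha> \<beta> by (simp add: fun_eq_iff Q_def)
      then show ?thesis using d_P[OF assms, of 0 c x vs] 2 by (simp add: Q_neg zero)
    qed
  next
    case 3
    then have k: "k = int (Suc n)" "k - 1 = int n" by simp_all
    have "d (Q k \<alpha> \<beta>) c x vs - \<delta> (Q (k - 1) \<alpha> \<beta>) c x vs
        = (d (P (Suc n) \<alpha> \<beta>) c x vs - real (Suc n) * \<delta> (P n \<alpha> \<beta>) c x vs) / fact (Suc n)"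
      unfolding k(2) unfolding k(1) Q_of_nat d_lin[OF form_P[OF assms] form_P[OF assms]] koszul_lin[OF form_P[OF assms] form_P[OF assms]]
      by (simp add: lin_def diff_divide_distrib del: of_nat_Suc)
    also have "\<dots> = (P (Suc n) (d \<alpha>) \<beta> c x vs - real (Suc n) * P n (\<delta> \<alpha>) \<beta> c x vs
        + P (Suc n) (parity_inv \<alpha>) (d \<beta>) c x vs - real (Suc n) * P n (parity_inv \<alpha>) (\<delta> \<beta>) c x vs) / fact (Suc n)"
      using d_P[OF assms, of "Suc n" c x vs] by simp
    finally show ?thesis
      unfolding k(2) unfolding k(1) Q_of_nat
      by (simp add: lin_def diff_divide_distrib add_divide_distrib del: of_nat_Suc)
  qed
qed

text \<open>A binomial coefficient over \<open>fact n\<close> is a product of inverse factorials.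
  Orders outside \<open>{0..s}\<close> contribute 0, so any larger finite range will do; this lets
  the ranges on the two sides be matched.\<close>

lemma Q_assoc:
  assumes "form \<alpha>" "form \<beta>" "form \<gamma>" "finite Z" "{0..s} \<subseteq> Z"
  shows "(\<Sum>m\<in>Z. Q (s - m) (Q m \<alpha> \<beta>) \<gamma> c x vs) = (\<Sum>m\<in>Z. Q (s - m) \<alpha> (Q m \<beta> \<gamma>) c x vs)"
proof -
  have Z: "(\<Sum>m\<in>Z. F m) = (\<Sum>m\<in>{0..s}. F m)" if "\<And>m. m < 0 \<or> s < m \<Longrightarrow> F m = 0" for F :: "int \<Rightarrow> real"
    using assms(4,5) that by (intro sum.mono_neutral_right) auto
  have "(\<Sum>m\<in>{0..s}. Q (s - m) (Q m \<alpha> \<beta>) \<gamma> c x vs) = (\<Sum>m\<in>{0..s}. Q (s - m) \<alpha> (Q m \<beta> \<gamma>) c x vs)"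
  proof (cases "s < 0")
    case False
    then obtain n where s: "s = int n" by (metis nonneg_int_cases not_less)
    have reindex: "(\<Sum>m\<in>{0..s}. F m) = (\<Sum>k\<le>n. F (int k))" for F :: "int \<Rightarrow> real"
    proof -
      have "{0..s} = int ` {..n}"
        unfolding s by (auto simp: image_iff intro: nonneg_int_cases)
      then show ?thesis by (simp add: sum.reindex)
    qed
    have choose: "real (n choose k) / fact n = 1 / (fact (n - k) * fact k)" if "k \<le> n" for k
      using binomial_fact[OF that, where ?'a = real] by (simp add: field_simps)
    have left: "Q (s - int k) (Q (int k) \<alpha> \<beta>) \<gamma> c x vs
        = (n choose k) * P (n - k) (P k \<alpha> \<beta>) \<gamma> c x vs / fact n" if "k \<le> n" for k
    proof -
      have "s - int k = int (n - k)" using that by (simp add: s of_nat_diff)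
      then have "Q (s - int k) (Q (int k) \<alpha> \<beta>) \<gamma> c x vs
          = P (n - k) (P k \<alpha> \<beta>) \<gamma> c x vs * (1 / (fact (n - k) * fact k))"
        by (simp add: Q_of_nat P_lin_left) (simp add: lin_def)
      then show ?thesis by (simp add: choose[OF that, symmetric])
    qed
    have right: "Q (s - int k) \<alpha> (Q (int k) \<beta> \<gamma>) c x vs
        = (n choose k) * P (n - k) \<alpha> (P k \<beta> \<gamma>) c x vs / fact n" if "k \<le> n" for k
    proof -
      have "s - int k = int (n - k)" using that by (simp add: s of_nat_diff)
      then have "Q (s - int k) \<alpha> (Q (int k) \<beta> \<gamma>) c x vs
          = P (n - k) \<alpha> (P k \<beta> \<gamma>) c x vs * (1 / (fact (n - k) * fact k))"
        by (simp add: Q_of_nat P_lin_right) (simp add: lin_def)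
      then show ?thesis by (simp add: choose[OF that, symmetric])
    qed
    show ?thesis
      using P_assoc[OF assms(1-3), of n c x vs]
      by (simp add: reindex left right sum_divide_distrib[symmetric])
  qed simp
  then show ?thesis by (subst (1 2) Z) (auto simp: Q_neg)
qed

lemma form_sum:
  assumes "\<And>i. i \<in> I \<Longrightarrow> form (f i)"
  shows "form (\<lambda>c x vs. \<Sum>i\<in>I. f i c x vs)"
  using assms
proof (induction I rule: infinite_finite_induct)
  case (insert i I)
  then have "form (lin 1 (f i) 1 (\<lambda>c x vs. \<Sum>i\<in>I. f i c x vs))" by (intro form_lin) auto
  moreover have "lin 1 (f i) 1 (\<lambda>c x vs. \<Sum>i\<in>I. f i c x vs) = (\<lambda>c x vs. \<Sum>i\<in>insert i I. f i c x vs)"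
    using insert.hyps by (simp add: fun_eq_iff lin_def)
  ultimately show ?case by simp
qed (simp_all add: form_zero)

text \<open>Enlarging the supports adds only zero terms, which gives different products a common
  index range.\<close>

lemma qwedge_eq:
  assumes "finite Z" "hsupp a \<subseteq> Z" "finite Z'" "hsupp b \<subseteq> Z'"
  shows "qwedge E w a b n = (\<lambda>c x vs. \<Sum>p\<in>Z. \<Sum>q\<in>Z'. Q (n - p - q) (a p) (b q) c x vs)"
proof (intro ext)
  fix c x vs
  have summand: "(if p + q \<le> n then qwedge_coeff E (w c x) (nat (n - p - q)) (a p c x) (b q c x) vs else 0)
      = Q (n - p - q) (a p) (b q) c x vs" for p q
    by (simp add: Q_def qwedge_coeff_eq[OF finite_E] P_def W_def[abs_def])
  have "qwedge E w a b n c x vs = (\<Sum>p\<in>hsupp a. \<Sum>q\<in>hsupp b. Q (n - p - q) (a p) (b q) c x vs)"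
    unfolding qwedge_def summand ..
  also have "\<dots> = (\<Sum>p\<in>hsupp a. \<Sum>q\<in>Z'. Q (n - p - q) (a p) (b q) c x vs)"
    using assms by (intro sum.cong refl sum.mono_neutral_left) (auto simp: notin_hsupp)
  also have "\<dots> = (\<Sum>p\<in>Z. \<Sum>q\<in>Z'. Q (n - p - q) (a p) (b q) c x vs)"
    using assms by (intro sum.mono_neutral_left) (auto simp: notin_hsupp)
  finally show "qwedge E w a b n c x vs = (\<Sum>p\<in>Z. \<Sum>q\<in>Z'. Q (n - p - q) (a p) (b q) c x vs)" .
qed

lemma qd_eq: "qd E \<A> w a n = lin 1 (d (a n)) (-1) (\<delta> (a (n - 1)))"
  by (simp add: fun_eq_iff qd_def lin_def)

abbreviation "laurent \<equiv> Omega_laurent \<A>"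

lemma laurentD:
  assumes "a \<in> laurent"
  shows "finite (hsupp a)" "form (a n)"
  using assms by (simp_all add: Omega_laurent_def)

section \<open>Supports and Laurent polynomials of forms\<close>

lemma hsupp_qd: "hsupp (qd E \<A> w a) \<subseteq> hsupp a \<union> (\<lambda>n. n + 1) ` hsupp a"
proof
  fix n assume n: "n \<in> hsupp (qd E \<A> w a)"
  show "n \<in> hsupp a \<union> (\<lambda>n. n + 1) ` hsupp a"
  proof (rule ccontr)
    assume "n \<notin> hsupp a \<union> (\<lambda>n. n + 1) ` hsupp a"
    then have "n \<notin> hsupp a" "n - 1 \<notin> hsupp a" by (auto simp: image_iff)
    then have "qd E \<A> w a n = (\<lambda>c x vs. 0)"
      by (simp add: qd_eq notin_hsupp d_zero koszul_zero fun_eq_iff lin_def)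
    with n show False by (simp add: hsupp_def)
  qed
qed

lemma hsupp_hlin: "hsupp (hlin r a s b) \<subseteq> hsupp a \<union> hsupp b"
  by (auto simp: hsupp_def hlin_def lin_def[abs_def])

lemma hsupp_hparity_inv: "hsupp (hparity_inv a) \<subseteq> hsupp a"
  by (auto simp: hsupp_def hparity_inv_def parity_inv_def[abs_def] grade_inv_def[abs_def])

text \<open>Orders beyond \<open>card E\<close> vanish, which keeps the support finite; the bound
  below by 0 keeps polynomials polynomial.\<close>

lemma hsupp_qwedge:
  assumes "a \<in> laurent" "b \<in> laurent"
  shows "hsupp (qwedge E w a b) \<subseteq> (\<lambda>(p, q, k). p + q + k) ` (hsupp a \<times> hsupp b \<times> {0..int (card E)})"
proof
  fix n assume n: "n \<in> hsupp (qwedge E w a b)"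
  show "n \<in> (\<lambda>(p, q, k). p + q + k) ` (hsupp a \<times> hsupp b \<times> {0..int (card E)})"
  proof (rule ccontr)
    assume not: "n \<notin> (\<lambda>(p, q, k). p + q + k) ` (hsupp a \<times> hsupp b \<times> {0..int (card E)})"
    have "Q (n - p - q) (a p) (b q) = (\<lambda>c x vs. 0)" if "p \<in> hsupp a" "q \<in> hsupp b" for p q
    proof (rule Q_eq_0[OF laurentD(2)[OF assms(2)]])
      show "n - p - q < 0 \<or> int (card E) < n - p - q"
      proof (rule ccontr)
        assume "\<not> (n - p - q < 0 \<or> int (card E) < n - p - q)"
        then have "(p, q, n - p - q) \<in> hsupp a \<times> hsupp b \<times> {0..int (card E)}" using that by auto
        moreover have "n = (\<lambda>(p, q, k). p + q + k) (p, q, n - p - q)" by simp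
        ultimately show False using not by blast
      qed
    qed
    then have "qwedge E w a b n = (\<lambda>c x vs. 0)"
      by (simp add: qwedge_eq[OF laurentD(1)[OF assms(1)] order_refl laurentD(1)[OF assms(2)] order_refl])
    with n show False by (simp add: hsupp_def)
  qed
qed

lemma laurent_qd: "a \<in> laurent \<Longrightarrow> qd E \<A> w a \<in> laurent"
  using finite_subset[OF hsupp_qd]
  by (auto simp: Omega_laurent_def qd_eq intro!: form_lin form_d form_koszul)

lemma laurent_hlin: "a \<in> laurent \<Longrightarrow> b \<in> laurent \<Longrightarrow> hlin r a s b \<in> laurent"
  using finite_subset[OF hsupp_hlin] by (auto simp: Omega_laurent_def hlin_def intro!: form_lin)

lemma laurent_hparity_inv: "a \<in> laurent \<Longrightarrow> hparity_inv a \<in> laurent"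
  using finite_subset[OF hsupp_hparity_inv]
  by (auto simp: Omega_laurent_def hparity_inv_def intro!: form_parity_inv)

lemma laurent_qwedge:
  assumes "a \<in> laurent" "b \<in> laurent"
  shows "qwedge E w a b \<in> laurent"
proof -
  have "form (qwedge E w a b n)" for n
    unfolding qwedge_eq[OF laurentD(1)[OF assms(1)] order_refl laurentD(1)[OF assms(2)] order_refl]
    by (intro form_sum form_Q laurentD(2) assms)
  then show ?thesis
    using finite_subset[OF hsupp_qwedge[OF assms]] laurentD(1)[OF assms(1)] laurentD(1)[OF assms(2)]
    by (simp add: Omega_laurent_def)
qed

lemma qd_hlin: "a \<in> laurent \<Longrightarrow> b \<in> laurent \<Longrightarrow>
    qd E \<A> w (hlin r a s b) = hlin r (qd E \<A> w a) s (qd E \<A> w b)"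
  by (simp add: fun_eq_iff qd_eq hlin_def d_lin koszul_lin laurentD(2)) (simp add: lin_def algebra_simps)

text \<open>The three powers of \<open>h\<close> give \<open>d d\<close>,
  \<open>d \<delta> + \<delta> d\<close> and \<open>\<delta> \<delta>\<close>.\<close>

lemma qd_qd:
  assumes "a \<in> laurent"
  shows "qd E \<A> w (qd E \<A> w a) = hzero"
proof (intro ext)
  fix n c x vs
  show "qd E \<A> w (qd E \<A> w a) n c x vs = 0"
    by (simp add: qd_eq d_lin koszul_lin form_d form_koszul laurentD(2)[OF assms])
      (simp add: lin_def d_d koszul_koszul d_koszul laurentD(2)[OF assms])
qed

lemma d_parity_inv:
  assumes "form \<alpha>"
  shows "d (parity_inv \<alpha>) c x vs = - parity_inv (d \<alpha>) c x vs"
proof (cases "c \<in> \<A> \<and> x \<in> chart_image c")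
  case True
  then have "differentiable_coeffs (\<alpha> c) x"
    using formD(2)[OF assms] by (blast intro: local_form_differentiable)
  from local_d_grade_inv[OF this] True show ?thesis
    by (simp add: d_eq parity_inv_def[abs_def])
next
  case False
  then show ?thesis by (simp add: d_outside parity_inv_def grade_inv_def)
qed

lemma koszul_parity_inv:
  assumes "form \<alpha>"
  shows "\<delta> (parity_inv \<alpha>) c x vs = - parity_inv (\<delta> \<alpha>) c x vs"
proof -
  have "d (parity_inv \<alpha>) = (\<lambda>c x vs. - parity_inv (d \<alpha>) c x vs)"
    by (intro ext d_parity_inv assms)
  then have "J (d (parity_inv \<alpha>)) c x vs = - parity_inv (J (d \<alpha>)) c x vs"
    by (simp add: J_eq flip: J_parity_inv)
  then show ?thesis
    by (simp add: koszul_eq lin_def J_parity_inv d_parity_inv form_J assms)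
      (simp add: parity_inv_def grade_inv_def lin_def algebra_simps)
qed

lemma qd_hparity_inv:
  assumes "a \<in> laurent" "qd E \<A> w a = hzero"
  shows "qd E \<A> w (hparity_inv a) = hzero"
proof (intro ext)
  fix n c x vs
  have "qd E \<A> w (hparity_inv a) n c x vs = - hparity_inv (qd E \<A> w a) n c x vs"
    by (simp add: qd_eq hparity_inv_def lin_def d_parity_inv koszul_parity_inv laurentD(2)[OF assms(1)])
      (simp add: parity_inv_def grade_inv_def lin_def algebra_simps)
  then show "qd E \<A> w (hparity_inv a) n c x vs = 0"
    by (simp add: assms(2) hparity_inv_def parity_inv_def grade_inv_def)
qed

lemma qwedge_hlin_left:
  assumes "a \<in> laurent" "a' \<in> laurent" "b \<in> laurent"
  shows "qwedge E w (hlin r a s a') b = hlin r (qwedge E w a b) s (qwedge E w a' b)"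
proof (rule ext)
  fix n
  let ?Z = "hsupp a \<union> hsupp a'"
  have Z: "finite ?Z" "finite (hsupp b)" using assms by (simp_all add: laurentD(1))
  show "qwedge E w (hlin r a s a') b n = hlin r (qwedge E w a b) s (qwedge E w a' b) n"
    unfolding hlin_def[of r "qwedge E w a b"] qwedge_eq[OF Z(1) hsupp_hlin Z(2) order_refl]
      qwedge_eq[OF Z(1) Un_upper1 Z(2) order_refl] qwedge_eq[OF Z(1) Un_upper2 Z(2) order_refl]
    by (simp add: fun_eq_iff hlin_def Q_lin_left) (simp add: lin_def sum.distrib sum_distrib_left)
qed

lemma qwedge_hlin_right:
  assumes "a \<in> laurent" "b \<in> laurent" "b' \<in> laurent"
  shows "qwedge E w a (hlin r b s b') = hlin r (qwedge E w a b) s (qwedge E w a b')"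
proof (rule ext)
  fix n
  let ?Z = "hsupp b \<union> hsupp b'"
  have Z: "finite ?Z" "finite (hsupp a)" using assms by (simp_all add: laurentD(1))
  show "qwedge E w a (hlin r b s b') n = hlin r (qwedge E w a b) s (qwedge E w a b') n"
    unfolding hlin_def[of r "qwedge E w a b"] qwedge_eq[OF Z(2) order_refl Z(1) hsupp_hlin]
      qwedge_eq[OF Z(2) order_refl Z(1) Un_upper1] qwedge_eq[OF Z(2) order_refl Z(1) Un_upper2]
    by (simp add: fun_eq_iff hlin_def Q_lin_right) (simp add: lin_def sum.distrib sum_distrib_left)
qed

lemma d_sum:
  assumes "finite I" "\<And>i. i \<in> I \<Longrightarrow> form (f i)"
  shows "d (\<lambda>c x vs. \<Sum>i\<in>I. f i c x vs) c x vs = (\<Sum>i\<in>I. d (f i) c x vs)"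
    "\<delta> (\<lambda>c x vs. \<Sum>i\<in>I. f i c x vs) c x vs = (\<Sum>i\<in>I. \<delta> (f i) c x vs)"
proof -
  have "d (\<lambda>c x vs. \<Sum>i\<in>I. f i c x vs) c x vs = (\<Sum>i\<in>I. d (f i) c x vs) \<and>
    \<delta> (\<lambda>c x vs. \<Sum>i\<in>I. f i c x vs) c x vs = (\<Sum>i\<in>I. \<delta> (f i) c x vs)"
    using assms
  proof (induction I rule: finite_induct)
    case empty
    then show ?case by (simp add: d_zero koszul_zero)
  next
    case (insert i I)
    let ?s = "\<lambda>c x vs. \<Sum>i\<in>I. f i c x vs"
    have "(\<lambda>c x vs. \<Sum>i\<in>insert i I. f i c x vs) = lin 1 (f i) 1 ?s"
      using insert.hyps by (simp add: fun_eq_iff lin_def)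
    moreover have "form (f i)" "form ?s" using insert.prems by (auto intro: form_sum)
    ultimately show ?case
      using insert by (simp add: d_lin koszul_lin) (simp add: lin_def)
  qed
  then show "d (\<lambda>c x vs. \<Sum>i\<in>I. f i c x vs) c x vs = (\<Sum>i\<in>I. d (f i) c x vs)"
    "\<delta> (\<lambda>c x vs. \<Sum>i\<in>I. f i c x vs) c x vs = (\<Sum>i\<in>I. \<delta> (f i) c x vs)" by auto
qed

lemma finite_shift: "finite S \<Longrightarrow> finite (S \<union> (\<lambda>n. n + 1) ` S)" for S :: "int set"
  by simp

text \<open>Reindexes the contribution of \<open>h \<delta>\<close>, which comes from one power
  lower. The first argument of \<open>F\<close> selects the form, which vanishes off the support;
  the second enters the order of the product.\<close>

lemma sum_shift:
  fixes F :: "int \<Rightarrow> int \<Rightarrow> real"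
  assumes "finite S" "\<And>p q. p \<notin> S \<Longrightarrow> F p q = 0"
  shows "(\<Sum>p\<in>S \<union> (\<lambda>n. n + 1) ` S. F (p - 1) (p - 1)) = (\<Sum>p\<in>S. F p p)"
proof -
  have "(\<Sum>p\<in>S \<union> (\<lambda>n. n + 1) ` S. F (p - 1) (p - 1)) = (\<Sum>p\<in>(\<lambda>n. n + 1) ` S. F (p - 1) (p - 1))"
  proof (rule sum.mono_neutral_right)
    show "\<forall>i\<in>(S \<union> (\<lambda>n. n + 1) ` S) - (\<lambda>n. n + 1) ` S. F (i - 1) (i - 1) = 0"
    proof
      fix i assume "i \<in> (S \<union> (\<lambda>n. n + 1) ` S) - (\<lambda>n. n + 1) ` S"
      then have "i - 1 \<notin> S" by (auto simp: image_iff dest: bspec[of S _ "i - 1"])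
      then show "F (i - 1) (i - 1) = 0" by (rule assms(2))
    qed
  qed (use assms in auto)
  also have "\<dots> = (\<Sum>p\<in>S. F p p)" by (simp add: sum.reindex inj_on_def)
  finally show ?thesis .
qed

text \<open>Coefficientwise this is \<open>d_Q\<close>. The sign involves form degrees only, since
  \<open>h\<close> has even degree.\<close>

lemma qd_qwedge:
  assumes "a \<in> laurent" "b \<in> laurent"
  shows "qd E \<A> w (qwedge E w a b)
    = hadd (qwedge E w (qd E \<A> w a) b) (qwedge E w (hparity_inv a) (qd E \<A> w b))"
proof (intro ext)
  fix n :: int and c x vs
  let ?A = "hsupp a" and ?B = "hsupp b"
  let ?A' = "?A \<union> (\<lambda>n. n + 1) ` ?A" and ?B' = "?B \<union> (\<lambda>n. n + 1) ` ?B"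
  note fin = laurentD(1)[OF assms(1)] laurentD(1)[OF assms(2)]
  note forms = laurentD(2)[OF assms(1)] laurentD(2)[OF assms(2)]
  let ?\<sigma> = parity_inv
  note zero = d_zero koszul_zero
  \<comment> \<open>The orders are expressed through the shifted index \<open>p - 1\<close> or
    \<open>q - 1\<close>, the shape that \<open>sum_shift\<close> expects.\<close>
  have idx: "n - (p - 1) - q - 1 = n - p - q" "n - p - (q - 1) - 1 = n - p - q" for p q
    by linarith+
  have ext: "(\<Sum>p\<in>S \<union> (\<lambda>n. n + 1) ` S. F p) = (\<Sum>p\<in>S. F p)"
    if "finite S" "\<And>p. p \<notin> S \<Longrightarrow> F p = 0" for S :: "int set" and F :: "int \<Rightarrow> real"
    using that by (intro sum.mono_neutral_right) auto
  have "qd E \<A> w (qwedge E w a b) n c x vs =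
      (\<Sum>p\<in>?A. \<Sum>q\<in>?B. d (Q (n - p - q) (a p) (b q)) c x vs - \<delta> (Q (n - p - q - 1) (a p) (b q)) c x vs)"
    unfolding qd_def qwedge_eq[OF fin(1) order_refl fin(2) order_refl]
    by (simp add: d_sum fin form_sum form_Q forms sum_subtractf algebra_simps)
  also have "\<dots> = (\<Sum>p\<in>?A. \<Sum>q\<in>?B. Q (n - p - q) (d (a p)) (b q) c x vs - Q (n - p - q - 1) (\<delta> (a p)) (b q) c x vs
      + Q (n - p - q) (?\<sigma> (a p)) (d (b q)) c x vs - Q (n - p - q - 1) (?\<sigma> (a p)) (\<delta> (b q)) c x vs)"
    by (simp only: d_Q forms)
  also have "\<dots> = qwedge E w (qd E \<A> w a) b n c x vs + qwedge E w (hparity_inv a) (qd E \<A> w b) n c x vs"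
  proof -
    have "qwedge E w (qd E \<A> w a) b n c x vs =
        (\<Sum>p\<in>?A'. \<Sum>q\<in>?B. Q (n - p - q) (d (a p)) (b q) c x vs)
        - (\<Sum>p\<in>?A'. \<Sum>q\<in>?B. Q (n - (p - 1) - q - 1) (\<delta> (a (p - 1))) (b q) c x vs)"
      unfolding qwedge_eq[OF finite_shift[OF fin(1)] hsupp_qd fin(2) order_refl] idx
      by (simp add: qd_eq Q_lin_left) (simp add: lin_def sum_subtractf)
    also have "(\<Sum>p\<in>?A'. \<Sum>q\<in>?B. Q (n - p - q) (d (a p)) (b q) c x vs)
        = (\<Sum>p\<in>?A. \<Sum>q\<in>?B. Q (n - p - q) (d (a p)) (b q) c x vs)"
      by (rule ext[OF fin(1)]) (simp add: notin_hsupp zero)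
    also have "(\<Sum>p\<in>?A'. \<Sum>q\<in>?B. Q (n - (p - 1) - q - 1) (\<delta> (a (p - 1))) (b q) c x vs)
        = (\<Sum>p\<in>?A. \<Sum>q\<in>?B. Q (n - p - q - 1) (\<delta> (a p)) (b q) c x vs)"
      by (rule sum_shift[OF fin(1), of "\<lambda>p p'. \<Sum>q\<in>?B. Q (n - p' - q - 1) (\<delta> (a p)) (b q) c x vs"])
        (simp add: notin_hsupp zero)
    finally have left: "qwedge E w (qd E \<A> w a) b n c x vs =
        (\<Sum>p\<in>?A. \<Sum>q\<in>?B. Q (n - p - q) (d (a p)) (b q) c x vs)
        - (\<Sum>p\<in>?A. \<Sum>q\<in>?B. Q (n - p - q - 1) (\<delta> (a p)) (b q) c x vs)" .
    have "qwedge E w (hparity_inv a) (qd E \<A> w b) n c x vs =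
        (\<Sum>p\<in>?A. \<Sum>q\<in>?B'. Q (n - p - q) (?\<sigma> (a p)) (d (b q)) c x vs)
        - (\<Sum>p\<in>?A. \<Sum>q\<in>?B'. Q (n - p - (q - 1) - 1) (?\<sigma> (a p)) (\<delta> (b (q - 1))) c x vs)"
      unfolding qwedge_eq[OF fin(1) hsupp_hparity_inv finite_shift[OF fin(2)] hsupp_qd] idx
      by (simp add: qd_eq Q_lin_right hparity_inv_def) (simp add: lin_def sum_subtractf)
    also have "(\<Sum>p\<in>?A. \<Sum>q\<in>?B'. Q (n - p - q) (?\<sigma> (a p)) (d (b q)) c x vs)
        = (\<Sum>p\<in>?A. \<Sum>q\<in>?B. Q (n - p - q) (?\<sigma> (a p)) (d (b q)) c x vs)"
      by (intro sum.cong refl ext[OF fin(2)]) (simp add: notin_hsupp zero)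
    also have "(\<Sum>p\<in>?A. \<Sum>q\<in>?B'. Q (n - p - (q - 1) - 1) (?\<sigma> (a p)) (\<delta> (b (q - 1))) c x vs)
        = (\<Sum>p\<in>?A. \<Sum>q\<in>?B. Q (n - p - q - 1) (?\<sigma> (a p)) (\<delta> (b q)) c x vs)"
    proof (rule sum.cong[OF refl])
      fix p
      show "(\<Sum>q\<in>?B'. Q (n - p - (q - 1) - 1) (?\<sigma> (a p)) (\<delta> (b (q - 1))) c x vs)
          = (\<Sum>q\<in>?B. Q (n - p - q - 1) (?\<sigma> (a p)) (\<delta> (b q)) c x vs)"
        by (rule sum_shift[OF fin(2), of "\<lambda>q q'. Q (n - p - q' - 1) (?\<sigma> (a p)) (\<delta> (b q)) c x vs"])
          (simp add: notin_hsupp zero)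
    qed
    finally show ?thesis unfolding left by (simp add: sum.distrib sum_subtractf)
  qed
  finally show "qd E \<A> w (qwedge E w a b) n c x vs
      = hadd (qwedge E w (qd E \<A> w a) b) (qwedge E w (hparity_inv a) (qd E \<A> w b)) n c x vs"
    by (simp add: hadd_def)
qed

lemma qwedge_commute:
  assumes "a \<in> laurent" "b \<in> laurent" "homogeneous k a" "homogeneous l b"
  shows "qwedge E w a b = hscale ((-1) powi (k * l)) (qwedge E w b a)"
proof (intro ext)
  fix n c x vs
  note fin = laurentD(1)[OF assms(1)] laurentD(1)[OF assms(2)]
  note forms = laurentD(2)[OF assms(1)] laurentD(2)[OF assms(2)]
  \<comment> \<open>The coefficient at the power \<open>p\<close> has degree
    \<open>m - 2 * p\<close>; \<open>nat \<bar>m\<bar>\<close> is a natural number of that parity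
    even for negative \<open>m\<close>.\<close>
  have parity: "has_parity (nat \<bar>m\<bar>) (f p c x)" if "homogeneous m f" for m p and f :: "('m, 'e) hform"
    unfolding has_parity_def
  proof (intro allI impI)
    fix us assume "f p c x us \<noteq> 0"
    then have "int (length us) = m - 2 * p" using that unfolding homogeneous_def by blast
    then have "even (int (length us + nat \<bar>m\<bar>))" by (cases "m \<ge> 0") auto
    then show "even (length us + nat \<bar>m\<bar>)" by simp
  qed
  have sign: "(-1 :: real) ^ (nat \<bar>k\<bar> * nat \<bar>l\<bar>) = (-1) powi (k * l)"
  proof -
    have "nat \<bar>k\<bar> * nat \<bar>l\<bar> = nat \<bar>k * l\<bar>" by (simp add: abs_mult nat_mult_distrib)
    then show ?thesis
      by (cases "k * l \<ge> 0") (simp_all add: power_int_def)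
  qed
  have "Q m (a p) (b q) c x vs = (-1) powi (k * l) * Q m (b q) (a p) c x vs" for m p q
    using P_commute[where n = "nat m" and \<alpha> = "a p" and \<beta> = "b q" and c = c and x = x and vs = vs,
        OF forms(1) forms(2) parity[OF assms(3), of p] parity[OF assms(4), of q]]
    by (simp add: Q_def sign)
  then have "qwedge E w a b n c x vs
      = (\<Sum>p\<in>hsupp a. \<Sum>q\<in>hsupp b. (-1) powi (k * l) * Q (n - q - p) (b q) (a p) c x vs)"
    unfolding qwedge_eq[OF fin(1) order_refl fin(2) order_refl]
    by (simp add: algebra_simps)
  also have "\<dots> = (\<Sum>q\<in>hsupp b. \<Sum>p\<in>hsupp a. (-1) powi (k * l) * Q (n - q - p) (b q) (a p) c x vs)"
    by (rule sum.swap)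
  finally show "qwedge E w a b n c x vs = hscale ((-1) powi (k * l)) (qwedge E w b a) n c x vs"
    unfolding hscale_def qwedge_eq[OF fin(2) order_refl fin(1) order_refl]
    by (simp add: sum_distrib_left)
qed

lemma qwedge_assoc:
  assumes "a \<in> laurent" "b \<in> laurent" "e \<in> laurent"
  shows "qwedge E w (qwedge E w a b) e = qwedge E w a (qwedge E w b e)"
proof (intro ext)
  fix n c x vs
  let ?A = "hsupp a" and ?B = "hsupp b" and ?C = "hsupp e"
  note fin = laurentD(1)[OF assms(1)] laurentD(1)[OF assms(2)] laurentD(1)[OF assms(3)]
  note forms = laurentD(2)[OF assms(1)] laurentD(2)[OF assms(2)] laurentD(2)[OF assms(3)]
  \<comment> \<open>\<open>X\<close> and \<open>Y\<close> pad the supports so that after translation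
    they contain every range \<open>{0..s}\<close> over which \<open>Q_assoc\<close> sums.\<close>
  define X where "X = hsupp (qwedge E w a b) \<union> (\<Union>p\<in>?A. \<Union>q\<in>?B. \<Union>r\<in>?C. (\<lambda>m. m + p + q) ` {0..n - p - q - r})"
  define Y where "Y = hsupp (qwedge E w b e) \<union> (\<Union>p\<in>?A. \<Union>q\<in>?B. \<Union>r\<in>?C. (\<lambda>m. m + q + r) ` {0..n - p - q - r})"
  have X: "finite X" "hsupp (qwedge E w a b) \<subseteq> X"
    unfolding X_def using fin laurentD(1)[OF laurent_qwedge[OF assms(1,2)]] by auto
  have Y: "finite Y" "hsupp (qwedge E w b e) \<subseteq> Y"
    unfolding Y_def using fin laurentD(1)[OF laurent_qwedge[OF assms(2,3)]] by auto
  have "qwedge E w (qwedge E w a b) e n c x vs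
      = (\<Sum>m\<in>X. \<Sum>r\<in>?C. \<Sum>p\<in>?A. \<Sum>q\<in>?B. Q (n - m - r) (Q (m - p - q) (a p) (b q)) (e r) c x vs)"
    unfolding qwedge_eq[OF X fin(3) order_refl] qwedge_eq[OF fin(1) order_refl fin(2) order_refl]
    by (simp only: Q_sum_left)
  also have "\<dots> = (\<Sum>r\<in>?C. \<Sum>p\<in>?A. \<Sum>q\<in>?B. \<Sum>m\<in>X. Q (n - m - r) (Q (m - p - q) (a p) (b q)) (e r) c x vs)"
    by (subst sum.swap, rule sum.cong[OF refl], subst sum.swap, rule sum.cong[OF refl], rule sum.swap)
  also have "\<dots> = (\<Sum>r\<in>?C. \<Sum>p\<in>?A. \<Sum>q\<in>?B. \<Sum>m\<in>Y. Q (n - p - m) (a p) (Q (m - q - r) (b q) (e r)) c x vs)"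
  proof (rule sum.cong[OF refl], rule sum.cong[OF refl], rule sum.cong[OF refl])
    fix r p q assume r: "r \<in> ?C" "p \<in> ?A" "q \<in> ?B"
    define s where "s = n - p - q - r"
    \<comment> \<open>A common range for both sides, of which only \<open>{0..s}\<close>
      contributes.\<close>
    define Z where "Z = (\<lambda>m. m - p - q) ` X \<union> (\<lambda>m. m - q - r) ` Y"
    have Zfin: "finite Z" unfolding Z_def using X Y by simp
    have subX: "{0..s} \<subseteq> (\<lambda>m. m - p - q) ` X"
    proof
      fix m assume "m \<in> {0..s}"
      then have "m + p + q \<in> X" unfolding X_def s_def using r by blast
      then have "m + p + q - p - q \<in> (\<lambda>m. m - p - q) ` X" by (rule imageI)
      then show "m \<in> (\<lambda>m. m - p - q) ` X" by simp
    qed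
    have subY: "{0..s} \<subseteq> (\<lambda>m. m - q - r) ` Y"
    proof
      fix m assume "m \<in> {0..s}"
      then have "m + q + r \<in> Y" unfolding Y_def s_def using r by blast
      then have "m + q + r - q - r \<in> (\<lambda>m. m - q - r) ` Y" by (rule imageI)
      then show "m \<in> (\<lambda>m. m - q - r) ` Y" by simp
    qed
    have extend: "(\<Sum>m\<in>T. F m) = (\<Sum>m\<in>Z. F m)"
      if "T \<subseteq> Z" "{0..s} \<subseteq> T" "\<And>m. m < 0 \<or> s < m \<Longrightarrow> F m = 0" for T and F :: "int \<Rightarrow> real"
    proof (rule sum.mono_neutral_left[OF Zfin that(1)], intro ballI that(3))
      fix i assume "i \<in> Z - T"
      then have "i \<notin> {0..s}" using that(2) by blast
      then show "i < 0 \<or> s < i" by auto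
    qed
    have "(\<Sum>m\<in>X. Q (n - m - r) (Q (m - p - q) (a p) (b q)) (e r) c x vs)
        = (\<Sum>m\<in>(\<lambda>m. m - p - q) ` X. Q (s - m) (Q m (a p) (b q)) (e r) c x vs)"
      by (simp add: sum.reindex inj_on_def s_def algebra_simps)
    also have "\<dots> = (\<Sum>m\<in>Z. Q (s - m) (Q m (a p) (b q)) (e r) c x vs)"
      by (rule extend[OF _ subX]) (auto simp: Z_def Q_neg)
    also have "\<dots> = (\<Sum>m\<in>Z. Q (s - m) (a p) (Q m (b q) (e r)) c x vs)"
      by (rule Q_assoc[OF forms Zfin]) (use subX in \<open>auto simp: Z_def\<close>)
    also have "\<dots> = (\<Sum>m\<in>(\<lambda>m. m - q - r) ` Y. Q (s - m) (a p) (Q m (b q) (e r)) c x vs)"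
      by (rule extend[OF _ subY, symmetric]) (auto simp: Z_def Q_neg)
    also have "\<dots> = (\<Sum>m\<in>Y. Q (n - p - m) (a p) (Q (m - q - r) (b q) (e r)) c x vs)"
      by (simp add: sum.reindex inj_on_def s_def algebra_simps)
    finally show "(\<Sum>m\<in>X. Q (n - m - r) (Q (m - p - q) (a p) (b q)) (e r) c x vs)
        = (\<Sum>m\<in>Y. Q (n - p - m) (a p) (Q (m - q - r) (b q) (e r)) c x vs)" .
  qed
  also have "\<dots> = (\<Sum>p\<in>?A. \<Sum>m\<in>Y. \<Sum>q\<in>?B. \<Sum>r\<in>?C. Q (n - p - m) (a p) (Q (m - q - r) (b q) (e r)) c x vs)"
  proof -
    let ?F = "\<lambda>p q r m. Q (n - p - m) (a p) (Q (m - q - r) (b q) (e r)) c x vs"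
    have "(\<Sum>r\<in>?C. \<Sum>p\<in>?A. \<Sum>q\<in>?B. \<Sum>m\<in>Y. ?F p q r m) = (\<Sum>p\<in>?A. \<Sum>r\<in>?C. \<Sum>q\<in>?B. \<Sum>m\<in>Y. ?F p q r m)"
      by (rule sum.swap)
    also have "\<dots> = (\<Sum>p\<in>?A. \<Sum>q\<in>?B. \<Sum>r\<in>?C. \<Sum>m\<in>Y. ?F p q r m)"
      by (intro sum.cong refl sum.swap)
    also have "\<dots> = (\<Sum>p\<in>?A. \<Sum>q\<in>?B. \<Sum>m\<in>Y. \<Sum>r\<in>?C. ?F p q r m)"
      by (intro sum.cong refl sum.swap)
    also have "\<dots> = (\<Sum>p\<in>?A. \<Sum>m\<in>Y. \<Sum>q\<in>?B. \<Sum>r\<in>?C. ?F p q r m)"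
      by (intro sum.cong refl sum.swap)
    finally show ?thesis .
  qed
  also have "\<dots> = qwedge E w a (qwedge E w b e) n c x vs"
    unfolding qwedge_eq[OF fin(1) order_refl Y] qwedge_eq[OF fin(2) order_refl fin(3) order_refl]
    by (simp only: Q_sum_right)
  finally show "qwedge E w (qwedge E w a b) e n c x vs = qwedge E w a (qwedge E w b e) n c x vs" .
qed

end

section \<open>Quantum de Rham cohomology\<close>

text \<open>Treats polynomial and Laurent coefficients at once; they differ only in a bound on the
  support, which all operations respect.\<close>

locale quantum_cohomology = poisson E M \<A> w
  for E :: "'e::real_inner set"
    and M :: "'m::{t2_space,second_countable_topology} set"
    and \<A> :: "('m, 'e) chart set"
    and w :: "('m, 'e) mvfield" +
  fixes S :: "('m, 'e) hform set"
  assumes S: "S = Omega_poly \<A> \<or> S = Omega_laurent \<A>"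
begin

abbreviation "D \<equiv> qd E \<A> w"
abbreviation mult (infixl "\<star>" 70) where "a \<star> b \<equiv> qwedge E w a b"
abbreviation "cls \<equiv> qclass E \<A> w S"

lemma S_laurent: "a \<in> S \<Longrightarrow> a \<in> laurent"
  using S by (auto simp: Omega_poly_def)

lemma S_I: "a \<in> laurent \<Longrightarrow> (S = Omega_poly \<A> \<Longrightarrow> hsupp a \<subseteq> {0..}) \<Longrightarrow> a \<in> S"
  using S by (auto simp: Omega_poly_def)

lemma S_hsupp: "a \<in> S \<Longrightarrow> S = Omega_poly \<A> \<Longrightarrow> hsupp a \<subseteq> {0..}"
  by (simp add: Omega_poly_def)

lemma S_qd:
  assumes "a \<in> S"
  shows "D a \<in> S"
proof (rule S_I[OF laurent_qd[OF S_laurent[OF assms]]])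
  assume "S = Omega_poly \<A>"
  from S_hsupp[OF assms this] show "hsupp (D a) \<subseteq> {0..}"
    by (intro subset_trans[OF hsupp_qd]) auto
qed

lemma S_hlin:
  assumes "a \<in> S" "b \<in> S"
  shows "hlin r a s b \<in> S"
proof (rule S_I[OF laurent_hlin[OF S_laurent[OF assms(1)] S_laurent[OF assms(2)]]])
  assume "S = Omega_poly \<A>"
  from S_hsupp[OF assms(1) this] S_hsupp[OF assms(2) this] show "hsupp (hlin r a s b) \<subseteq> {0..}"
    by (intro subset_trans[OF hsupp_hlin]) auto
qed

lemma S_hparity_inv:
  assumes "a \<in> S"
  shows "hparity_inv a \<in> S"
proof (rule S_I[OF laurent_hparity_inv[OF S_laurent[OF assms]]])
  assume "S = Omega_poly \<A>"
  from S_hsupp[OF assms this] show "hsupp (hparity_inv a) \<subseteq> {0..}"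
    by (rule subset_trans[OF hsupp_hparity_inv])
qed

lemma S_qwedge:
  assumes "a \<in> S" "b \<in> S"
  shows "a \<star> b \<in> S"
proof (rule S_I[OF laurent_qwedge[OF S_laurent[OF assms(1)] S_laurent[OF assms(2)]]])
  assume "S = Omega_poly \<A>"
  from S_hsupp[OF assms(1) this] S_hsupp[OF assms(2) this] show "hsupp (a \<star> b) \<subseteq> {0..}"
    by (intro subset_trans[OF hsupp_qwedge[OF S_laurent[OF assms(1)] S_laurent[OF assms(2)]]]) (auto simp: subset_iff)
qed

definition cocycles :: "('m, 'e) hform set" where
  "cocycles = {a \<in> S. D a = hzero}"

lemma qwedge_zero: "hzero \<star> a = hzero" "a \<star> hzero = hzero"
  by (simp_all add: fun_eq_iff qwedge_def hsupp_def)

lemma hadd_zero: "hadd a hzero = a" "hadd hzero a = a"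
  by (simp_all add: hadd_def)

text \<open>The exact elements form a subspace, so translation by one of them preserves each
  coset.\<close>

lemma cls_add_qd:
  assumes "v \<in> S"
  shows "cls (hadd u (D v)) = cls u"
proof -
  have lin: "D (hlin 1 g r v) = hlin 1 (D g) r (D v)" if "g \<in> S" for g r
    by (rule qd_hlin[OF S_laurent[OF that] S_laurent[OF assms]])
  have "hadd (hadd u (D v)) (D g) \<in> cls u" if "g \<in> S" for g
  proof -
    have "hadd (hadd u (D v)) (D g) = hadd u (D (hlin 1 g 1 v))"
      by (simp add: lin[OF that] fun_eq_iff hadd_def hlin_def lin_def)
    then show ?thesis unfolding qclass_def using S_hlin[OF that assms] by blast
  qed
  moreover have "hadd u (D g) \<in> cls (hadd u (D v))" if "g \<in> S" for g
  proof -
    have "hadd u (D g) = hadd (hadd u (D v)) (D (hlin 1 g (-1) v))"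
      by (simp add: lin[OF that] fun_eq_iff hadd_def hlin_def lin_def)
    then show ?thesis unfolding qclass_def using S_hlin[OF that assms] by blast
  qed
  ultimately show ?thesis unfolding qclass_def by blast
qed

lemma cocycle_add_qd:
  assumes "a \<in> cocycles" "g \<in> S"
  shows "hadd a (D g) \<in> cocycles"
proof -
  have "D (hadd a (D g)) = hadd (D a) (D (D g))"
    unfolding hadd_eq using assms by (intro qd_hlin S_laurent S_qd) (auto simp: cocycles_def)
  then show ?thesis
    using assms by (simp add: cocycles_def hadd_eq S_hlin S_qd qd_qd S_laurent)
      (simp add: fun_eq_iff hlin_def lin_def)
qed

lemma cocycle_qwedge:
  assumes "a \<in> cocycles" "b \<in> cocycles"
  shows "a \<star> b \<in> cocycles"
  using assms qd_qwedge[of a b]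
  by (simp add: cocycles_def S_qwedge S_laurent qwedge_zero hadd_zero)

lemma cls_cocycle: "x \<in> cls a \<Longrightarrow> a \<in> cocycles \<Longrightarrow> x \<in> cocycles \<and> cls x = cls a"
  by (auto simp: qclass_def[of _ _ _ _ a] cocycle_add_qd cls_add_qd)

lemma self_in_cls: "a \<in> cls a"
proof -
  have z: "hzero \<in> S"
    by (rule S_I) (auto simp: Omega_laurent_def hsupp_def form_zero)
  have "D hzero = hzero"
    by (simp add: fun_eq_iff qd_def d_zero koszul_zero)
  then have "a = hadd a (D hzero)" by (simp add: hadd_zero)
  then show ?thesis unfolding qclass_def using z by blast
qed

text \<open>For a cocycle \<open>b\<close> the Leibniz rule gives
  \<open>D (g \<star> b) = D g \<star> b\<close>, so a change of representative changes the product
  by an exact element.\<close>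

lemma cls_qwedge_left:
  assumes "a \<in> cocycles" "b \<in> cocycles" "x \<in> cls a"
  shows "cls (x \<star> b) = cls (a \<star> b)"
proof -
  obtain g where g: "g \<in> S" "x = hadd a (D g)" using assms(3) by (auto simp: qclass_def)
  have ab: "a \<in> S" "b \<in> S" "D b = hzero" using assms by (auto simp: cocycles_def)
  have "D (g \<star> b) = D g \<star> b"
    using qd_qwedge[OF S_laurent[OF g(1)] S_laurent[OF ab(2)]] by (simp add: ab qwedge_zero hadd_zero)
  moreover have "x \<star> b = hadd (a \<star> b) (D g \<star> b)"
    unfolding g(2) hadd_eq by (intro qwedge_hlin_left S_laurent S_qd ab g)
  ultimately show ?thesis using cls_add_qd[OF S_qwedge[OF g(1) ab(2)]] by simp
qed

text \<open>The Leibniz rule puts \<open>hparity_inv\<close> on the left factor. Starting from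
  \<open>hparity_inv a\<close>, again a cocycle, the involution undoes itself and yields
  \<open>a \<star> D g\<close>.\<close>

lemma cls_qwedge_right:
  assumes "a \<in> cocycles" "b \<in> cocycles" "y \<in> cls b"
  shows "cls (a \<star> y) = cls (a \<star> b)"
proof -
  obtain g where g: "g \<in> S" "y = hadd b (D g)" using assms(3) by (auto simp: qclass_def)
  have ab: "a \<in> S" "b \<in> S" "D a = hzero" using assms by (auto simp: cocycles_def)
  have "hparity_inv (hparity_inv a) = a"
    by (simp add: fun_eq_iff hparity_inv_def parity_inv_def[abs_def])
  then have "D (hparity_inv a \<star> g) = a \<star> D g"
    using qd_qwedge[OF S_laurent[OF S_hparity_inv[OF ab(1)]] S_laurent[OF g(1)]]
    by (simp add: qd_hparity_inv S_laurent ab qwedge_zero hadd_zero)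
  moreover have "a \<star> y = hadd (a \<star> b) (a \<star> D g)"
    unfolding g(2) hadd_eq by (intro qwedge_hlin_right S_laurent S_qd ab g)
  ultimately show ?thesis using cls_add_qd[OF S_qwedge[OF S_hparity_inv[OF ab(1)] g(1)]] by simp
qed

text \<open>All products of representatives lie in one class, so the union defining
  \<open>cup\<close> is a union of copies of one coset.\<close>

lemma cup_cls:
  assumes "a \<in> cocycles" "b \<in> cocycles"
  shows "cup E \<A> w S (cls a) (cls b) = cls (a \<star> b)"
proof -
  have "cls (x \<star> y) = cls (a \<star> b)" if "x \<in> cls a" "y \<in> cls b" for x y
    using cls_qwedge_left[OF assms(1) _ that(1), of y] cls_qwedge_right[OF assms that(2)]
      cls_cocycle[OF that(2) assms(2)] by simp
  then show ?thesis
    unfolding cup_def using self_in_cls[of a] self_in_cls[of b] by blast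
qed

lemma class_scale_cls:
  assumes "u \<in> S"
  shows "class_scale E \<A> w S r (cls u) = cls (hscale r u)"
proof -
  have "cls (hscale r x) = cls (hscale r u)" if x: "x \<in> cls u" for x
  proof -
    obtain g where g: "g \<in> S" "x = hadd u (D g)" using x by (auto simp: qclass_def)
    \<comment> \<open>The multiple of \<open>g\<close> by \<open>r\<close>, written as a combination
      so that linearity of \<open>D\<close> applies.\<close>
    have "D (hlin r g 0 g) = hlin r (D g) 0 (D g)"
      by (intro qd_hlin S_laurent g)
    then have "hscale r x = hadd (hscale r u) (D (hlin r g 0 g))"
      unfolding g(2) by (simp add: fun_eq_iff hadd_def hscale_def hlin_def lin_def distrib_left)
    then show ?thesis using cls_add_qd[OF S_hlin[OF g(1) g(1)]] by simp
  qed
  then show ?thesis unfolding class_scale_def using self_in_cls[of u] by blast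
qed

lemma qcohomology_eq: "qcohomology E \<A> w S = cls ` cocycles"
  by (simp add: qcohomology_def cocycles_def)

lemma cup_commute:
  assumes "\<alpha> \<in> qcohomology E \<A> w S" "\<beta> \<in> qcohomology E \<A> w S" "class_degree k \<alpha>" "class_degree l \<beta>"
  shows "cup E \<A> w S \<alpha> \<beta> = class_scale E \<A> w S ((-1) powi (k * l)) (cup E \<A> w S \<beta> \<alpha>)"
proof -
  \<comment> \<open>The homogeneous representative supplied by \<open>class_degree\<close> is a
    cocycle, as are all members of a cohomology class.\<close>
  have rep: "\<exists>a\<in>cocycles. homogeneous m a \<and> \<gamma> = cls a"
    if "\<gamma> \<in> qcohomology E \<A> w S" "class_degree m \<gamma>" for m \<gamma>
    using that cls_cocycle unfolding qcohomology_eq class_degree_def by blast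
  obtain a where a: "a \<in> cocycles" "homogeneous k a" "\<alpha> = cls a" using rep[OF assms(1,3)] by blast
  obtain b where b: "b \<in> cocycles" "homogeneous l b" "\<beta> = cls b" using rep[OF assms(2,4)] by blast
  have S: "a \<in> S" "b \<in> S" using a b by (auto simp: cocycles_def)
  show ?thesis
    using qwedge_commute[OF S_laurent[OF S(1)] S_laurent[OF S(2)] a(2) b(2)]
    by (simp add: a(3) b(3) cup_cls a(1) b(1) class_scale_cls S_qwedge S)
qed

lemma cup_assoc:
  assumes "\<alpha> \<in> qcohomology E \<A> w S" "\<beta> \<in> qcohomology E \<A> w S" "\<gamma> \<in> qcohomology E \<A> w S"
  shows "cup E \<A> w S (cup E \<A> w S \<alpha> \<beta>) \<gamma> = cup E \<A> w S \<alpha> (cup E \<A> w S \<beta> \<gamma>)"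
proof -
  obtain a b c where *: "a \<in> cocycles" "b \<in> cocycles" "c \<in> cocycles" "\<alpha> = cls a" "\<beta> = cls b" "\<gamma> = cls c"
    using assms unfolding qcohomology_eq by blast
  then have "a \<in> S" "b \<in> S" "c \<in> S" by (auto simp: cocycles_def)
  then show ?thesis by (simp add: * cup_cls cocycle_qwedge qwedge_assoc S_laurent)
qed

end

theorem theorem3:
  fixes E :: "'e::real_inner set"
    and M :: "'m::{t2_space,second_countable_topology} set"
    and \<A> :: "('m, 'e) chart set"
    and w :: "('m, 'e) mvfield"
  assumes "poisson_manifold E M \<A> w"
  shows
    "(\<forall>\<alpha>\<in>QH_poly E \<A> w. \<forall>\<beta>\<in>QH_poly E \<A> w. \<forall>a b. class_degree a \<alpha> \<and> class_degree b \<beta> \<longrightarrow>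
        cup_poly E \<A> w \<alpha> \<beta> =
        class_scale E \<A> w (Omega_poly \<A>) ((-1) powi (a * b)) (cup_poly E \<A> w \<beta> \<alpha>)) \<and>
     (\<forall>\<alpha>\<in>QH_poly E \<A> w. \<forall>\<beta>\<in>QH_poly E \<A> w. \<forall>\<gamma>\<in>QH_poly E \<A> w.
        cup_poly E \<A> w (cup_poly E \<A> w \<alpha> \<beta>) \<gamma> =
        cup_poly E \<A> w \<alpha> (cup_poly E \<A> w \<beta> \<gamma>)) \<and>
     (\<forall>\<alpha>\<in>QH_laurent E \<A> w. \<forall>\<beta>\<in>QH_laurent E \<A> w. \<forall>a b. class_degree a \<alpha> \<and> class_degree b \<beta> \<longrightarrow>
        cup_laurent E \<A> w \<alpha> \<beta> =
        class_scale E \<A> w (Omega_laurent \<A>) ((-1) powi (a * b)) (cup_laurent E \<A> w \<beta> \<alpha>)) \<and>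
     (\<forall>\<alpha>\<in>QH_laurent E \<A> w. \<forall>\<beta>\<in>QH_laurent E \<A> w. \<forall>\<gamma>\<in>QH_laurent E \<A> w.
        cup_laurent E \<A> w (cup_laurent E \<A> w \<alpha> \<beta>) \<gamma> =
        cup_laurent E \<A> w \<alpha> (cup_laurent E \<A> w \<beta> \<gamma>))"
proof -
  interpret poly: quantum_cohomology E M \<A> w "Omega_poly \<A>"
    using assms by unfold_locales simp_all
  interpret laurent: quantum_cohomology E M \<A> w "Omega_laurent \<A>"
    using assms by unfold_locales simp_all
  show ?thesis
    unfolding QH_poly_def QH_laurent_def cup_poly_def cup_laurent_def
    using poly.cup_commute poly.cup_assoc laurent.cup_commute laurent.cup_assoc by blast
qed

end
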